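(* Let $s,t\ge1$ and let $G$ be an LCK OT-like Lie group of type $(s,t)$. If $G$ admits a lattice, then $t=1$. Moreover, $G$ is associated to some OT manifold $X(K,U)$ of type $(s,1)$ and of simple type.
   Context: A lattice in a connected solvable Lie group $G$ is a discrete subgroup $\Gamma$ with $\Gamma\backslash G$ compact. LCK OT-like Lie groups. For $C=(c_{ij})\in \mathrm{Mat}_{t\times s}(\mathbb{C})$ with $\mathrm{Re}\,c_{1j}+\cdots+\mathrm{Re}\,c_{tj}=-\tfrac12$ for all $1\le j\le s$, define $\phi_C:\mathbb{R}^s\to \mathrm{GL}(\mathbb{R}^s\oplus\mathbb{C}^t)$ by $\phi_C(t_1,\dots,t_s)=\exp\big(\mathrm{diag}(t_1,\dots,t_s,(\sum_{j=1}^s c_{ij}t_j)_{i=1}^t)\big)$, and $G_C=\mathbb{R}^s\ltimes_{\phi_C}(\mathbb{R}^s\oplus\mathbb{C}^t)$ with product $(x_1,y_1)(x_2,y_2)=(x_1+x_2,\,y_1+\phi_C(x_1)y_2)$. A Lie group is LCK OT-like of type $(s,t)$ if it is isomorphic to $G_C$ for some $C$ with $\mathrm{Re}\,c_{ij}=-\tfrac1{2t}$ for all $1\le i\le t$, $1\le j\le s$. OT manifolds. Let $K$ be a number field of degree $n=s+2t$ over $\mathbb{Q}$ with exactly $s$ real embeddings $\sigma_1,\dots,\sigma_s$ and $2t$ complex (non-real) embeddings $\sigma_{s+1},\dots,\sigma_{s+2t}$, labelled so that $\sigma_{s+i}=\overline{\sigma_{s+t+i}}$ for $1\le i\le t$.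 Let $\mathcal{O}_K$ be its ring of integers and $\mathcal{O}_K^{\times,+}=\{u\in\mathcal{O}_K^\times: \sigma_i(u)>0,\ 1\le i\le s\}$. A subgroup $U\subset\mathcal{O}_K^{\times,+}$ is admissible if it has rank $s$ and $\{(\log\sigma_1(u),\dots,\log\sigma_s(u)):u\in U\}$ is a lattice in $\mathbb{R}^s$. For admissible $U$, the OT manifold of type $(s,t)$ is $X(K,U)=(\mathbb{H}^s\times\mathbb{C}^t)/(U\ltimes\mathcal{O}_K)$, where $\mathbb{H}$ is the upper half-plane, $a\in\mathcal{O}_K$ acts by translation by $(\sigma_1(a),\dots,\sigma_{s+t}(a))$ and $u\in U$ acts by coordinatewise multiplication by $(\sigma_1(u),\dots,\sigma_{s+t}(u))$. It is of simple type if $\mathbb{Q}(U)=K$. Associated groups. A Lie group $G$ is associated to $X(K,U)$ if, for some labelling $\sigma_1,\dots,\sigma_{s+2t}$ of the embeddings of $K$ with $\sigma_1,\dots,\sigma_s$ real and $\sigma_{s+1},\dots,\sigma_{s+2t}$ non-real satisfying $\sigma_{s+i}=\overline{\sigma_{s+t+i}}$ for $1\le i\le t$, some $\mathbb{Z}$-basis $(a_k)_{k=1}^s$ of $U$ and some $C=(c_{ij})\in\mathrm{Mat}_{t\times s}(\mathbb{C})$ satisfying $\sigma_{s+i}(a_k)=\exp\big(\sum_{j=1}^s c_{ij}\log\sigma_j(a_k)\big)$ for all $1\le i\le t$, $1\le k\le s$, one has $G\cong G_C$ (such a $C$ automatically satisfies $\sum_i\mathrm{Re}\,c_{ij}=-\tfrac12$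 for all $j$). *)

theory Defs
  imports
    "HOL-Analysis.Analysis"
    "HOL-Algebra.Algebraic_Closure_Type"
    "HOL-Algebra.Generated_Fields"
    "HOL-Computational_Algebra.Polynomial"
begin

section \<open>Smooth manifolds\<close>

text \<open>\<open>Ck_on k S f\<close> is meant for open \<open>S\<close>: \<open>f\<close> is of class $C^k$ on \<open>S\<close>.\<close>

primrec Ck_on ::
  "nat \<Rightarrow> 'a::euclidean_space set \<Rightarrow> ('a \<Rightarrow> 'b::euclidean_space) \<Rightarrow> bool" where
  "Ck_on 0 S f \<longleftrightarrow> continuous_on S f"
| "Ck_on (Suc k) S f \<longleftrightarrow>
     (\<forall>x\<in>S. f differentiable (at x)) \<and>
     (\<forall>v. Ck_on k S (\<lambda>x. frechet_derivative f (at x) v))"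

definition smooth_on :: "'a::euclidean_space set \<Rightarrow> ('a \<Rightarrow> 'b::euclidean_space) \<Rightarrow> bool" where
  "smooth_on S f \<longleftrightarrow> (\<forall>k. Ck_on k S f)"

text \<open>A chart \<open>(V, \<phi>)\<close> has domain \<open>V\<close>; only the values of \<open>\<phi>\<close> on \<open>V\<close> matter. The charts form
  an atlas, not necessarily a maximal one.\<close>

record ('a, 'e) manifold =
  mtop :: "'a topology"
  charts :: "('a set \<times> ('a \<Rightarrow> 'e)) set"

definition smooth_manifold :: "('a, 'e::euclidean_space) manifold \<Rightarrow> bool" where
  "smooth_manifold M \<longleftrightarrow>
     Hausdorff_space (mtop M) \<and> second_countable (mtop M) \<and>
     (\<forall>(V, \<phi>)\<in>charts M. openin (mtop M) V \<and> open (\<phi> ` V) \<and>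
        homeomorphic_map (subtopology (mtop M) V) (top_of_set (\<phi> ` V)) \<phi>) \<and>
     (\<Union>(V, \<phi>)\<in>charts M. V) = topspace (mtop M) \<and>
     (\<forall>(V, \<phi>)\<in>charts M. \<forall>(W, \<psi>)\<in>charts M. smooth_on (\<phi> ` (V \<inter> W)) (\<psi> \<circ> inv_into V \<phi>))"

definition smooth_map ::
  "('a, 'e::euclidean_space) manifold \<Rightarrow> ('b, 'f::euclidean_space) manifold
     \<Rightarrow> ('a \<Rightarrow> 'b) \<Rightarrow> bool" where
  "smooth_map M N f \<longleftrightarrow>
     continuous_map (mtop M) (mtop N) f \<and>
     (\<forall>(V, \<phi>)\<in>charts M. \<forall>(W, \<psi>)\<in>charts N.
        smooth_on (\<phi> ` {x \<in> V. f x \<in> W}) (\<psi> \<circ> f \<circ> inv_into V \<phi>))"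

definition prod_manifold ::
  "('a, 'e) manifold \<Rightarrow> ('b, 'f) manifold \<Rightarrow> ('a \<times> 'b, 'e \<times> 'f) manifold" where
  "prod_manifold M N =
     \<lparr> mtop = prod_topology (mtop M) (mtop N),
       charts = {(V \<times> W, map_prod \<phi> \<psi>) | V \<phi> W \<psi>. (V, \<phi>) \<in> charts M \<and> (W, \<psi>) \<in> charts N} \<rparr>"


section \<open>Lie groups and lattices\<close>

record ('a, 'e) lie = "'a monoid" +
  mfd :: "('a, 'e) manifold"

definition lie_group :: "('a, 'e::euclidean_space) lie \<Rightarrow> bool" where
  "lie_group G \<longleftrightarrow>
     group G \<and> smooth_manifold (mfd G) \<and> topspace (mtop (mfd G)) = carrier G \<and>
     smooth_map (prod_manifold (mfd G) (mfd G)) (mfd G) (\<lambda>(x, y). x \<otimes>\<^bsub>G\<^esub> y) \<and>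
     smooth_map (mfd G) (mfd G) (\<lambda>x. inv\<^bsub>G\<^esub> x)"

definition lie_isomorphic ::
  "('a, 'e::euclidean_space) lie \<Rightarrow> ('b, 'f::euclidean_space) lie \<Rightarrow> bool" where
  "lie_isomorphic G H \<longleftrightarrow>
     (\<exists>f \<in> iso G H. smooth_map (mfd G) (mfd H) f \<and>
        smooth_map (mfd H) (mfd G) (inv_into (carrier G) f))"

definition quotient_topology :: "'a topology \<Rightarrow> ('a \<Rightarrow> 'b) \<Rightarrow> 'b topology" where
  "quotient_topology T q =
     topology (\<lambda>W. W \<subseteq> q ` topspace T \<and> openin T {x \<in> topspace T. q x \<in> W})"

lemma openin_quotient_topology:
  "openin (quotient_topology T q) W \<longleftrightarrow>
     W \<subseteq> q ` topspace T \<and> openin T {x \<in> topspace T. q x \<in> W}"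
proof -
  let ?P = "\<lambda>W. W \<subseteq> q ` topspace T \<and> openin T {x \<in> topspace T. q x \<in> W}"
  have "istopology ?P"
    unfolding istopology_def
  proof (intro conjI allI impI)
    fix A B assume "?P A" "?P B"
    moreover have "{x \<in> topspace T. q x \<in> A \<inter> B} =
        {x \<in> topspace T. q x \<in> A} \<inter> {x \<in> topspace T. q x \<in> B}" by auto
    ultimately show "A \<inter> B \<subseteq> q ` topspace T"
      and "openin T {x \<in> topspace T. q x \<in> A \<inter> B}" by auto
  next
    fix \<K> assume *: "\<forall>A\<in>\<K>. ?P A"
    then show "\<Union>\<K> \<subseteq> q ` topspace T" by blast
    have "{x \<in> topspace T. q x \<in> \<Union>\<K>} = (\<Union>A\<in>\<K>. {x \<in> topspace T. q x \<in> A})" by auto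
    with * show "openin T {x \<in> topspace T. q x \<in> \<Union>\<K>}" by auto
  qed
  then show ?thesis
    unfolding quotient_topology_def by (simp add: topology_inverse')
qed

lemma topspace_quotient_topology: "topspace (quotient_topology T q) = q ` topspace T"
proof
  show "topspace (quotient_topology T q) \<subseteq> q ` topspace T"
    using openin_quotient_topology openin_topspace by metis
  have "{x \<in> topspace T. q x \<in> q ` topspace T} = topspace T" by auto
  then have "openin (quotient_topology T q) (q ` topspace T)"
    by (simp add: openin_quotient_topology)
  then show "q ` topspace T \<subseteq> topspace (quotient_topology T q)"
    by (rule openin_subset)
qed

lemma quotient_map_quotient_topology: "quotient_map T (quotient_topology T q) q"
  unfolding quotient_map_def
  by (auto simp: topspace_quotient_topology openin_quotient_topology)

text \<open>\<open>T\<close> is the topology of the group \<open>G\<close>. The space $\Gamma\backslash G$ consists of the cosets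
  $\Gamma g$, which are the values of the quotient map \<open>\<lambda>g. \<Gamma> #> g\<close>.\<close>

definition is_lattice :: "('a, 'm) monoid_scheme \<Rightarrow> 'a topology \<Rightarrow> 'a set \<Rightarrow> bool" where
  "is_lattice G T \<Gamma> \<longleftrightarrow>
     subgroup \<Gamma> G \<and>
     subtopology T \<Gamma> = discrete_topology \<Gamma> \<and>
     compact_space (quotient_topology T (\<lambda>g. \<Gamma> #>\<^bsub>G\<^esub> g))"


section \<open>OT-like Lie groups\<close>

text \<open>The integers \<open>s\<close> and \<open>t\<close> are the cardinalities of the index types \<open>'s\<close> and \<open>'t\<close>; a matrix
  in $\mathrm{Mat}_{t\times s}(\mathbb{C})$ has type \<open>complex^'s^'t\<close>. The matrix whose exponential defines
  $\phi_C$ is diagonal, so its exponential is written out.\<close>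

definition phi ::
  "complex^'s^'t \<Rightarrow> real^'s \<Rightarrow> (real^'s) \<times> (complex^'t) \<Rightarrow> (real^'s) \<times> (complex^'t)" where
  "phi C x = (\<lambda>(y, z).
     (\<chi> j. exp (x $ j) * y $ j,
      \<chi> i. exp (\<Sum>j\<in>UNIV. C $ i $ j * of_real (x $ j)) * z $ i))"

definition G_C ::
  "complex^'s^'t \<Rightarrow>
     ((real^'s) \<times> ((real^'s) \<times> (complex^'t)), (real^'s) \<times> ((real^'s) \<times> (complex^'t))) lie" where
  "G_C C =
     \<lparr> carrier = UNIV,
       mult = (\<lambda>(x1, y1) (x2, y2). (x1 + x2, y1 + phi C x1 y2)),
       one = 0,
       mfd = \<lparr> mtop = euclidean, charts = {(UNIV, id)} \<rparr> \<rparr>"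

text \<open>The condition on \<open>C\<close> forces $\sum_i \mathrm{Re}\,c_{ij} = -1/2$ for all \<open>j\<close>.\<close>

definition LCK_OT_like ::
  "'s::finite itself \<Rightarrow> 't::finite itself \<Rightarrow> ('a, 'e::euclidean_space) lie \<Rightarrow> bool" where
  "LCK_OT_like _ _ G \<longleftrightarrow>
     (\<exists>C :: complex^'s^'t.
        (\<forall>i j. Re (C $ i $ j) = - 1 / (2 * real CARD('t))) \<and> lie_isomorphic G (G_C C))"


section \<open>Number fields\<close>

text \<open>Number fields are realised as subfields of \<open>\<complex>\<close>, and their embeddings as functions that are
  \<open>undefined\<close> outside the field, so that distinct functions are distinct embeddings.\<close>

abbreviation CC :: "complex ring" where
  "CC \<equiv> ring_of_type_algebra"

definition number_field :: "complex set \<Rightarrow> nat \<Rightarrow> bool" where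
  "number_field K n \<longleftrightarrow> subfield K CC \<and> ring.dimension CC n \<rat> K"

definition embeddings :: "complex set \<Rightarrow> (complex \<Rightarrow> complex) set" where
  "embeddings K = ring_hom (CC\<lparr>carrier := K\<rparr>) CC \<inter> extensional K"

definition real_embedding :: "complex set \<Rightarrow> (complex \<Rightarrow> complex) \<Rightarrow> bool" where
  "real_embedding K \<sigma> \<longleftrightarrow> \<sigma> \<in> embeddings K \<and> \<sigma> ` K \<subseteq> \<real>"

text \<open>The indices $1,\dots,s$, $s+1,\dots,s+t$ and $s+t+1,\dots,s+2t$ of the embeddings are
  \<open>Inl j\<close>, \<open>Inr (Inl i)\<close> and \<open>Inr (Inr i)\<close>, respectively. The labelling is a bijection, so
  there are exactly \<open>s\<close> real and \<open>2 * t\<close> non-real embeddings.\<close>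

definition labelling ::
  "complex set \<Rightarrow> ('s::finite + 't::finite + 't \<Rightarrow> complex \<Rightarrow> complex) \<Rightarrow> bool" where
  "labelling K \<sigma> \<longleftrightarrow>
     bij_betw \<sigma> UNIV (embeddings K) \<and>
     (\<forall>j. real_embedding K (\<sigma> (Inl j))) \<and>
     (\<forall>i. \<not> real_embedding K (\<sigma> (Inr i))) \<and>
     (\<forall>i. \<forall>x\<in>K. \<sigma> (Inr (Inl i)) x = cnj (\<sigma> (Inr (Inr i)) x))"

definition O_K :: "complex set \<Rightarrow> complex set" where
  "O_K K = {x \<in> K. algebraic_int x}"

abbreviation O_K_units :: "complex set \<Rightarrow> complex monoid" where
  "O_K_units K \<equiv> units_of (CC\<lparr>carrier := O_K K\<rparr>)"

definition O_K_pos_units :: "complex set \<Rightarrow> complex set" where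
  "O_K_pos_units K =
     {u \<in> carrier (O_K_units K). \<forall>\<sigma>. real_embedding K \<sigma> \<longrightarrow> Re (\<sigma> u) > 0}"

definition mult_independent :: "complex set \<Rightarrow> bool" where
  "mult_independent B \<longleftrightarrow>
     (\<forall>m :: complex \<Rightarrow> int. (\<Prod>b\<in>B. b powi m b) = 1 \<longrightarrow> (\<forall>b\<in>B. m b = 0))"

definition has_rank :: "complex set \<Rightarrow> nat \<Rightarrow> bool" where
  "has_rank U r \<longleftrightarrow>
     (\<exists>B\<subseteq>U. finite B \<and> mult_independent B \<and> card B = r) \<and>
     (\<forall>B\<subseteq>U. finite B \<and> mult_independent B \<longrightarrow> card B \<le> r)"

definition Z_basis :: "complex set \<Rightarrow> ('s::finite \<Rightarrow> complex) \<Rightarrow> bool" where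
  "Z_basis U a \<longleftrightarrow>
     bij_betw (\<lambda>m :: 's \<Rightarrow> int. \<Prod>k\<in>UNIV. a k powi m k) UNIV U"

definition log_vec ::
  "('s::finite + 't::finite + 't \<Rightarrow> complex \<Rightarrow> complex) \<Rightarrow> complex \<Rightarrow> real^'s" where
  "log_vec \<sigma> u = (\<chi> j. ln (Re (\<sigma> (Inl j) u)))"

definition admissible ::
  "complex set \<Rightarrow> ('s::finite + 't::finite + 't \<Rightarrow> complex \<Rightarrow> complex) \<Rightarrow> complex set \<Rightarrow> bool" where
  "admissible K \<sigma> U \<longleftrightarrow>
     subgroup U (O_K_units K) \<and> U \<subseteq> O_K_pos_units K \<and> has_rank U CARD('s) \<and>
     is_lattice \<lparr> carrier = UNIV, mult = (+), one = 0 \<rparr> euclidean (log_vec \<sigma> ` U)"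


section \<open>OT manifolds and associated groups\<close>

definition HC :: "((complex^'s) \<times> (complex^'t)) set" where
  "HC = {(w, z). \<forall>j. Im (w $ j) > 0}"

definition OT_act ::
  "('s::finite + 't::finite + 't \<Rightarrow> complex \<Rightarrow> complex) \<Rightarrow> complex \<Rightarrow> complex
     \<Rightarrow> (complex^'s) \<times> (complex^'t) \<Rightarrow> (complex^'s) \<times> (complex^'t)" where
  "OT_act \<sigma> u a = (\<lambda>(w, z).
     (\<chi> j. \<sigma> (Inl j) u * w $ j + \<sigma> (Inl j) a,
      \<chi> i. \<sigma> (Inr (Inl i)) u * z $ i + \<sigma> (Inr (Inl i)) a))"

definition OT_orbit ::
  "complex set \<Rightarrow> complex set \<Rightarrow> ('s::finite + 't::finite + 't \<Rightarrow> complex \<Rightarrow> complex)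
     \<Rightarrow> (complex^'s) \<times> (complex^'t) \<Rightarrow> ((complex^'s) \<times> (complex^'t)) set" where
  "OT_orbit K U \<sigma> p = {OT_act \<sigma> u a p | u a. u \<in> U \<and> a \<in> O_K K}"

type_synonym ('s, 't) OT_space =
  "(((complex^'s) \<times> (complex^'t)) set, (complex^'s) \<times> (complex^'t)) manifold"

text \<open>The complex structure of the quotient is given by the atlas of local inverses of the
  projection.\<close>

definition OT_quotient ::
  "complex set \<Rightarrow> complex set \<Rightarrow> ('s::finite + 't::finite + 't \<Rightarrow> complex \<Rightarrow> complex)
     \<Rightarrow> ('s, 't) OT_space" where
  "OT_quotient K U \<sigma> =
     \<lparr> mtop = quotient_topology (top_of_set HC) (OT_orbit K U \<sigma>),
       charts = {(OT_orbit K U \<sigma> ` V, inv_into V (OT_orbit K U \<sigma>)) | V.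
                   open V \<and> V \<subseteq> HC \<and> inj_on (OT_orbit K U \<sigma>) V} \<rparr>"

text \<open>\<open>M\<close> is the OT manifold $X(K,U)$; its type is \<open>(CARD('s), CARD('t))\<close>.\<close>

definition OT_manifold :: "complex set \<Rightarrow> complex set \<Rightarrow> ('s::finite, 't::finite) OT_space \<Rightarrow> bool" where
  "OT_manifold K U M \<longleftrightarrow>
     number_field K (CARD('s) + 2 * CARD('t)) \<and>
     (\<exists>\<sigma> :: 's + 't + 't \<Rightarrow> complex \<Rightarrow> complex.
        labelling K \<sigma> \<and> admissible K \<sigma> U \<and> M = OT_quotient K U \<sigma>)"

definition simple_type :: "complex set \<Rightarrow> complex set \<Rightarrow> bool" where
  "simple_type K U \<longleftrightarrow> generate_field CC U = K"

definition OT_associated ::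
  "'s::finite itself \<Rightarrow> 't::finite itself \<Rightarrow> ('a, 'e::euclidean_space) lie
     \<Rightarrow> complex set \<Rightarrow> complex set \<Rightarrow> bool" where
  "OT_associated _ _ G K U \<longleftrightarrow>
     (\<exists>(\<sigma> :: 's + 't + 't \<Rightarrow> complex \<Rightarrow> complex) (a :: 's \<Rightarrow> complex) (C :: complex^'s^'t).
        labelling K \<sigma> \<and> Z_basis U a \<and>
        (\<forall>i k. \<sigma> (Inr (Inl i)) (a k) =
           exp (\<Sum>j\<in>UNIV. C $ i $ j * of_real (ln (Re (\<sigma> (Inl j) (a k)))))) \<and>
        lie_isomorphic G (G_C C))"

end

theory Submission
  imports Defs
begin

text \<open>Write \<open>\<chi>\<^sub>k\<close> for the \<open>s + 2t\<close> characters of \<open>\<real>\<^sup>s\<close> by which \<open>\<phi>\<close> acts on the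
  complexification of \<open>\<real>\<^sup>s \<oplus> \<complex>\<^sup>t\<close>. A lattice \<open>\<Gamma>\<close> meets \<open>\<real>\<^sup>s \<oplus> \<complex>\<^sup>t\<close> in a lattice \<open>\<Lambda>\<close> and projects
  to a lattice \<open>L\<close> of \<open>\<real>\<^sup>s\<close>, so for \<open>l \<in> L\<close> the numbers \<open>\<chi>\<^sub>k(l)\<close> are the eigenvalues of an integer
  matrix with unit determinant. The functionals \<open>ln \<bar>\<chi>\<^sub>k\<bar>\<close> sum to \<open>0\<close> and satisfy so few other linear
  relations that, for generic \<open>l\<close>, the characteristic polynomial is irreducible. If \<open>t \<ge> 2\<close>, then
  \<open>\<bar>\<chi>\<^sub>k(l)\<bar>\<^sup>2\<close>, for non-real \<open>\<chi>\<^sub>k\<close>, is in too many ways a product of two eigenvalues: all its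
  conjugates have the same absolute value, which is impossible since it is a unit different
  from 1. Finally \<open>K = \<rat>(\<chi>\<^sub>1(l))\<close> and \<open>U = \<chi>\<^sub>1(L)\<close> are the required number field and unit
  group; that \<open>U \<subseteq> K\<close> follows from the integrality of the traces \<open>\<Sum>\<^sub>k \<chi>\<^sub>k(l')\<close> for \<open>l' \<in> L\<close>.\<close>

text \<open>The projection of a discrete subgroup need not be discrete, and its intersection with a
  normal subgroup may be trivial. For the nilradical this is usually settled by Mostow's theorem;
  here commutators and cocompactness show that \<open>\<Lambda>\<close> spans, and \<open>L\<close>
  is discrete because it acts faithfully on \<open>\<Lambda>\<close>. There are few relations
  because the real characters give the coordinate functionals, while by the LCK condition all 2t
  non-real ones give the same functional, -1/(2t) times the sum of the coordinates. In a vanishing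
  subsum a coordinate is cancelled only by all the non-real terms together, and these call for every
  coordinate. That \<open>U\<close> lies in \<open>K\<close> needs an argument because the
  irreducible polynomial of one generic \<open>l\<close> says nothing directly about other elements
  of \<open>L\<close>. Inverting the trace form writes each \<open>\<chi>\<^sub>k(l')\<close> as
  g/m' evaluated at \<open>\<chi>\<^sub>k(l)\<close>, with integer polynomials g and m' that do not
  depend on k. By this uniformity the embeddings of \<open>K\<close> carry
  \<open>\<chi>\<^sub>1(l')\<close> to the other \<open>\<chi>\<^sub>k(l')\<close>.\<close>

no_notation fps_nth (infixl \<open>$\<close> 75)

section \<open>Discrete subgroups of Euclidean spaces\<close>

lemma diff_closed_int_sum:
  fixes D :: "'a::real_vector set"
  assumes "0 \<in> D" and diff: "\<And>x y. x \<in> D \<Longrightarrow> y \<in> D \<Longrightarrow> x - y \<in> D"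
  shows "x \<in> D \<Longrightarrow> y \<in> D \<Longrightarrow> x + y \<in> D"
    and "x \<in> D \<Longrightarrow> of_int n *\<^sub>R x \<in> D"
    and "(\<And>i. i \<in> A \<Longrightarrow> b i \<in> D) \<Longrightarrow> (\<Sum>i\<in>A. of_int (m i) *\<^sub>R b i) \<in> D"
proof -
  have neg: "- x \<in> D" if "x \<in> D" for x using diff[OF \<open>0 \<in> D\<close> that] by simp
  show plus: "x + y \<in> D" if "x \<in> D" "y \<in> D" for x y
    using diff[OF that(1) neg[OF that(2)]] by simp
  have natmult: "of_nat n *\<^sub>R x \<in> D" if "x \<in> D" for n x
    by (induction n) (use \<open>0 \<in> D\<close> plus that in \<open>auto simp: algebra_simps\<close>)
  show intmult: "of_int n *\<^sub>R x \<in> D" if "x \<in> D" for n x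
    by (cases n rule: int_cases2) (use natmult[OF that] neg in auto)
  show "(\<Sum>i\<in>A. of_int (m i) *\<^sub>R b i) \<in> D" if "\<And>i. i \<in> A \<Longrightarrow> b i \<in> D"
    using that by (induction A rule: infinite_finite_induct) (auto simp: \<open>0 \<in> D\<close> plus intmult)
qed

text \<open>Induction on the dimension: the new basis vector is one with the least positive
  coordinate modulo the span of the previous ones.\<close>

lemma discrete_subgroup_basis_aux:
  fixes D :: "'a::euclidean_space set"
  assumes "0 \<in> D" and add: "\<And>x y. x \<in> D \<Longrightarrow> y \<in> D \<Longrightarrow> x - y \<in> D"
    and "e > 0" and disc: "\<And>x. x \<in> D \<Longrightarrow> norm x < e \<Longrightarrow> x = 0"
    and "finite S" "independent S" "S \<subseteq> D"
  shows "\<exists>B. finite B \<and> B \<subseteq> D \<and> independent B \<and> span B = span S \<and>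
    D \<inter> span S \<subseteq> {\<Sum>b\<in>B. of_int (m b) *\<^sub>R b | m. True}"
  using assms(5-7)
proof (induction S rule: finite_induct)
  case empty
  show ?case by (intro exI[of _ "{}"]) (auto simp: independent_empty)
next
  case (insert v S)
  then have "independent S" "S \<subseteq> D" and vS: "v \<notin> span S" and "v \<in> D"
    using independent_insert[of v S] by auto
  with insert.IH obtain B where B: "finite B" "B \<subseteq> D" "independent B" "span B = span S"
    "D \<inter> span S \<subseteq> {\<Sum>b\<in>B. of_int (m b) *\<^sub>R b | m. True}" by blast
  have intmult: "of_int n *\<^sub>R x \<in> D" if "x \<in> D" for n x
    using diff_closed_int_sum(2)[OF assms(1,2) that] by blast
  have sumD: "(\<Sum>b\<in>B. of_int (m b) *\<^sub>R b) \<in> D" for m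
    using diff_closed_int_sum(3)[OF assms(1,2), of B "\<lambda>b. b" m] B(2) by blast
  have vB: "v \<notin> B" using vS B(4) span_base by metis
  have indep: "independent (insert v B)" using B vS independent_insert vB by metis
  obtain c :: "'a \<Rightarrow> real" where c: "linear c" "\<And>x. x \<in> insert v B \<Longrightarrow> c x = (if x = v then 1 else 0)"
    using linear_independent_extend[OF indep, of "\<lambda>x. if x = v then 1 else 0"] by blast
  have cS: "c x = 0" if "x \<in> span S" for x
  proof -
    have "x \<in> span B" using that B(4) by simp
    moreover have "c y = 0" if "y \<in> B" for y using c(2) that vB by auto
    ultimately show ?thesis using linear_eq_0_on_span[OF c(1)] by blast
  qed
  have cv: "c v = 1" using c(2) by simp
  define D' where "D' = D \<inter> span (insert v S)"
  have decomp: "x - c x *\<^sub>R v \<in> span S" if x: "x \<in> span (insert v S)" for x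
  proof -
    obtain k where k: "x - k *\<^sub>R v \<in> span S" using x span_breakdown_eq by blast
    then have "c (x - k *\<^sub>R v) = 0" by (rule cS)
    then have "c x = k" using c(1) cv by (simp add: linear_diff linear_scale)
    with k show ?thesis by simp
  qed
  \<comment> \<open>Subtracting integer multiples of the elements of \<open>B\<close> leaves
    \<open>c\<close> unchanged and brings the remaining coordinates into [0,1). So the finite set
    \<open>F\<close> realises every value of \<open>c\<close> on \<open>D'\<close> that lies in
    [-1,1], and a least positive value exists.\<close>
  define F where "F = {x \<in> D'. \<bar>c x\<bar> \<le> 1 \<and> norm (x - c x *\<^sub>R v) \<le> (\<Sum>b\<in>B. norm b)}"
  have "bounded F"
    unfolding bounded_iff
  proof (intro exI ballI)
    fix x assume x: "x \<in> F"
    have "norm x \<le> norm (x - c x *\<^sub>R v) + norm (c x *\<^sub>R v)" by (metis diff_add_cancel norm_triangle_ineq)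
    also have "\<dots> \<le> (\<Sum>b\<in>B. norm b) + 1 * norm v"
      using x by (intro add_mono) (auto simp: F_def intro: mult_right_mono mult_left_le_one_le)
    finally show "norm x \<le> (\<Sum>b\<in>B. norm b) + 1 * norm v" .
  qed
  moreover have "x = y" if "x \<in> F" "y \<in> F" "dist x y < e" for x y
    using disc[of "x - y"] that add by (auto simp: F_def D'_def dist_norm)
  ultimately have "uniform_discrete F \<and> bounded F"
    using \<open>e > 0\<close> unfolding uniform_discrete_def by blast
  then have "finite F" by (simp add: uniform_discrete_finite_iff)
  have red: "\<exists>y\<in>F. c y = c x" if x: "x \<in> D'" "\<bar>c x\<bar> \<le> 1" for x
  proof -
    have "x - c x *\<^sub>R v \<in> span B" using decomp x B(4) by (auto simp: D'_def)
    then obtain r where r: "x - c x *\<^sub>R v = (\<Sum>b\<in>B. r b *\<^sub>R b)"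
      using span_finite[OF B(1)] by auto
    define w where "w = (\<Sum>b\<in>B. of_int \<lfloor>r b\<rfloor> *\<^sub>R b)"
    have wS: "w \<in> span S" unfolding w_def B(4)[symmetric] by (intro span_sum span_scale span_base)
    have cw: "c (x - w) = c x" using c(1) cS[OF wS] by (simp add: linear_diff)
    have "x - w - c (x - w) *\<^sub>R v = (\<Sum>b\<in>B. frac (r b) *\<^sub>R b)"
      unfolding cw using r by (simp add: w_def frac_def algebra_simps sum_subtractf)
    also have "norm \<dots> \<le> (\<Sum>b\<in>B. norm b)"
    proof (intro sum_norm_le)
      fix b show "norm (frac (r b) *\<^sub>R b) \<le> norm b"
        using frac_lt_1[of "r b"] by (simp add: mult_left_le_one_le)
    qed
    finally have "norm (x - w - c (x - w) *\<^sub>R v) \<le> (\<Sum>b\<in>B. norm b)" .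
    moreover have "x - w \<in> D'"
      using x(1) add sumD[of "\<lambda>b. \<lfloor>r b\<rfloor>"] wS span_diff[of x "insert v S" w] span_mono[of S "insert v S"]
      by (auto simp: D'_def w_def)
    ultimately show ?thesis using cw x(2) by (intro bexI[of _ "x - w"]) (auto simp: F_def)
  qed
  have vD': "v \<in> D'" using \<open>v \<in> D\<close> by (simp add: D'_def span_base)
  define P where "P = {t \<in> c ` F. t > 0}"
  have "finite P" "P \<noteq> {}" using \<open>finite F\<close> red[OF vD'] cv by (force simp: P_def)+
  define c0 where "c0 = Min P"
  have "c0 \<in> P" using \<open>finite P\<close> \<open>P \<noteq> {}\<close> by (simp add: c0_def)
  then obtain x0 where x0: "x0 \<in> F" "c x0 = c0" "c0 > 0" by (auto simp: P_def)
  have "c0 \<le> 1" using x0 by (auto simp: F_def)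
  have x0D: "x0 \<in> D" "x0 \<in> span (insert v S)" using x0 by (auto simp: F_def D'_def)
  have least: "c x = 0" if x: "x \<in> D'" "0 \<le> c x" "c x < c0" for x
  proof (rule ccontr)
    assume "c x \<noteq> 0"
    then have "c x > 0" using that by simp
    obtain y where "y \<in> F" "c y = c x" using red[OF x(1)] x \<open>c0 \<le> 1\<close> by auto
    then have "c x \<in> P" using \<open>c x > 0\<close> unfolding P_def by (metis (mono_tags, lifting) imageI mem_Collect_eq)
    then have "c0 \<le> c x" using \<open>finite P\<close> by (simp add: c0_def)
    then show False using that by simp
  qed
  have x0S: "x0 \<notin> span B" using cS x0 B(4) by force
  have x0B: "x0 \<notin> B" using x0S span_base by blast
  have "independent (insert x0 B)" using B x0S x0B independent_insert by metis
  moreover have "span (insert x0 B) = span (insert v S)"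
  proof (rule span_eq[THEN iffD2], intro conjI)
    show "insert x0 B \<subseteq> span (insert v S)"
      using x0D B(4) span_mono[of S "insert v S"] span_base[of _ B] by auto
    have "v \<in> span (insert x0 B)"
    proof -
      have "x0 - c0 *\<^sub>R v \<in> span (insert x0 B)"
        using decomp[OF x0D(2)] x0 B(4) span_mono[of B "insert x0 B"] by auto
      moreover have "x0 \<in> span (insert x0 B)" by (simp add: span_base)
      ultimately have "x0 - (x0 - c0 *\<^sub>R v) \<in> span (insert x0 B)" by (rule span_diff[rotated])
      then have "(1/c0) *\<^sub>R (x0 - (x0 - c0 *\<^sub>R v)) \<in> span (insert x0 B)" by (rule span_scale)
      then show ?thesis using x0 by simp
    qed
    moreover have "S \<subseteq> span (insert x0 B)"
      using B(4) span_mono[of B "insert x0 B"] span_base[of _ S] by auto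
    ultimately show "insert v S \<subseteq> span (insert x0 B)" by simp
  qed
  moreover have "x \<in> {\<Sum>b\<in>insert x0 B. of_int (m b) *\<^sub>R b | m. True}" if x: "x \<in> D \<inter> span (insert v S)" for x
  proof -
    \<comment> \<open>Division with remainder by \<open>c0\<close>: the remainder \<open>y\<close>
      has \<open>c y\<close> in [0, \<open>c0\<close>), so \<open>c y = 0\<close> by
      minimality.\<close>
    define q where "q = \<lfloor>c x / c0\<rfloor>"
    define y where "y = x - of_int q *\<^sub>R x0"
    have yD: "y \<in> D'"
      using x x0D add intmult by (auto simp: y_def D'_def intro: span_diff span_scale)
    have cy: "c y = c x - of_int q * c0" using c(1) x0 by (simp add: y_def linear_diff linear_scale)
    have "of_int q \<le> c x / c0" "c x / c0 < of_int q + 1" by (auto simp: q_def)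
    then have "0 \<le> c y" "c y < c0" using x0(3) unfolding cy by (auto simp: field_simps)
    then have "c y = 0" using least yD by blast
    then have "y \<in> D \<inter> span S" using decomp[of y] yD by (simp add: D'_def)
    then obtain m :: "'a \<Rightarrow> int" where m: "y = (\<Sum>b\<in>B. of_int (m b) *\<^sub>R b)" using B(5) by blast
    have "(\<Sum>b\<in>insert x0 B. of_int ((m(x0 := q)) b) *\<^sub>R b) = of_int q *\<^sub>R x0 + y"
      using B(1) x0B by (auto simp: m intro!: sum.cong)
    also have "\<dots> = x" by (simp add: y_def)
    finally show ?thesis by blast
  qed
  ultimately show ?case using B x0D by (intro exI[of _ "insert x0 B"]) auto
qed

text \<open>Indexing the basis by a type lets it serve as the columns of a matrix, as in
  \<open>integral_matrices\<close>.\<close>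

proposition discrete_subgroup_basis:
  fixes D :: "'a::euclidean_space set"
  assumes "0 \<in> D" "\<And>x y. x \<in> D \<Longrightarrow> y \<in> D \<Longrightarrow> x - y \<in> D"
    and "e > 0" "\<And>x. x \<in> D \<Longrightarrow> norm x < e \<Longrightarrow> x = 0"
    and "span D = UNIV" "CARD('n) = DIM('a)"
  obtains b :: "'n::finite \<Rightarrow> 'a" where "inj b" "independent (range b)" "span (range b) = UNIV"
    "D = range (\<lambda>m. \<Sum>k\<in>UNIV. of_int (m k) *\<^sub>R b k)"
proof -
  obtain S where S: "S \<subseteq> D" "independent S" "D \<subseteq> span S"
    using maximal_independent_subset by metis
  then have "finite S" "span S = UNIV"
    using independent_bound assms(5) span_mono[OF S(3)] by (auto simp: span_span)
  with discrete_subgroup_basis_aux[OF assms(1-4) _ S(2,1)]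
  obtain B where B: "finite B" "B \<subseteq> D" "independent B" "span B = UNIV"
    "D \<subseteq> {\<Sum>b\<in>B. of_int (m b) *\<^sub>R b | m. True}" by auto
  have "card B = CARD('n)"
    using dim_eq_card[OF _ B(3), of UNIV] B(4) assms(6) by (simp add: dim_UNIV)
  then obtain b :: "'n::finite \<Rightarrow> 'a" where b: "bij_betw b UNIV B"
    using finite_same_card_bij[of "UNIV :: 'n::finite set" B] B(1) by auto
  then have rb: "range b = B" and "inj b" by (auto simp: bij_betw_def)
  have "(\<Sum>k\<in>UNIV. of_int (m k) *\<^sub>R b k) \<in> D" for m
    using diff_closed_int_sum(3)[OF assms(1,2), of UNIV b m] B(2) rb by blast
  moreover have "x \<in> range (\<lambda>m. \<Sum>k\<in>UNIV. of_int (m k) *\<^sub>R b k)" if x: "x \<in> D" for x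
  proof -
    obtain m :: "'a \<Rightarrow> int" where "x = (\<Sum>b\<in>B. of_int (m b) *\<^sub>R b)" using B(5) x by blast
    also have "\<dots> = (\<Sum>k\<in>UNIV. of_int ((m \<circ> b) k) *\<^sub>R b k)"
      using sum.reindex_bij_betw[OF b, of "\<lambda>b. of_int (m b) *\<^sub>R b"] by simp
    finally show ?thesis by blast
  qed
  ultimately have "D = range (\<lambda>m. \<Sum>k\<in>UNIV. of_int (m k) *\<^sub>R b k)" by auto
  with that \<open>inj b\<close> B rb show thesis by blast
qed

section \<open>Integer polynomials\<close>

abbreviation ipoly :: "int poly \<Rightarrow> complex poly" where
  "ipoly \<equiv> map_poly of_int"

lemma coeff_ipoly [simp]: "Polynomial.coeff (ipoly p) i = of_int (Polynomial.coeff p i)"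
  by (simp add: coeff_map_poly)

lemma ipoly_add: "ipoly (p + q) = ipoly p + ipoly q"
  by (rule poly_eqI) simp

lemma ipoly_smult: "ipoly (Polynomial.smult a p) = Polynomial.smult (of_int a) (ipoly p)"
  by (rule poly_eqI) simp

lemma ipoly_mult: "ipoly (p * q) = ipoly p * ipoly q"
  by (rule poly_eqI) (simp add: coeff_mult)

lemma degree_ipoly [simp]: "Polynomial.degree (ipoly p) = Polynomial.degree p"
  by (rule degree_map_poly) simp

lemma ipoly_eq_0_iff [simp]: "ipoly p = 0 \<longleftrightarrow> p = 0"
  by (simp add: poly_eq_iff)

lemma ipoly_pderiv: "ipoly (pderiv p) = pderiv (ipoly p)"
  by (rule poly_eqI) (simp add: coeff_pderiv)

text \<open>The primitive form of the minimal polynomial over the rationals. Divisibility is among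
  integer polynomials, so \<open>z\<close> determines \<open>m\<close> up to sign.\<close>

definition min_ipoly :: "complex \<Rightarrow> int poly \<Rightarrow> bool" where
  "min_ipoly z m \<longleftrightarrow> Polynomial.degree m > 0 \<and> poly (ipoly m) z = 0 \<and>
     (\<forall>f. poly (ipoly f) z = 0 \<longrightarrow> m dvd f)"

text \<open>An integer polynomial of least degree vanishing at \<open>z\<close> divides every other one up to a
  constant, by pseudo-division; once it is primitive, Gauss's lemma removes the constant.\<close>

lemma min_ipoly_exists:
  assumes "p \<noteq> 0" "poly (ipoly p) z = 0"
  obtains m where "min_ipoly z m"
proof -
  define d where "d = (LEAST d. \<exists>q. q \<noteq> 0 \<and> poly (ipoly q) z = 0 \<and> Polynomial.degree q = d)"
  have "\<exists>q. q \<noteq> 0 \<and> poly (ipoly q) z = 0 \<and> Polynomial.degree q = d"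
    unfolding d_def by (rule LeastI_ex) (use assms in blast)
  then obtain q where q: "q \<noteq> 0" "poly (ipoly q) z = 0" "Polynomial.degree q = d" by blast
  have least: "d \<le> Polynomial.degree r" if "r \<noteq> 0" "poly (ipoly r) z = 0" for r
    unfolding d_def by (rule Least_le) (use that in blast)
  define m where "m = primitive_part q"
  have "q = Polynomial.smult (content q) m" by (simp add: m_def)
  then have "poly (ipoly q) z = of_int (content q) * poly (ipoly m) z"
    by (metis ipoly_smult poly_smult)
  then have m: "m \<noteq> 0" "Polynomial.degree m = d" "poly (ipoly m) z = 0" "content m = 1"
    using q by (auto simp: m_def)
  have "d > 0"
  proof (rule ccontr)
    assume "\<not> d > 0"
    then obtain c where "m = [:c:]" using m(2) by (auto elim: degree_eq_zeroE)
    then show False using m by (simp add: map_poly_pCons)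
  qed
  moreover have "m dvd f" if f: "poly (ipoly f) z = 0" for f
  proof -
    obtain a h where ah: "a \<noteq> 0" "Polynomial.smult a f = m * h + pseudo_mod f m"
      using pseudo_mod(1)[OF m(1), of f] by blast
    have "pseudo_mod f m = 0"
    proof (rule ccontr)
      assume nz: "pseudo_mod f m \<noteq> 0"
      have "poly (ipoly (Polynomial.smult a f)) z = poly (ipoly m * ipoly h + ipoly (pseudo_mod f m)) z"
        using ah(2) by (metis ipoly_add ipoly_mult)
      then have "poly (ipoly (pseudo_mod f m)) z = 0" using f m by (simp add: ipoly_smult)
      then show False using least[OF nz] pseudo_mod(2)[OF m(1), of f] nz m by simp
    qed
    with ah have eq: "Polynomial.smult a f = m * h" by simp
    then have "content h = content (Polynomial.smult a f)" using m by (simp add: content_mult)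
    then have "a dvd content h" by simp
    then have "[:a:] dvd h" by (simp add: const_poly_dvd_iff_dvd_content)
    then obtain h' where "h = Polynomial.smult a h'" by (auto elim!: dvdE)
    with eq have "Polynomial.smult a f = Polynomial.smult a (m * h')" by simp
    then have "f = m * h'" using ah(1) by (metis smult_cancel)
    then show ?thesis by simp
  qed
  ultimately show thesis using that m unfolding min_ipoly_def by blast
qed

text \<open>Write \<open>m = k * h\<close> with \<open>k\<close> minimal for \<open>w\<close>. As
  \<open>h\<close> has smaller degree than \<open>m\<close>, it cannot vanish at \<open>z\<close>;
  so \<open>k\<close> does, \<open>m\<close> divides \<open>k\<close>, and the divisibility property
  of \<open>k\<close> passes to \<open>m\<close>.\<close>

lemma min_ipoly_conj:
  assumes "min_ipoly z m" "poly (ipoly m) w = 0"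
  shows "min_ipoly w m"
proof -
  have m: "Polynomial.degree m > 0" "poly (ipoly m) z = 0" "\<And>f. poly (ipoly f) z = 0 \<Longrightarrow> m dvd f"
    using assms(1) by (auto simp: min_ipoly_def)
  then have "m \<noteq> 0" by auto
  then obtain k where k: "min_ipoly w k" using min_ipoly_exists assms(2) by blast
  then obtain h where h: "m = k * h" using assms(2) unfolding min_ipoly_def dvd_def by blast
  have nz: "k \<noteq> 0" "h \<noteq> 0" using \<open>m \<noteq> 0\<close> h by auto
  have "poly (ipoly k) z = 0 \<or> poly (ipoly h) z = 0" using m(2) unfolding h ipoly_mult by simp
  then have "m dvd k"
  proof
    assume "poly (ipoly h) z = 0"
    then have "Polynomial.degree m \<le> Polynomial.degree h" using m(3) nz by (simp add: dvd_imp_degree_le)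
    then show ?thesis using k nz unfolding h by (simp add: degree_mult_eq min_ipoly_def)
  qed (rule m(3))
  then have "m dvd f" if "poly (ipoly f) w = 0" for f
    using that k by (meson dvd_trans min_ipoly_def)
  then show ?thesis using m assms(2) by (auto simp: min_ipoly_def)
qed

text \<open>By \<open>min_ipoly_conj\<close>, \<open>m\<close> is minimal for each of its roots; at
  a multiple root it would have to divide its own derivative.\<close>

lemma min_ipoly_rsquarefree:
  assumes "min_ipoly z m"
  shows "rsquarefree (ipoly m)"
  unfolding rsquarefree_roots
proof (intro allI notI)
  fix w assume w: "poly (ipoly m) w = 0 \<and> poly (pderiv (ipoly m)) w = 0"
  have m: "Polynomial.degree m > 0" using assms by (simp add: min_ipoly_def)
  have "m dvd pderiv m"
    using min_ipoly_conj[OF assms, of w] w unfolding min_ipoly_def ipoly_pderiv[symmetric] by blast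
  moreover have "pderiv m \<noteq> 0" using m by (simp add: pderiv_eq_0_iff)
  ultimately have "Polynomial.degree m \<le> Polynomial.degree (pderiv m)" by (rule dvd_imp_degree_le)
  then show False using m by (simp add: degree_pderiv)
qed

text \<open>As long as \<open>q\<close> vanishes at \<open>z\<close> it can be divided by
  \<open>m\<close>, and each division lowers the multiplicities at \<open>z\<close> and at
  \<open>w\<close> by exactly one, since both are simple roots of \<open>m\<close>.\<close>

lemma min_ipoly_order_le:
  assumes "min_ipoly z m" "poly (ipoly m) w = 0" "q \<noteq> 0"
  shows "Polynomial.order z (ipoly q) \<le> Polynomial.order w (ipoly q)"
proof -
  have m: "m \<noteq> 0" "poly (ipoly m) z = 0" using assms(1) by (auto simp: min_ipoly_def)
  have ord: "Polynomial.order z (ipoly m) = 1" "Polynomial.order w (ipoly m) = 1"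
    using rsquarefree_root_order[OF min_ipoly_rsquarefree[OF assms(1)]] m assms(2) by auto
  show ?thesis using assms(3)
  proof (induction "Polynomial.degree q" arbitrary: q rule: less_induct)
    case less
    show ?case
    proof (cases "poly (ipoly q) z = 0")
      case True
      then obtain h where h: "q = m * h" using assms(1) by (auto simp: min_ipoly_def dvd_def)
      then have nz: "h \<noteq> 0" using less by auto
      have "Polynomial.degree h < Polynomial.degree q"
        using assms(1) nz m h by (simp add: degree_mult_eq min_ipoly_def)
      with less nz have "Polynomial.order z (ipoly h) \<le> Polynomial.order w (ipoly h)" by blast
      then show ?thesis using nz m ord by (simp add: h ipoly_mult order_mult)
    qed (simp add: order_0I)
  qed
qed

text \<open>An integer factor of a polynomial with leading coefficient 1 and constant term 1 or -1
  has leading and constant coefficients 1 or -1; passing to \<open>- m\<close> corrects the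
  sign.\<close>

lemma monic_min_ipoly:
  assumes "Polynomial.lead_coeff p = 1" "\<bar>Polynomial.coeff p 0\<bar> = 1" "poly (ipoly p) z = 0"
  obtains m where "min_ipoly z m" "Polynomial.lead_coeff m = 1" "\<bar>Polynomial.coeff m 0\<bar> = 1"
    "\<And>w. poly (ipoly m) w = 0 \<Longrightarrow> poly (ipoly p) w = 0"
proof -
  have "p \<noteq> 0" using assms by auto
  then obtain m where m: "min_ipoly z m" using min_ipoly_exists assms(3) by blast
  then obtain h where h: "p = m * h" using assms(3) by (auto simp: min_ipoly_def dvd_def)
  have "Polynomial.lead_coeff m * Polynomial.lead_coeff h = 1" using assms(1) by (simp add: h lead_coeff_mult)
  then have lm: "Polynomial.lead_coeff m = 1 \<or> Polynomial.lead_coeff m = -1" by (auto simp: zmult_eq_1_iff)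
  have "\<bar>Polynomial.coeff m 0\<bar> * \<bar>Polynomial.coeff h 0\<bar> = 1" using assms(2) by (simp add: h coeff_mult_0 abs_mult)
  then have cm: "\<bar>Polynomial.coeff m 0\<bar> = 1" by (auto simp: zmult_eq_1_iff)
  have rt: "poly (ipoly p) w = 0" if "poly (ipoly m) w = 0" for w
    using that by (simp add: h ipoly_mult)
  show thesis
  proof (cases "Polynomial.lead_coeff m = 1")
    case True
    with that m cm rt show ?thesis by blast
  next
    case False
    have "ipoly (- m) = - ipoly m" by (rule poly_eqI) simp
    then have "min_ipoly z (- m)" using m by (simp add: min_ipoly_def)
    then show ?thesis
    proof (rule that[of "- m"])
      show "Polynomial.lead_coeff (- m) = 1" using False lm by simp
      show "\<bar>Polynomial.coeff (- m) 0\<bar> = 1" using cm by simp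
    qed (use rt \<open>ipoly (- m) = - ipoly m\<close> in simp)
  qed
qed

lemma min_ipoly_roots:
  assumes "min_ipoly z m" "Polynomial.lead_coeff m = 1"
  shows "ipoly m = (\<Prod>w | poly (ipoly m) w = 0. [:- w, 1:])"
    and "finite {w. poly (ipoly m) w = 0}"
    and "card {w. poly (ipoly m) w = 0} = Polynomial.degree m"
    and "\<bar>Polynomial.coeff m 0\<bar> = 1 \<Longrightarrow> (\<Prod>w | poly (ipoly m) w = 0. cmod w) = 1"
proof -
  have "Polynomial.lead_coeff (ipoly m) = 1" using assms(2) by simp
  then show eq: "ipoly m = (\<Prod>w | poly (ipoly m) w = 0. [:- w, 1:])"
    using complex_poly_decompose_rsquarefree[OF min_ipoly_rsquarefree[OF assms(1)]] by simp
  have "ipoly m \<noteq> 0" using assms(2) by auto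
  then show "finite {w. poly (ipoly m) w = 0}" by (rule poly_roots_finite)
  have "Polynomial.degree (ipoly m) = card {w. poly (ipoly m) w = 0}"
    by (subst eq) (simp add: degree_prod_sum_eq)
  then show "card {w. poly (ipoly m) w = 0} = Polynomial.degree m" by simp
  assume c: "\<bar>Polynomial.coeff m 0\<bar> = 1"
  have "of_int (Polynomial.coeff m 0) = poly (ipoly m) 0" by (simp add: poly_0_coeff_0)
  also have "\<dots> = (\<Prod>w | poly (ipoly m) w = 0. - w)" by (subst eq) (simp add: poly_prod)
  finally have "cmod (of_int (Polynomial.coeff m 0)) = cmod (\<Prod>w | poly (ipoly m) w = 0. - w)"
    by (rule arg_cong)
  also have "\<dots> = (\<Prod>w | poly (ipoly m) w = 0. cmod (- w))" by (rule prod_norm[symmetric])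
  also have "\<dots> = (\<Prod>w | poly (ipoly m) w = 0. cmod w)" by simp
  finally have "cmod (of_int (Polynomial.coeff m 0)) = (\<Prod>w | poly (ipoly m) w = 0. cmod w)" .
  then show "(\<Prod>w | poly (ipoly m) w = 0. cmod w) = 1"
    using c by (metis norm_of_int of_int_1 of_int_abs)
qed

lemma order_prod_linear:
  assumes "finite I"
  shows "Polynomial.order w (\<Prod>i\<in>I. [:- d i, 1:]) = card {i \<in> I. d i = (w::complex)}"
  using assms
proof induction
  case (insert i I)
  have "Polynomial.order w [:- d i, 1:] = (if d i = w then 1 else 0)"
    using order_power_n_n[of w 1] order_0I[of "[:- d i, 1:]" w] by (cases "d i = w") auto
  moreover have "{j \<in> insert i I. d j = w} =
      (if d i = w then insert i {j \<in> I. d j = w} else {j \<in> I. d j = w})" by auto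
  moreover have "Polynomial.order w ([:- d i, 1:] * (\<Prod>i\<in>I. [:- d i, 1:])) =
      Polynomial.order w [:- d i, 1:] + Polynomial.order w (\<Prod>i\<in>I. [:- d i, 1:])"
    by (intro order_mult) (use insert in \<open>simp del: mult_pCons_left\<close>)
  ultimately show ?case using insert by (simp del: mult_pCons_left)
qed simp

section \<open>Spectra of integer matrices\<close>

lemma det_hom:
  fixes h :: "'a::comm_ring_1 \<Rightarrow> 'b::comm_ring_1" and A :: "'a^'n^'n"
  assumes "h 0 = 0" "h 1 = 1" "\<And>x y. h (x + y) = h x + h y" "\<And>x y. h (x * y) = h x * h y"
  shows "det (\<chi> i j. h (A $ i $ j)) = h (det A)"
proof -
  have hs: "h (sum f S) = (\<Sum>x\<in>S. h (f x))" for f :: "('n \<Rightarrow> 'n) \<Rightarrow> 'a" and S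
    by (induction S rule: infinite_finite_induct) (auto simp: assms)
  have hp: "h (prod f S) = (\<Prod>x\<in>S. h (f x))" for f :: "'n \<Rightarrow> 'a" and S
    by (induction S rule: infinite_finite_induct) (auto simp: assms)
  have "h (-1) = -1"
    using assms(3)[of 1 "-1"] assms(1,2) by (simp add: eq_neg_iff_add_eq_0 add.commute)
  then have hsgn: "h (of_int (sign p)) = of_int (sign p)" for p :: "'n \<Rightarrow> 'n"
    using assms(2) by (cases p rule: sign_cases) auto
  show ?thesis by (simp add: det_def hs hp assms(4) hsgn)
qed

text \<open>Row \<open>k\<close> of \<open>B\<close> is a left eigenvector of \<open>M\<close> with
  eigenvalue \<open>d k\<close>. Hence (X - diag d) B = B (X - M) over the complex polynomials;
  taking determinants and cancelling \<open>det B\<close> identifies the product with the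
  characteristic polynomial of \<open>M\<close>.\<close>

lemma integral_charpoly:
  fixes B :: "complex^'n^'n" and M :: "int^'n^'n" and d :: "'n \<Rightarrow> complex"
  assumes "det B \<noteq> 0" "\<And>k m. d k * B $ k $ m = (\<Sum>p\<in>UNIV. B $ k $ p * of_int (M $ p $ m))"
  shows "\<exists>P. ipoly P = (\<Prod>k\<in>UNIV. [:- d k, 1:])"
proof -
  define N :: "int poly^'n^'n" where
    "N = (\<chi> i j. (if i = j then [:0, 1:] else 0) - [:M $ i $ j:])"
  define Y :: "complex poly^'n^'n" where "Y = (\<chi> i j. if i = j then [:- d i, 1:] else 0)"
  define B' :: "complex poly^'n^'n" where "B' = (\<chi> i j. [:B $ i $ j:])"
  define N' :: "complex poly^'n^'n" where "N' = (\<chi> i j. ipoly (N $ i $ j))"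
  have N': "N' $ p $ m = (if p = m then [:0, 1:] else 0) - [:of_int (M $ p $ m):]" for p m
    by (rule poly_eqI) (simp add: N'_def N_def coeff_pCons split: nat.split)
  have "Y ** B' = B' ** N'"
  proof (simp add: vec_eq_iff matrix_matrix_mult_def, intro allI)
    fix k m
    have "(\<Sum>p\<in>UNIV. Y $ k $ p * B' $ p $ m) = (\<Sum>p\<in>UNIV. if p = k then [:- d k, 1:] * [:B $ k $ m:] else 0)"
      by (rule sum.cong) (auto simp: Y_def B'_def)
    also have "\<dots> = [:0, 1:] * [:B $ k $ m:] - [:d k * B $ k $ m:]" by (simp add: algebra_simps)
    also have "[:d k * B $ k $ m:] = (\<Sum>p\<in>UNIV. [:B $ k $ p * of_int (M $ p $ m):])"
      unfolding assms(2) by (rule poly_eqI) (simp add: coeff_sum coeff_pCons split: nat.split)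
    also have "[:0, 1:] * [:B $ k $ m:] = (\<Sum>p\<in>UNIV. if p = m then [:B $ k $ p:] * [:0, 1:] else 0)"
      by (simp add: algebra_simps)
    also have "(\<Sum>p\<in>UNIV. if p = m then [:B $ k $ p:] * [:0, 1:] else 0) -
        (\<Sum>p\<in>UNIV. [:B $ k $ p * of_int (M $ p $ m):]) = (\<Sum>p\<in>UNIV. B' $ k $ p * N' $ p $ m)"
      unfolding sum_subtractf[symmetric] by (rule sum.cong) (auto simp: N' B'_def algebra_simps)
    finally show "(\<Sum>p\<in>UNIV. Y $ k $ p * B' $ p $ m) = (\<Sum>p\<in>UNIV. B' $ k $ p * N' $ p $ m)" .
  qed
  then have "det (Y ** B') = det (B' ** N')" by simp
  then have "det Y * det B' = det B' * det N'" by (simp only: det_mul)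
  moreover have "det B' = [:det B:]"
    unfolding B'_def by (rule det_hom) (auto simp: one_pCons)
  ultimately have "Polynomial.smult (det B) (det Y) = Polynomial.smult (det B) (det N')"
    by simp
  then have "det N' = det Y" using assms(1) by (metis smult_cancel)
  moreover have "det N' = ipoly (det N)"
    unfolding N'_def by (rule det_hom) (auto simp: ipoly_add ipoly_mult)
  moreover have "det Y = (\<Prod>k\<in>UNIV. [:- d k, 1:])"
    by (subst det_diagonal) (auto simp: Y_def)
  ultimately show ?thesis by metis
qed

lemma integral_trace:
  fixes B :: "complex^'n^'n" and M :: "int^'n^'n" and d :: "'n \<Rightarrow> complex"
  assumes "det B \<noteq> 0" "\<And>k m. d k * B $ k $ m = (\<Sum>p\<in>UNIV. B $ k $ p * of_int (M $ p $ m))"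
  shows "(\<Sum>k\<in>UNIV. d k) \<in> \<int>"
proof -
  define D :: "complex^'n^'n" where "D = (\<chi> i j. if i = j then d i else 0)"
  define M' :: "complex^'n^'n" where "M' = (\<chi> i j. of_int (M $ i $ j))"
  obtain B' where B': "B ** B' = mat 1" "B' ** B = mat 1"
    using assms(1) by (auto simp: invertible_det_nz[symmetric] invertible_def)
  have "D ** B = B ** M'"
  proof (simp add: vec_eq_iff matrix_matrix_mult_def, intro allI)
    fix k m
    have "(\<Sum>p\<in>UNIV. D $ k $ p * B $ p $ m) = (\<Sum>p\<in>UNIV. if p = k then d k * B $ k $ m else 0)"
      by (rule sum.cong) (auto simp: D_def)
    then show "(\<Sum>p\<in>UNIV. D $ k $ p * B $ p $ m) = (\<Sum>p\<in>UNIV. B $ k $ p * M' $ p $ m)"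
      by (simp add: assms(2) M'_def)
  qed
  then have "(B ** M') ** B' = D ** (B ** B')"
    by (simp add: matrix_mul_assoc)
  then have "(B ** M') ** B' = D" by (simp add: B')
  then have "trace D = trace (B' ** (B ** M'))"
    by (simp add: trace_mul_sym)
  also have "B' ** (B ** M') = M'"
    by (simp add: matrix_mul_assoc B')
  finally have "trace D = trace M'" .
  moreover have "trace D = (\<Sum>k\<in>UNIV. d k)" "trace M' \<in> \<int>"
    by (auto simp: trace_def D_def M'_def)
  ultimately show ?thesis by simp
qed

text \<open>The coefficients of the quotients \<open>m(X) / (X - \<gamma>\<^sub>k)\<close> are integer polynomials in \<open>\<gamma>\<^sub>k\<close>, by Horner's
  scheme.\<close>

lemma trace_dual:
  fixes m :: "int poly" and \<gamma> c :: "'n::finite \<Rightarrow> complex"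
  assumes m: "ipoly m = (\<Prod>k\<in>UNIV. [:- \<gamma> k, 1:])"
    and c: "\<And>j. (\<Sum>k\<in>UNIV. c k * \<gamma> k ^ j) \<in> \<int>"
  obtains g where "\<And>k. poly (ipoly g) (\<gamma> k) = c k * poly (ipoly (pderiv m)) (\<gamma> k)"
proof -
  define q where "q k = (\<Prod>j\<in>UNIV-{k}. [:- \<gamma> j, 1:])" for k
  have mq: "ipoly m = [:- \<gamma> k, 1:] * q k" for k
    unfolding m q_def by (subst prod.remove[of UNIV k]) auto
  have rec: "Polynomial.coeff (q k) i = of_int (Polynomial.coeff m (Suc i)) + \<gamma> k * Polynomial.coeff (q k) (Suc i)" for k i
    using arg_cong[OF mq[of k], of "\<lambda>p. Polynomial.coeff p (Suc i)"] by simp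
  \<comment> \<open>Downward induction on \<open>i\<close>, for all \<open>j\<close> at once: each
    Horner step raises the coefficient index at the price of one more power of
    \<open>\<gamma>\<close>.\<close>
  have int: "(\<Sum>k\<in>UNIV. c k * \<gamma> k ^ j * Polynomial.coeff (q k) i) \<in> \<int>" for i j
  proof (induction "Polynomial.degree m - i" arbitrary: i j rule: less_induct)
    case less
    show ?case
    proof (cases "i < Polynomial.degree m")
      case True
      have "(\<Sum>k\<in>UNIV. c k * \<gamma> k ^ j * Polynomial.coeff (q k) i) =
          of_int (Polynomial.coeff m (Suc i)) * (\<Sum>k\<in>UNIV. c k * \<gamma> k ^ j)
          + (\<Sum>k\<in>UNIV. c k * \<gamma> k ^ Suc j * Polynomial.coeff (q k) (Suc i))"
        unfolding sum_distrib_left sum.distrib[symmetric]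
        by (intro sum.cong refl) (simp add: rec[of _ i] algebra_simps)
      then show ?thesis using c less[of "Suc i" "Suc j"] True by simp
    next
      case False
      have "Polynomial.degree (q k) < Polynomial.degree m" for k
      proof -
        have "q k \<noteq> 0" by (simp add: q_def)
        then have "Polynomial.degree (ipoly m) = 1 + Polynomial.degree (q k)"
          unfolding mq[of k] by (subst degree_mult_eq) auto
        then show ?thesis by simp
      qed
      then have "Polynomial.coeff (q k) i = 0" for k using False by (intro coeff_eq_0) (meson linorder_not_less order_less_le_trans)
      then show ?thesis by simp
    qed
  qed
  \<comment> \<open>Lagrange interpolation: at \<open>\<gamma> k\<close> only the summand of
    \<open>k\<close> survives, and \<open>q k\<close> takes there the value of the derivative of
    \<open>m\<close>.\<close>
  define G where "G = (\<Sum>k\<in>UNIV. Polynomial.smult (c k) (q k))"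
  have "Polynomial.coeff G i \<in> \<int>" for i using int[of 0 i] by (simp add: G_def coeff_sum)
  then have "\<exists>g. ipoly g = G"
  proof (intro exI[of _ "map_poly floor (map_poly Re G)"] poly_eqI, goal_cases)
    case (1 n)
    then obtain r where "Polynomial.coeff G n = of_int r" using Ints_cases by blast
    then show ?case by (simp add: coeff_map_poly)
  qed
  then obtain g where g: "ipoly g = G" by blast
  show thesis
  proof (rule that)
    fix k
    have qz: "poly (q j) (\<gamma> k) = 0" if "j \<noteq> k" for j
      using that by (auto simp: q_def poly_prod)
    have "poly (ipoly g) (\<gamma> k) = (\<Sum>j\<in>UNIV. c j * poly (q j) (\<gamma> k))"
      by (simp add: g G_def poly_sum)
    also have "\<dots> = (\<Sum>j\<in>UNIV. if j = k then c k * poly (q k) (\<gamma> k) else 0)"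
      by (intro sum.cong refl) (auto simp: qz)
    also have "\<dots> = c k * poly (q k) (\<gamma> k)" by simp
    also have "poly (q k) (\<gamma> k) = poly (ipoly (pderiv m)) (\<gamma> k)"
      unfolding ipoly_pderiv mq[of k] by (simp del: mult_pCons_left add: pderiv_mult pderiv_pCons)
    finally show "poly (ipoly g) (\<gamma> k) = c k * poly (ipoly (pderiv m)) (\<gamma> k)" .
  qed
qed

section \<open>Lattices in OT-like groups\<close>

text \<open>The index type is that of \<open>labelling\<close>, so one index names both a character
  and, later, an embedding of the number field.\<close>

definition chi ::
  "complex^'s::finite^'t::finite \<Rightarrow> real^'s \<Rightarrow> 's + 't + 't \<Rightarrow> complex" where
  "chi C x k = (case k of
     Inl j \<Rightarrow> of_real (exp (x $ j))
   | Inr (Inl i) \<Rightarrow> exp (\<Sum>j\<in>UNIV. C $ i $ j * of_real (x $ j))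
   | Inr (Inr i) \<Rightarrow> cnj (exp (\<Sum>j\<in>UNIV. C $ i $ j * of_real (x $ j))))"

text \<open>Coordinates on the complexification in which \<open>phi\<close> becomes diagonal
  (\<open>coord_phi\<close>). They determine the vector, so identities involving \<open>phi\<close>
  are checked one eigenvalue at a time.\<close>

definition coord :: "(real^'s::finite) \<times> (complex^'t::finite) \<Rightarrow> 's + 't + 't \<Rightarrow> complex" where
  "coord v k = (case k of
     Inl j \<Rightarrow> of_real (fst v $ j)
   | Inr (Inl i) \<Rightarrow> snd v $ i
   | Inr (Inr i) \<Rightarrow> cnj (snd v $ i))"

text \<open>The vector representing the functional ln |\<open>chi C x k\<close>| of \<open>x\<close>
  (see \<open>cmod_chi\<close>); the LCK condition makes it independent of \<open>C\<close>.\<close>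

definition ell :: "'s::finite + 't::finite + 't \<Rightarrow> real^'s" where
  "ell k = (case k of Inl j \<Rightarrow> axis j 1 | Inr _ \<Rightarrow> (\<chi> j. - 1 / (2 * real CARD('t))))"

lemma chi_add: "chi C (x + y) k = chi C x k * chi C y k"
  by (auto simp: chi_def exp_add sum.distrib algebra_simps split: sum.split)

lemma chi_0 [simp]: "chi C 0 k = 1"
  by (auto simp: chi_def split: sum.split)

lemma chi_nonzero [simp]: "chi C x k \<noteq> 0"
  by (auto simp: chi_def split: sum.split)

lemma chi_minus: "chi C (- x) k = inverse (chi C x k)"
  using chi_add[of C x "- x" k] by (simp add: field_simps)

lemma chi_scale_nat: "chi C (of_nat n *\<^sub>R x) k = chi C x k ^ n"
  by (induction n) (auto simp: chi_add scaleR_left_distrib)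

lemma chi_Inl: "chi C x (Inl j) = of_real (exp (x $ j))"
  by (simp add: chi_def)

lemma chi_Inr_Inr: "chi C x (Inr (Inr i)) = cnj (chi C x (Inr (Inl i)))"
  by (simp add: chi_def)

lemma coord_simps [simp]:
  "coord 0 k = 0" "coord (v + w) k = coord v k + coord w k"
  "coord (v - w) k = coord v k - coord w k" "coord (- v) k = - coord v k"
  by (auto simp: coord_def split: sum.split)

lemma coord_scaleR [simp]: "coord (r *\<^sub>R v) k = of_real r * coord v k"
proof -
  have "coord (r *\<^sub>R v) k = r *\<^sub>R coord v k"
    by (auto simp: coord_def scaleR_conv_of_real[of r "of_real _"] split: sum.split)
  then show ?thesis by (simp add: scaleR_conv_of_real)
qed

lemma coord_sum: "coord (\<Sum>i\<in>A. f i) k = (\<Sum>i\<in>A. coord (f i) k)"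
  by (induction A rule: infinite_finite_induct) auto

lemma coord_phi [simp]: "coord (phi C x v) k = chi C x k * coord v k"
  by (cases v) (auto simp: coord_def chi_def phi_def split: sum.split)

lemma coord_eqI:
  assumes "\<And>k. coord v k = coord w k"
  shows "v = w"
proof (rule prod_eqI)
  show "fst v = fst w"
    unfolding vec_eq_iff using assms[of "Inl _"] by (simp add: coord_def)
  show "snd v = snd w"
    unfolding vec_eq_iff using assms[of "Inr (Inl _)"] by (simp add: coord_def)
qed

lemma phi_0 [simp]: "phi C 0 v = v"
  by (rule coord_eqI) simp

lemma phi_phi: "phi C x (phi C y v) = phi C (x + y) v"
  by (rule coord_eqI) (simp add: chi_add)

lemma linear_phi: "linear (phi C x)"
  by (rule linearI; rule coord_eqI) (auto simp: algebra_simps)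

lemma continuous_on_phi: "continuous_on UNIV (\<lambda>p. phi C (fst p) (snd p))"
  unfolding phi_def case_prod_unfold by (intro continuous_intros)

lemma phi_bounded:
  fixes C :: "complex^'s::finite^'t::finite"
  obtains K where "\<And>x u. norm x \<le> R \<Longrightarrow> norm u \<le> R' \<Longrightarrow> norm (phi C x u) \<le> K"
proof -
  define S where "S = (\<lambda>p. phi C (fst p) (snd p)) ` (cball 0 R \<times> cball 0 R')"
  have "compact S"
    unfolding S_def
    by (intro compact_continuous_image[OF continuous_on_subset[OF continuous_on_phi subset_UNIV]]
          compact_Times compact_cball)
  then have "bounded S" by (rule compact_imp_bounded)
  then obtain K where K: "\<forall>y\<in>S. norm y \<le> K" unfolding bounded_iff by blast
  show thesis
  proof (rule that)
    fix x :: "real^'s" and u :: "(real^'s) \<times> (complex^'t)"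
    assume "norm x \<le> R" "norm u \<le> R'"
    then have "phi C x u \<in> S" unfolding S_def by (intro image_eqI[of _ _ "(x, u)"]) auto
    with K show "norm (phi C x u) \<le> K" by blast
  qed
qed

lemma ell_nonzero [simp]: "ell k \<noteq> 0"
  by (auto simp: ell_def vec_eq_iff axis_def split: sum.split)

lemma ell_Inl: "ell (Inl j) $ i = (if i = j then 1 else 0)"
  by (simp add: ell_def axis_def)

lemma ell_Inr: "ell (Inr i :: 's::finite + 't::finite + 't) $ j = - 1 / (2 * real CARD('t))"
  by (simp add: ell_def)

lemma sum_UNIV_sum:
  fixes f :: "'a::finite + 'b::finite \<Rightarrow> 'c::comm_monoid_add"
  shows "(\<Sum>k\<in>UNIV. f k) = (\<Sum>j\<in>UNIV. f (Inl j)) + (\<Sum>i\<in>UNIV. f (Inr i))"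
  by (simp add: sum.Plus flip: UNIV_Plus_UNIV)

lemma sum_ell: "(\<Sum>k\<in>UNIV. ell (k :: 's::finite + 't::finite + 't)) = 0"
proof -
  have "(\<Sum>k\<in>UNIV. ell (k :: 's + 't + 't) $ j) = 0" for j
    by (simp add: sum_UNIV_sum ell_Inl ell_Inr)
  then show ?thesis by (simp add: vec_eq_iff)
qed

lemma cmod_chi:
  fixes C :: "complex^'s::finite^'t::finite"
  assumes "\<And>i j. Re (C $ i $ j) = - 1 / (2 * real CARD('t))"
  shows "cmod (chi C x k) = exp (ell k \<bullet> x)"
proof -
  have "Re (\<Sum>j\<in>UNIV. C $ i $ j * of_real (x $ j)) = (\<chi> j. - 1 / (2 * real CARD('t))) \<bullet> x" for i
    by (simp add: assms inner_vec_def)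
  then show ?thesis
    by (auto simp: chi_def ell_def inner_axis' split: sum.split)
qed

section \<open>Sets within bounded distance of every point\<close>

lemma coarsely_dense_span:
  fixes W :: "'a::euclidean_space set"
  assumes "\<And>w. \<exists>w'\<in>W. norm (w - w') \<le> R"
  shows "span W = UNIV"
proof (rule ccontr)
  assume "span W \<noteq> UNIV"
  then obtain a where a: "a \<noteq> 0" "span W \<subseteq> {x. a \<bullet> x = 0}"
    using span_not_univ_subset_hyperplane by blast
  \<comment> \<open>This puts \<open>c *\<^sub>R a\<close> at distance R + 1 from the hyperplane
    orthogonal to \<open>a\<close>.\<close>
  define c where "c = (R + 1) / norm a"
  obtain w' where w': "w' \<in> W" "norm (c *\<^sub>R a - w') \<le> R" using assms by blast
  have "a \<bullet> w' = 0" using a w' span_base by blast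
  then have "c * (norm a)\<^sup>2 = a \<bullet> (c *\<^sub>R a - w')"
    by (simp add: inner_diff_right power2_norm_eq_inner)
  also have "\<dots> \<le> norm a * R"
    using w'(2) norm_cauchy_schwarz[of a "c *\<^sub>R a - w'"] mult_left_mono[OF w'(2), of "norm a"] by simp
  finally have "norm a * (R + 1) \<le> norm a * R"
    using a(1) by (simp add: c_def power2_eq_square)
  then show False using a(1) by simp
qed

text \<open>Finitely many hyperplanes have measure zero, so some \<open>y\<close> avoids them.
  Scaling \<open>y\<close> by \<open>c\<close> moves it more than \<open>R\<close> away from each of
  them, and then a nearby element of \<open>L\<close> avoids them too.\<close>

lemma coarsely_dense_generic:
  fixes L F :: "'a::euclidean_space set"
  assumes "finite F" "0 \<notin> F" and near: "\<And>w. \<exists>l\<in>L. norm (w - l) \<le> R"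
  shows "\<exists>l\<in>L. \<forall>f\<in>F. f \<bullet> l \<noteq> 0"
proof -
  have "negligible (\<Union>f\<in>F. {x. f \<bullet> x = 0})"
    using assms(1,2) by (intro negligible_Union) (auto intro!: negligible_hyperplane)
  then have "(\<Union>f\<in>F. {x. f \<bullet> x = 0}) \<noteq> UNIV" by (metis non_negligible_UNIV)
  then obtain y where y: "\<And>f. f \<in> F \<Longrightarrow> f \<bullet> y \<noteq> 0" by blast
  define c where "c = 1 + (\<Sum>f\<in>F. \<bar>norm f * R / (f \<bullet> y)\<bar>)"
  obtain l where l: "l \<in> L" "norm (c *\<^sub>R y - l) \<le> R" using near by blast
  have "f \<bullet> l \<noteq> 0" if f: "f \<in> F" for f
  proof
    assume "f \<bullet> l = 0"
    then have "\<bar>c * (f \<bullet> y)\<bar> = \<bar>f \<bullet> (c *\<^sub>R y - l)\<bar>" by (simp add: inner_diff_right)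
    also have "\<dots> \<le> norm f * R"
      using Cauchy_Schwarz_ineq2[of f "c *\<^sub>R y - l"] mult_left_mono[OF l(2), of "norm f"] by simp
    finally have le: "\<bar>c\<bar> * \<bar>f \<bullet> y\<bar> \<le> norm f * R" by (simp add: abs_mult)
    have "\<bar>norm f * R / (f \<bullet> y)\<bar> \<le> (\<Sum>f\<in>F. \<bar>norm f * R / (f \<bullet> y)\<bar>)"
      by (rule member_le_sum[OF f]) (use assms(1) in auto)
    then have "\<bar>norm f * R / (f \<bullet> y)\<bar> < \<bar>c\<bar>" unfolding c_def by linarith
    moreover have "R \<ge> 0" using near[of 0] norm_ge_zero order_trans by blast
    ultimately have "norm f * R / \<bar>f \<bullet> y\<bar> < \<bar>c\<bar>" by (simp add: abs_mult)
    then have "norm f * R < \<bar>c\<bar> * \<bar>f \<bullet> y\<bar>" using y[OF f] by (simp add: divide_less_eq)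
    with le show False by simp
  qed
  with l show ?thesis by blast
qed

text \<open>A lattice in \<open>G_C C\<close> in coordinates: \<open>inv_mem\<close> spells out the
  inverse in the semidirect product, \<open>discrete\<close> isolates the identity, and
  \<open>cocompact\<close> says that \<open>\<Gamma>\<close> times a bounded box is the whole
  group.\<close>

locale ot_lattice =
  fixes C :: "complex^'s::finite^'t::finite"
    and \<Gamma> :: "((real^'s) \<times> ((real^'s) \<times> (complex^'t))) set"
  assumes re: "\<And>i j. Re (C $ i $ j) = - 1 / (2 * real CARD('t))"
    and zero_mem: "0 \<in> \<Gamma>"
    and mult_mem: "\<And>x v y w. (x, v) \<in> \<Gamma> \<Longrightarrow> (y, w) \<in> \<Gamma> \<Longrightarrow> (x + y, v + phi C x w) \<in> \<Gamma>"
    and inv_mem: "\<And>x v. (x, v) \<in> \<Gamma> \<Longrightarrow> (- x, - phi C (- x) v) \<in> \<Gamma>"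
    and discrete: "\<exists>e>0. \<forall>p\<in>\<Gamma>. norm p < e \<longrightarrow> p = 0"
    and cocompact: "\<exists>R. \<forall>y w. \<exists>(x, v)\<in>\<Gamma>. \<exists>z u. norm z \<le> R \<and> norm u \<le> R \<and> y = x + z \<and> w = v + phi C x u"
begin

section \<open>The base \<open>L\<close> and the fibre \<open>\<Lambda>\<close> of a lattice\<close>

definition "L = fst ` \<Gamma>"
definition "\<Lambda> = {v. (0, v) \<in> \<Gamma>}"

lemma L_0: "0 \<in> L"
  using zero_mem by (force simp: L_def)

lemma L_diff:
  assumes "x \<in> L" "y \<in> L"
  shows "x - y \<in> L"
proof -
  obtain v w where "(x, v) \<in> \<Gamma>" "(y, w) \<in> \<Gamma>" using assms by (auto simp: L_def)
  from mult_mem[OF this(1) inv_mem[OF this(2)]] show ?thesis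
    unfolding L_def by (rule rev_image_eqI) simp
qed

lemma L_near: "\<exists>R. \<forall>y. \<exists>l\<in>L. norm (y - l) \<le> R"
proof -
  obtain R where R: "\<And>y w. \<exists>(x, v)\<in>\<Gamma>. \<exists>z u. norm z \<le> R \<and> norm u \<le> R \<and> y = x + z \<and> w = v + phi C x u"
    using cocompact by blast
  have "\<exists>l\<in>L. norm (y - l) \<le> R" for y
  proof -
    obtain x v z where "(x, v) \<in> \<Gamma>" "norm z \<le> R" "y = x + z" using R[of y 0] by blast
    then show ?thesis by (intro bexI[of _ x]) (force simp: L_def)+
  qed
  then show ?thesis by blast
qed

lemma span_L: "span L = UNIV"
  using L_near coarsely_dense_span by blast

lemma \<Lambda>_0: "0 \<in> \<Lambda>"
  using zero_mem by (simp add: \<Lambda>_def zero_prod_def)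

lemma \<Lambda>_diff: "v \<in> \<Lambda> \<Longrightarrow> w \<in> \<Lambda> \<Longrightarrow> v - w \<in> \<Lambda>"
  using mult_mem[of 0 v 0 "- w"] inv_mem[of 0 w] by (simp add: \<Lambda>_def)

text \<open>The element (0, v - w) is the product of (x, v) with the inverse of (x, w).\<close>

lemma quotient_mem_\<Lambda>:
  assumes "(x, v) \<in> \<Gamma>" "(x, w) \<in> \<Gamma>"
  shows "v - w \<in> \<Lambda>"
  using mult_mem[OF assms(1) inv_mem[OF assms(2)]]
  by (simp add: \<Lambda>_def phi_phi linear_neg[OF linear_phi])

text \<open>Conjugation of (0, v) by an element of \<open>\<Gamma>\<close> over \<open>l\<close>
  gives (0, \<open>phi C l v\<close>).\<close>

lemma phi_\<Lambda>:
  assumes "l \<in> L" "v \<in> \<Lambda>"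
  shows "phi C l v \<in> \<Lambda>"
proof -
  obtain a where a: "(l, a) \<in> \<Gamma>" using assms by (auto simp: L_def)
  have "(l, a + phi C l v) \<in> \<Gamma>" using mult_mem[OF a, of 0 v] assms by (simp add: \<Lambda>_def)
  from quotient_mem_\<Lambda>[OF this a] show ?thesis by simp
qed

lemma generic_element:
  assumes "finite F" "0 \<notin> F"
  shows "\<exists>l\<in>L. \<forall>f\<in>F. f \<bullet> l \<noteq> 0"
  using coarsely_dense_generic[OF assms] L_near by metis

lemma chi_eq_1: "chi C x k = 1 \<Longrightarrow> ell k \<bullet> x = 0"
  using cmod_chi[OF re, of x k] by simp

text \<open>Choose \<open>(x\<^sub>0, v\<^sub>0) \<in> \<Gamma>\<close> such that \<open>\<phi>(x\<^sub>0) - 1\<close> is invertible, with \<open>v\<^sub>0 = (1 - \<phi>(x\<^sub>0)) w\<^sub>0\<close>. The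
  commutator of \<open>(x\<^sub>0, v\<^sub>0)\<close> and \<open>(x, v) \<in> \<Gamma>\<close> lies in \<open>\<Lambda>\<close> and equals
  \<open>(\<phi>(x\<^sub>0) - 1)(v + \<phi>(x) w\<^sub>0 - w\<^sub>0)\<close>, so \<open>v\<close> lies within a bounded distance of the span of \<open>\<Lambda>\<close> as
  long as \<open>x\<close> is bounded; cocompactness then forces this span to be everything.\<close>

lemma span_\<Lambda>: "span \<Lambda> = UNIV"
proof -
  obtain x0 where x0: "x0 \<in> L" "\<And>k :: 's + 't + 't. ell k \<bullet> x0 \<noteq> 0"
    using generic_element[of "range (ell :: 's + 't + 't \<Rightarrow> _)"]
    by (metis ell_nonzero finite finite_imageI imageE rangeI)
  then obtain v0 where v0: "(x0, v0) \<in> \<Gamma>" by (auto simp: L_def)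
  have ne1: "chi C x0 k \<noteq> 1" for k using chi_eq_1 x0(2) by blast
  define w0 where "w0 = ((\<chi> j. fst v0 $ j / (1 - exp (x0 $ j))),
    (\<chi> i. snd v0 $ i / (1 - chi C x0 (Inr (Inl i)))))"
  have w0: "coord v0 k = (1 - chi C x0 k) * coord w0 k" for k
  proof -
    have ne: "1 - chi C x0 (Inl j) \<noteq> 0" "1 - chi C x0 (Inr (Inl i)) \<noteq> 0"
      "1 - cnj (chi C x0 (Inr (Inl i))) \<noteq> 0" for i j
      using ne1[of "Inl j"] ne1[of "Inr (Inl i)"] ne1[of "Inr (Inr i)"] by (auto simp: chi_Inr_Inr)
    consider j where "k = Inl j" | i where "k = Inr (Inl i)" | i where "k = Inr (Inr i)"
      by (metis sumE)
    then show ?thesis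
      by cases (use ne in \<open>simp_all add: coord_def w0_def chi_Inl chi_Inr_Inr\<close>)
  qed
  define T where "T = (\<lambda>u. phi C x0 u - u)"
  have T: "linear T" unfolding T_def by (intro linear_compose_sub linear_phi linear_id[unfolded id_def])
  have cT: "coord (T u) k = (chi C x0 k - 1) * coord u k" for u k
    by (simp add: T_def algebra_simps)
  have injT: "inj T"
  proof (rule injI)
    fix u u' assume "T u = T u'"
    then have "(chi C x0 k - 1) * coord u k = (chi C x0 k - 1) * coord u' k" for k using cT by metis
    then show "u = u'" using ne1 by (intro coord_eqI) simp
  qed
  \<comment> \<open>\<open>T\<close> maps the span into itself and is injective, so by dimension it
    is onto. This allows \<open>T\<close> to be cancelled from the commutator in
    \<open>key\<close>.\<close>
  have TW: "T ` span \<Lambda> = span \<Lambda>"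
  proof -
    have "T ` \<Lambda> \<subseteq> \<Lambda>" unfolding T_def using phi_\<Lambda>[OF x0(1)] \<Lambda>_diff by blast
    then have "T ` span \<Lambda> \<subseteq> span \<Lambda>"
      using linear_span_image[OF T, of \<Lambda>] span_mono[of "T ` \<Lambda>" \<Lambda>] by simp
    moreover have "dim (T ` span \<Lambda>) = dim (span \<Lambda>)"
      by (rule dim_image_eq[OF T inj_on_subset[OF injT subset_UNIV]])
    ultimately show ?thesis
      using subspace_dim_equal[OF linear_subspace_image[OF T subspace_span] subspace_span] by simp
  qed
  have key: "v + phi C x w0 - w0 \<in> span \<Lambda>" if xv: "(x, v) \<in> \<Gamma>" for x v
  proof -
    have "(x0 + x, v0 + phi C x0 v) \<in> \<Gamma>" "(x0 + x, v + phi C x v0) \<in> \<Gamma>"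
      using mult_mem[OF v0 xv] mult_mem[OF xv v0] by (auto simp: add.commute)
    then have "(v0 + phi C x0 v) - (v + phi C x v0) \<in> \<Lambda>" by (rule quotient_mem_\<Lambda>)
    also have "(v0 + phi C x0 v) - (v + phi C x v0) = T (v + phi C x w0 - w0)"
      by (rule coord_eqI) (simp add: cT w0 algebra_simps)
    finally have "T (v + phi C x w0 - w0) \<in> T ` span \<Lambda>" using TW span_base by blast
    then show ?thesis using injT by (simp add: inj_image_mem_iff)
  qed
  obtain R where R: "\<And>y w. \<exists>(x, v)\<in>\<Gamma>. \<exists>z u. norm z \<le> R \<and> norm u \<le> R \<and> y = x + z \<and> w = v + phi C x u"
    using cocompact by blast
  obtain K where K: "\<And>x u. norm x \<le> R \<Longrightarrow> norm u \<le> R + norm w0 \<Longrightarrow> norm (phi C x u) \<le> K"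
    by (rule phi_bounded) (rule that)
  have "\<exists>w'\<in>span \<Lambda>. norm (w - w') \<le> K + norm w0" for w
  proof -
    \<comment> \<open>Choosing a point over 0 makes \<open>x = - z\<close> bounded, so
      \<open>phi C x\<close> is bounded on bounded sets by a constant that does not depend on
      \<open>w\<close>.\<close>
    obtain x v z u where *: "(x, v) \<in> \<Gamma>" "norm z \<le> R" "norm u \<le> R" "0 = x + z" "w = v + phi C x u"
      using R[of 0 w] by blast
    then have x: "norm x \<le> R" by (simp add: add_eq_0_iff)
    have u: "norm (u - w0) \<le> R + norm w0" using norm_triangle_ineq4[of u w0] *(3) by simp
    have "w - (v + phi C x w0 - w0) = phi C x (u - w0) + w0"
      by (simp add: * linear_diff[OF linear_phi])
    also have "norm \<dots> \<le> K + norm w0"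
      using K[OF x u] norm_triangle_ineq[of "phi C x (u - w0)" w0] by linarith
    finally show ?thesis using key[OF *(1)] by blast
  qed
  then have "span (span \<Lambda>) = UNIV" by (rule coarsely_dense_span)
  then show ?thesis by (simp add: span_span)
qed

lemma \<Lambda>_discrete: "\<exists>e>0. \<forall>v\<in>\<Lambda>. norm v < e \<longrightarrow> v = 0"
proof -
  obtain e where e: "e > 0" "\<And>p. p \<in> \<Gamma> \<Longrightarrow> norm p < e \<Longrightarrow> p = 0" using discrete by blast
  have "v = 0" if "v \<in> \<Lambda>" "norm v < e" for v
    using e(2)[of "(0, v)"] that by (simp add: \<Lambda>_def norm_Pair zero_prod_def)
  with e show ?thesis by blast
qed

lemma \<Lambda>_basis:
  "\<exists>b :: 's + 't + 't \<Rightarrow> (real^'s) \<times> (complex^'t). span (range b) = UNIV \<and>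
    \<Lambda> = range (\<lambda>m. \<Sum>k\<in>UNIV. of_int (m k) *\<^sub>R b k) \<and> range b \<subseteq> \<Lambda>"
proof -
  obtain e where e: "e > 0" "\<And>v. v \<in> \<Lambda> \<Longrightarrow> norm v < e \<Longrightarrow> v = 0" using \<Lambda>_discrete by blast
  have card: "CARD('s + 't + 't) = DIM((real^'s) \<times> (complex^'t))" by simp
  obtain b :: "'s + 't + 't \<Rightarrow> (real^'s) \<times> (complex^'t)" where b: "span (range b) = UNIV"
    "\<Lambda> = range (\<lambda>m. \<Sum>k\<in>UNIV. of_int (m k) *\<^sub>R b k)"
    by (rule discrete_subgroup_basis[OF \<Lambda>_0 \<Lambda>_diff e span_\<Lambda> card])
  have "b k \<in> \<Lambda>" for k
  proof -
    have "(\<Sum>j\<in>UNIV. of_int (if j = k then 1 else 0) *\<^sub>R b j) = (\<Sum>j\<in>UNIV. if j = k then b k else 0)"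
      by (rule sum.cong) auto
    then have "b k = (\<Sum>j\<in>UNIV. of_int (if j = k then 1 else 0) *\<^sub>R b j)" by simp
    then show ?thesis unfolding b(2) by (rule range_eqI[where x = "\<lambda>j. if j = k then 1 else 0"])
  qed
  then have "range b \<subseteq> \<Lambda>" by blast
  with b show ?thesis by blast
qed

text \<open>Column \<open>m\<close> of \<open>B\<close> holds the coordinates of the m-th basis
  vector of \<open>\<Lambda>\<close>, and \<open>M\<close> is the matrix of \<open>phi C l\<close>
  in that basis, integral because \<open>\<Lambda>\<close> is preserved.\<close>

lemma integral_matrices:
  obtains B :: "complex^('s + 't + 't)^('s + 't + 't)" where "det B \<noteq> 0"
    "\<And>l. l \<in> L \<Longrightarrow> \<exists>M :: int^('s + 't + 't)^('s + 't + 't). \<forall>k m.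
       chi C l k * B $ k $ m = (\<Sum>p\<in>UNIV. B $ k $ p * of_int (M $ p $ m))"
proof -
  obtain b :: "'s + 't + 't \<Rightarrow> (real^'s) \<times> (complex^'t)" where b: "span (range b) = UNIV"
    "\<Lambda> = range (\<lambda>m. \<Sum>k\<in>UNIV. of_int (m k) *\<^sub>R b k)" "range b \<subseteq> \<Lambda>"
    using \<Lambda>_basis by (elim exE conjE) (rule that)
  define B :: "complex^('s + 't + 't)^('s + 't + 't)" where "B = (\<chi> k m. coord (b m) k)"
  \<comment> \<open>A vector \<open>w\<close> in the left kernel of \<open>B\<close> gives a
    real-linear form \<open>f\<close> that vanishes on the basis, hence everywhere. Testing
    \<open>f\<close> on axis vectors, with entries 1 and \<open>\<i>\<close> in the complex part,
    separates the coefficients of each complex coordinate and of its conjugate.\<close>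
  have "w = 0" if w: "transpose B *v w = 0" for w
  proof -
    define f where "f = (\<lambda>v. \<Sum>k\<in>UNIV. w $ k * coord v k)"
    have "linear f"
      by (rule linearI) (auto simp: f_def sum.distrib sum_distrib_left scaleR_conv_of_real algebra_simps)
    moreover have "f (b m) = 0" for m
    proof -
      have "f (b m) = (transpose B *v w) $ m"
        by (simp add: f_def B_def matrix_vector_mult_def transpose_def mult.commute)
      then show ?thesis using w by simp
    qed
    ultimately have f0: "f v = 0" for v
      using linear_eq_0_on_span[of f "range b" v] b(1) by blast
    have f: "f v = (\<Sum>j\<in>UNIV. w $ Inl j * of_real (fst v $ j)) +
      ((\<Sum>i\<in>UNIV. w $ Inr (Inl i) * snd v $ i) + (\<Sum>i\<in>UNIV. w $ Inr (Inr i) * cnj (snd v $ i)))" for v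
      by (simp add: f_def coord_def sum_UNIV_sum)
    have axis_sum: "(\<Sum>i\<in>UNIV. g i * (axis j a $ i)) = g j * a" for g :: "'t \<Rightarrow> complex" and j a
    proof -
      have "(\<Sum>i\<in>UNIV. g i * (axis j a $ i)) = (\<Sum>i\<in>UNIV. if i = j then g j * a else 0)"
        by (rule sum.cong) (auto simp: axis_def)
      then show ?thesis by simp
    qed
    have axis_sum': "(\<Sum>i\<in>UNIV. g i * cnj (axis j a $ i)) = g j * cnj a" for g :: "'t \<Rightarrow> complex" and j a
    proof -
      have "(\<Sum>i\<in>UNIV. g i * cnj (axis j a $ i)) = (\<Sum>i\<in>UNIV. if i = j then g j * cnj a else 0)"
        by (rule sum.cong) (auto simp: axis_def)
      then show ?thesis by simp
    qed
    have "w $ Inl j = 0" for j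
    proof -
      have "(\<Sum>i\<in>UNIV. w $ Inl i * of_real (axis j 1 $ i)) = (\<Sum>i\<in>UNIV. if i = j then w $ Inl j else 0)"
        by (rule sum.cong) (auto simp: axis_def)
      then show ?thesis using f0[of "(axis j 1, 0)"] by (simp add: f)
    qed
    moreover have "w $ Inr (Inl i) = 0 \<and> w $ Inr (Inr i) = 0" for i
    proof -
      have "w $ Inr (Inl i) + w $ Inr (Inr i) = 0" "w $ Inr (Inl i) * \<i> - w $ Inr (Inr i) * \<i> = 0"
        using f0[of "(0, axis i 1)"] f0[of "(0, axis i \<i>)"]
        by (simp_all add: f axis_sum axis_sum')
      then show ?thesis by (auto simp: add_eq_0_iff)
    qed
    ultimately have "w $ k = 0" for k
      by (cases k rule: sumE; cases "projr k" rule: sumE) auto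
    then show "w = 0" by (simp add: vec_eq_iff)
  qed
  then obtain B' where "B' ** transpose B = mat 1" using matrix_left_invertible_ker by blast
  then have "det B' * det (transpose B) = 1" by (metis det_I det_mul)
  then have "det B \<noteq> 0" by auto
  moreover have "\<exists>M :: int^('s + 't + 't)^('s + 't + 't). \<forall>k m.
       chi C l k * B $ k $ m = (\<Sum>p\<in>UNIV. B $ k $ p * of_int (M $ p $ m))" if l: "l \<in> L" for l
  proof -
    have "\<exists>n. phi C l (b m) = (\<Sum>p\<in>UNIV. of_int (n p) *\<^sub>R b p)" for m
    proof -
      have "phi C l (b m) \<in> \<Lambda>" by (rule phi_\<Lambda>[OF l]) (use b(3) in blast)
      then show ?thesis unfolding b(2) by blast
    qed
    then obtain n where n: "\<And>m. phi C l (b m) = (\<Sum>p\<in>UNIV. of_int (n m p) *\<^sub>R b p)" by metis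
    have "chi C l k * B $ k $ m = (\<Sum>p\<in>UNIV. B $ k $ p * of_int ((\<chi> p m. n m p) $ p $ m))" for k m
      using arg_cong[OF n[of m], of "\<lambda>v. coord v k"]
      by (simp add: B_def coord_sum mult.commute)
    then show ?thesis by blast
  qed
  ultimately show thesis by (rule that)
qed

text \<open>Elements of \<open>L\<close> in the unit ball send the basis of \<open>\<Lambda>\<close>
  into a bounded, hence finite, part of \<open>\<Lambda>\<close>. Images of the basis determine
  \<open>l\<close>, so only finitely many such \<open>l\<close> exist.\<close>

lemma L_discrete: "\<exists>e>0. \<forall>l\<in>L. norm l < e \<longrightarrow> l = 0"
proof -
  obtain b :: "'s + 't + 't \<Rightarrow> (real^'s) \<times> (complex^'t)" where b: "span (range b) = UNIV" "range b \<subseteq> \<Lambda>"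
    using \<Lambda>_basis by (elim exE conjE) (rule that)
  define S where "S = {l \<in> L. norm l \<le> 1}"
  obtain K where K: "\<And>x u. norm x \<le> 1 \<Longrightarrow> norm u \<le> (\<Sum>m\<in>UNIV. norm (b m)) \<Longrightarrow> norm (phi C x u) \<le> K"
    by (rule phi_bounded) (rule that)
  have bd: "bounded (\<Lambda> \<inter> cball 0 K)" (is "bounded ?F")
    by (rule bounded_subset[OF bounded_cball Int_lower2])
  obtain e where e: "e > 0" "\<And>v. v \<in> \<Lambda> \<Longrightarrow> norm v < e \<Longrightarrow> v = 0" using \<Lambda>_discrete by blast
  have "uniform_discrete ?F"
    unfolding uniform_discrete_def
  proof (intro exI[of _ e] conjI ballI impI)
    fix x y assume "x \<in> ?F" "y \<in> ?F" "dist x y < e"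
    then show "x = y" using e(2)[of "x - y"] \<Lambda>_diff[of x y] by (simp add: dist_norm)
  qed (rule e)
  with bd have finF: "finite ?F" using uniform_discrete_finite_iff by blast
  have "finite (PiE (UNIV :: ('s + 't + 't) set) (\<lambda>_. ?F))" by (rule finite_PiE[OF finite finF])
  moreover have "(\<lambda>l m. phi C l (b m)) ` S \<subseteq> PiE UNIV (\<lambda>_. ?F)"
  proof (intro image_subsetI PiE_I)
    fix l m assume l: "l \<in> S"
    have "phi C l (b m) \<in> \<Lambda>" by (rule phi_\<Lambda>) (use l b(2) in \<open>auto simp: S_def\<close>)
    moreover have "norm (phi C l (b m)) \<le> K"
      by (rule K) (use l in \<open>auto simp: S_def intro: member_le_sum\<close>)
    ultimately show "phi C l (b m) \<in> ?F" by simp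
  qed simp
  ultimately have "finite ((\<lambda>l m. phi C l (b m)) ` S)" by (rule finite_subset[rotated])
  moreover have "inj_on (\<lambda>l m. phi C l (b m)) S"
  proof (rule inj_onI)
    fix l l' assume "(\<lambda>m. phi C l (b m)) = (\<lambda>m. phi C l' (b m))"
    then have "phi C l v = phi C l' v" if "v \<in> range b" for v using that by (auto dest: fun_cong)
    then have "phi C l v = phi C l' v" for v
      using linear_eq_on_span[OF linear_phi linear_phi] b(1) by blast
    \<comment> \<open>The all-ones vector of the real part is sent to the vector of the exp
      (\<open>l $ j\<close>), from which \<open>l\<close> can be read off.\<close>
    from arg_cong[OF this[of "(\<chi> j. 1, 0)"], of fst] show "l = l'"
      by (simp add: phi_def vec_eq_iff)
  qed
  ultimately have "finite S" by (rule finite_imageD)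
  then obtain d where d: "d > 0" "\<And>x. x \<in> S \<Longrightarrow> x \<noteq> 0 \<Longrightarrow> d \<le> dist 0 x"
    using finite_set_avoid[of S 0] by blast
  have "l = 0" if "l \<in> L" "norm l < min d 1" for l
    using d(2)[of l] that by (auto simp: S_def)
  then show ?thesis using d(1) by (intro exI[of _ "min d 1"]) auto
qed

end

section \<open>The spectrum of a generic lattice element\<close>

lemma sum_UNIV_prod:
  fixes f :: "'a::finite \<Rightarrow> 'c::comm_semiring_0" and g :: "'b::finite \<Rightarrow> 'c"
  shows "(\<Sum>r\<in>UNIV. f (fst r) * g (snd r)) = (\<Sum>i\<in>UNIV. f i) * (\<Sum>j\<in>UNIV. g j)"
proof -
  have "(\<Sum>r\<in>UNIV \<times> UNIV. f (fst r) * g (snd r)) = (\<Sum>i\<in>UNIV. \<Sum>j\<in>UNIV. f i * g j)"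
    by (simp add: sum.cartesian_product case_prod_unfold)
  then show ?thesis by (simp add: sum_product)
qed

text \<open>\<open>integral_charpoly\<close> for the Kronecker squares of \<open>B\<close> and
  \<open>M\<close>: the products of two eigenvalues of \<open>M\<close> are the eigenvalues of its
  Kronecker square.\<close>

lemma integral_charpoly_tensor:
  fixes B :: "complex^'n^'n" and M :: "int^'n^'n" and d :: "'n \<Rightarrow> complex"
  assumes "det B \<noteq> 0" and eq: "\<And>k m. d k * B $ k $ m = (\<Sum>p\<in>UNIV. B $ k $ p * of_int (M $ p $ m))"
  shows "\<exists>P. ipoly P = (\<Prod>p\<in>UNIV. [:- (d (fst p) * d (snd p)), 1:])"
proof -
  define T :: "complex^'n^'n \<Rightarrow> complex^('n \<times> 'n)^('n \<times> 'n)" where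
    "T = (\<lambda>A. \<chi> p q. A $ fst p $ fst q * A $ snd p $ snd q)"
  define N :: "int^('n \<times> 'n)^('n \<times> 'n)" where "N = (\<chi> p q. M $ fst p $ fst q * M $ snd p $ snd q)"
  have T_mult: "T A ** T A' = T (A ** A')" for A A'
  proof -
    have "(T A ** T A') $ p $ q = T (A ** A') $ p $ q" for p q
      using sum_UNIV_prod[of "\<lambda>r. A $ fst p $ r * A' $ r $ fst q" "\<lambda>r. A $ snd p $ r * A' $ r $ snd q"]
      by (simp add: T_def matrix_matrix_mult_def mult_ac)
    then show ?thesis by (simp add: vec_eq_iff)
  qed
  have T_1: "T (mat 1) = mat 1"
    by (simp add: T_def vec_eq_iff mat_def prod_eq_iff)
  obtain B' where "B ** B' = mat 1"
    using assms(1) by (auto simp: invertible_det_nz[symmetric] invertible_def)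
  then have "T B ** T B' = mat 1" by (simp add: T_mult T_1)
  then have "det (T B) * det (T B') = det (mat 1 :: complex^('n \<times> 'n)^('n \<times> 'n))" by (simp flip: det_mul)
  then have "det (T B) \<noteq> 0" by auto
  moreover have "d (fst k) * d (snd k) * T B $ k $ m = (\<Sum>p\<in>UNIV. T B $ k $ p * of_int (N $ p $ m))" for k m
  proof -
    have "d (fst k) * d (snd k) * T B $ k $ m = (d (fst k) * B $ fst k $ fst m) * (d (snd k) * B $ snd k $ snd m)"
      by (simp add: T_def)
    also have "\<dots> = (\<Sum>p\<in>UNIV. (B $ fst k $ fst p * of_int (M $ fst p $ fst m)) * (B $ snd k $ snd p * of_int (M $ snd p $ snd m)))"
      unfolding eq by (rule sum_UNIV_prod[symmetric])
    also have "\<dots> = (\<Sum>p\<in>UNIV. T B $ k $ p * of_int (N $ p $ m))"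
      by (rule sum.cong) (auto simp: T_def N_def)
    finally show ?thesis .
  qed
  ultimately show ?thesis by (rule integral_charpoly)
qed

lemma unit_ipoly:
  fixes d :: "'i::finite \<Rightarrow> complex"
  assumes P: "ipoly P = (\<Prod>i\<in>UNIV. [:- d i, 1:])" and d: "(\<Prod>i\<in>UNIV. cmod (d i)) = 1"
  shows "Polynomial.lead_coeff P = 1" "\<bar>Polynomial.coeff P 0\<bar> = 1"
    and "poly (ipoly P) w = 0 \<longleftrightarrow> w \<in> range d"
proof -
  have "of_int (Polynomial.lead_coeff P) = Polynomial.lead_coeff (ipoly P)" by simp
  also have "\<dots> = (\<Prod>i\<in>UNIV. Polynomial.lead_coeff [:- d i, 1:])" unfolding P by (rule lead_coeff_prod)
  also have "\<dots> = of_int 1" by simp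
  finally show "Polynomial.lead_coeff P = 1" by (simp only: of_int_eq_iff)
  have "of_int (Polynomial.coeff P 0) = poly (ipoly P) 0" by (simp add: poly_0_coeff_0)
  also have "\<dots> = (\<Prod>i\<in>UNIV. - d i)" unfolding P by (simp add: poly_prod)
  finally have "cmod (of_int (Polynomial.coeff P 0)) = cmod (\<Prod>i\<in>UNIV. - d i)" by (rule arg_cong)
  also have "\<dots> = (\<Prod>i\<in>UNIV. cmod (- d i))" by (rule prod_norm[symmetric])
  finally have "cmod (of_int (Polynomial.coeff P 0)) = 1" using d by simp
  then show "\<bar>Polynomial.coeff P 0\<bar> = 1" by (metis norm_of_int of_int_abs of_int_1 of_int_eq_iff)
  show "poly (ipoly P) w = 0 \<longleftrightarrow> w \<in> range d"
    unfolding P by (auto simp: poly_prod)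
qed

text \<open>Coordinate j of the sum is [\<open>Inl j \<in> S\<close>] - N/(2t), where N counts the
  non-real indices in \<open>S\<close>. Coordinate \<open>j0\<close> forces N = 2t, and then every
  other coordinate forces \<open>Inl j \<in> S\<close>.\<close>

lemma sum_ell_subset:
  fixes S :: "('s::finite + 't::finite + 't) set"
  assumes "(\<Sum>k\<in>S. ell k) = 0" "Inl j0 \<in> S"
  shows "S = UNIV"
proof -
  have comp: "(\<Sum>k\<in>S. ell k) $ j = (if Inl j \<in> S then 1 else 0) - real (card {i. Inr i \<in> S}) / (2 * real CARD('t))" for j
  proof -
    have "(\<Sum>k\<in>S. ell k) $ j = (\<Sum>k\<in>UNIV. if k \<in> S then ell k $ j else 0)"
      by (simp add: sum.If_cases)
    also have "\<dots> = (\<Sum>i\<in>UNIV. if i = j then if Inl j \<in> S then 1 else 0 else 0)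
        + (\<Sum>i\<in>UNIV. if Inr i \<in> S then - 1 / (2 * real CARD('t)) else 0)"
      unfolding sum_UNIV_sum
      by (intro arg_cong2[where f = "(+)"] sum.cong) (auto simp: ell_Inl ell_Inr)
    also have "(\<Sum>i\<in>UNIV. if Inr i \<in> S then - 1 / (2 * real CARD('t)) else 0)
        = - (real (card {i. Inr i \<in> S}) / (2 * real CARD('t)))"
      by (simp add: sum.If_cases)
    finally show ?thesis by simp
  qed
  have one: "real (card {i. Inr i \<in> S}) / (2 * real CARD('t)) = 1"
    using comp[of j0] assms(2) unfolding assms(1) by (simp only: if_True zero_index)
  then have "real (card {i. Inr i \<in> S}) = 2 * real CARD('t)" by (rule right_inverse_eq[THEN iffD1, rotated]) simp
  also have "\<dots> = real (CARD('t + 't))" by simp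
  finally have c: "card {i. Inr i \<in> S} = CARD('t + 't)" by (simp only: of_nat_eq_iff)
  then have "{i. Inr i \<in> S} = UNIV" by (intro card_subset_eq) auto
  moreover have "Inl j \<in> S" for j
    using comp[of j] assms(1) one by (auto split: if_splits)
  ultimately have "k \<in> S" for k by (cases k) auto
  then show ?thesis by blast
qed

context ot_lattice
begin

lemma prod_cmod_chi: "(\<Prod>k\<in>S. cmod (chi C x k)) = exp ((\<Sum>k\<in>S. ell k) \<bullet> x)"
  by (simp add: cmod_chi[OF re] inner_sum_left exp_sum)

lemma L_plus: "x \<in> L \<Longrightarrow> y \<in> L \<Longrightarrow> x + y \<in> L"
  and L_int: "x \<in> L \<Longrightarrow> of_int n *\<^sub>R x \<in> L"
  using diff_closed_int_sum[OF L_0 L_diff] by blast+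

lemma chi_charpoly:
  assumes "l \<in> L"
  shows "\<exists>P. ipoly P = (\<Prod>k\<in>UNIV. [:- chi C l k, 1:])"
    and "(\<Sum>k\<in>UNIV. chi C l k) \<in> \<int>"
    and "\<exists>P. ipoly P = (\<Prod>p\<in>UNIV. [:- (chi C l (fst p) * chi C l (snd p)), 1:])"
proof -
  obtain B :: "complex^('s + 't + 't)^('s + 't + 't)" where B: "det B \<noteq> 0"
    "\<And>l. l \<in> L \<Longrightarrow> \<exists>M :: int^('s + 't + 't)^('s + 't + 't). \<forall>k m.
       chi C l k * B $ k $ m = (\<Sum>p\<in>UNIV. B $ k $ p * of_int (M $ p $ m))"
    by (rule integral_matrices) (rule that)
  obtain M :: "int^('s + 't + 't)^('s + 't + 't)" where
    M: "\<And>k m. chi C l k * B $ k $ m = (\<Sum>p\<in>UNIV. B $ k $ p * of_int (M $ p $ m))"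
    using B(2)[OF assms] by blast
  show "\<exists>P. ipoly P = (\<Prod>k\<in>UNIV. [:- chi C l k, 1:])"
    by (rule integral_charpoly[OF B(1) M])
  show "(\<Sum>k\<in>UNIV. chi C l k) \<in> \<int>"
    by (rule integral_trace[OF B(1) M])
  show "\<exists>P. ipoly P = (\<Prod>p\<in>UNIV. [:- (chi C l (fst p) * chi C l (snd p)), 1:])"
    by (rule integral_charpoly_tensor[OF B(1) M])
qed

text \<open>The bound 2 leaves finitely many hyperplanes to avoid and covers both applications:
  subset sums, with coefficients 0 and 1, and \<open>ell a + ell b - ell c - ell d\<close>, whose
  coefficients reach 2 and -2 when indices coincide.\<close>

definition generic :: "real^'s \<Rightarrow> bool" where
  "generic l \<longleftrightarrow> l \<in> L \<and> (\<forall>n :: 's + 't + 't \<Rightarrow> int. (\<forall>k. \<bar>n k\<bar> \<le> 2) \<longrightarrow>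
     (\<Sum>k\<in>UNIV. of_int (n k) *\<^sub>R ell k) \<bullet> l = 0 \<longrightarrow> (\<Sum>k\<in>UNIV. of_int (n k) *\<^sub>R ell k) = 0)"

lemma generic_exists: "\<exists>l. generic l"
proof -
  define F where "F = (\<lambda>n :: 's + 't + 't \<Rightarrow> int. \<Sum>k\<in>UNIV. of_int (n k) *\<^sub>R ell k) ` PiE UNIV (\<lambda>_. {-2..2})"
  have "finite F" unfolding F_def by (intro finite_imageI finite_PiE) auto
  then obtain l where l: "l \<in> L" "\<And>f. f \<in> F - {0} \<Longrightarrow> f \<bullet> l \<noteq> 0"
    using generic_element[of "F - {0}"] by blast
  have "generic l"
    unfolding generic_def
  proof (intro conjI allI impI l(1))
    fix n :: "'s + 't + 't \<Rightarrow> int"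
    assume n: "\<forall>k. \<bar>n k\<bar> \<le> 2" and 0: "(\<Sum>k\<in>UNIV. of_int (n k) *\<^sub>R ell k) \<bullet> l = 0"
    have "n \<in> PiE UNIV (\<lambda>_. {-2..2})" using n by (auto simp: abs_le_iff PiE_UNIV_domain minus_le_iff)
    then have "(\<Sum>k\<in>UNIV. of_int (n k) *\<^sub>R ell k) \<in> F" unfolding F_def by blast
    with l(2) 0 show "(\<Sum>k\<in>UNIV. of_int (n k) *\<^sub>R ell k) = 0" by blast
  qed
  then show ?thesis by blast
qed

lemma generic_subset_sum:
  fixes S :: "('s + 't + 't) set"
  assumes "generic l" "(\<Sum>k\<in>S. ell k) \<bullet> l = 0"
  shows "(\<Sum>k\<in>S. ell k) = (0 :: real^'s)"
proof -
  define n :: "'s + 't + 't \<Rightarrow> int" where "n k = (if k \<in> S then 1 else 0)" for k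
  have "(\<Sum>k\<in>UNIV. of_int (n k) *\<^sub>R ell k) = (\<Sum>k\<in>UNIV. if k \<in> S then ell k else 0 :: real^'s)"
    by (rule sum.cong) (auto simp: n_def)
  also have "\<dots> = (\<Sum>k\<in>S. ell k)" by (simp add: sum.If_cases)
  finally have n: "(\<Sum>k\<in>UNIV. of_int (n k) *\<^sub>R ell k) = (\<Sum>k\<in>S. ell k :: real^'s)" .
  have "\<bar>n k\<bar> \<le> 2" for k by (simp add: n_def)
  then show ?thesis
    using assms unfolding generic_def n[symmetric] by blast
qed

lemma generic_ell_nonzero:
  fixes k :: "'s + 't + 't"
  assumes "generic l"
  shows "ell k \<bullet> l \<noteq> 0"
  using generic_subset_sum[OF assms, of "{k}"] by auto

lemma generic_pair:
  assumes "generic l" "cmod (chi C l a * chi C l b) = cmod (chi C l c * chi C l d)"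
  shows "ell a + ell b = (ell c + ell d :: real^'s)"
proof -
  define n :: "'s + 't + 't \<Rightarrow> int" where
    "n k = (if k = a then 1 else 0) + (if k = b then 1 else 0) - (if k = c then 1 else 0) - (if k = d then 1 else 0)" for k
  have delta: "(\<Sum>k\<in>UNIV. (if k = x then 1 else 0) *\<^sub>R ell k) = (ell x :: real^'s)" for x
    by (simp add: if_distrib[of "\<lambda>x. x *\<^sub>R _"] cong: if_cong)
  have n: "(\<Sum>k\<in>UNIV. of_int (n k) *\<^sub>R ell k) = (ell a + ell b - ell c - ell d :: real^'s)"
    unfolding n_def of_int_add of_int_diff if_distrib[of of_int] of_int_1 of_int_0
      scaleR_left_diff_distrib scaleR_left_distrib sum.distrib sum_subtractf delta by simp
  have "exp ((ell a + ell b) \<bullet> l) = exp ((ell c + ell d) \<bullet> l)"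
    using assms(2) by (simp add: norm_mult cmod_chi[OF re] inner_add_left flip: exp_add)
  then have "(ell a + ell b - ell c - ell d) \<bullet> l = 0" by (simp add: algebra_simps inner_simps)
  moreover have "\<bar>n k\<bar> \<le> 2" for k by (simp add: n_def)
  ultimately have "ell a + ell b - ell c - ell d = (0 :: real^'s)"
    using assms(1) unfolding generic_def n[symmetric] by blast
  then show ?thesis by (simp add: algebra_simps)
qed

text \<open>Conjugates of \<open>exp l\<^sub>j\<close> have product of absolute value 1; genericity turns this into a
  linear relation among the \<open>ell k\<close>, and the only one involving \<open>ell (Inl j)\<close> involves all of them.\<close>

lemma generic_min_ipoly:
  assumes l: "generic l"
  obtains m where "min_ipoly (chi C l (Inl j)) m" "ipoly m = (\<Prod>k\<in>UNIV. [:- chi C l k, 1:])"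
    "Polynomial.lead_coeff m = 1" "inj (chi C l)"
proof -
  have "l \<in> L" using l by (simp add: generic_def)
  then obtain P where P: "ipoly P = (\<Prod>k\<in>UNIV. [:- chi C l k, 1:])" using chi_charpoly by blast
  have n1: "(\<Prod>k\<in>UNIV. cmod (chi C l k)) = 1"
    by (simp add: prod_cmod_chi sum_ell del: prod_norm)
  note P' = unit_ipoly[OF P n1]
  obtain m where m: "min_ipoly (chi C l (Inl j)) m" "Polynomial.lead_coeff m = 1" "\<bar>Polynomial.coeff m 0\<bar> = 1"
    "\<And>w. poly (ipoly m) w = 0 \<Longrightarrow> poly (ipoly P) w = 0"
    using monic_min_ipoly[OF P'(1,2)] P'(3) by blast
  define Z where "Z = {w. poly (ipoly m) w = 0}"
  have "Z \<subseteq> chi C l ` UNIV" using m(4) P'(3) by (auto simp: Z_def)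
  \<comment> \<open>The values \<open>chi C l k\<close> are not yet known to be distinct;
    \<open>S\<close> picks one index for each conjugate.\<close>
  then obtain S where S: "inj_on (chi C l) S" "Z = chi C l ` S"
    unfolding subset_image_inj by blast
  have "chi C l (Inl j) \<in> Z" using m(1) by (simp add: Z_def min_ipoly_def)
  then obtain k where k: "k \<in> S" "chi C l k = chi C l (Inl j)" using S(2) by force
  \<comment> \<open>The index picked for the conjugate at \<open>Inl j\<close> might be a different
    one; a trivial product relation with the extra factor \<open>chi C l k\<close> brings the case
    under \<open>generic_pair\<close> and excludes this.\<close>
  have "ell k + ell k = ell k + (ell (Inl j :: 's + 't + 't) :: real^'s)"
    by (rule generic_pair[OF l]) (simp add: k)
  then have "(ell k :: real^'s) $ j = 1" by (simp add: ell_Inl)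
  then have "k = Inl j"
    by (cases k) (auto simp: ell_Inl ell_Inr divide_eq_eq split: if_splits)
  with k have "Inl j \<in> S" by simp
  have "(\<Prod>w\<in>Z. cmod w) = 1" using min_ipoly_roots(4)[OF m(1,2,3)] by (simp add: Z_def)
  then have "exp ((\<Sum>k\<in>S. ell k) \<bullet> l) = 1"
    using S by (simp add: prod.reindex prod_cmod_chi[symmetric] del: prod_norm)
  then have "(\<Sum>k\<in>S. ell k) = (0 :: real^'s)" using generic_subset_sum[OF l] by simp
  then have "S = UNIV" using sum_ell_subset \<open>Inl j \<in> S\<close> by blast
  have "ipoly m = (\<Prod>w\<in>Z. [:- w, 1:])" unfolding Z_def by (rule min_ipoly_roots(1)[OF m(1,2)])
  also have "\<dots> = (\<Prod>k\<in>UNIV. [:- chi C l k, 1:])"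
    using S \<open>S = UNIV\<close> by (simp add: prod.reindex)
  finally show thesis using that m S \<open>S = UNIV\<close> by blast
qed

text \<open>Compare the j-th coordinates of the functionals: on the left the value is at least 1 -
  1/2, while only \<open>ell (Inl j)\<close> has a positive j-th coordinate. So \<open>c\<close> or
  \<open>d\<close> is \<open>Inl j\<close>, and the remaining factors agree by injectivity.\<close>

lemma generic_pair_unique:
  assumes "generic l" "inj (chi C l)" "chi C l (Inl j) * chi C l b = chi C l c * chi C l d"
  shows "(c, d) = (Inl j, b) \<or> (c, d) = (b, Inl j)"
proof -
  have "ell (Inl j :: 's + 't + 't) + ell b = (ell c + ell d :: real^'s)"
    by (rule generic_pair[OF assms(1)]) (simp only: assms(3))
  then have eq: "1 + ell b $ j = ell c $ j + (ell d :: real^'s) $ j"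
    by (metis ell_Inl vector_add_component)
  have lower: "(ell k :: real^'s) $ j \<ge> - 1 / 2" for k :: "'s + 't + 't"
  proof (cases k)
    case (Inr i)
    have "1 \<le> real CARD('t)" by (simp add: Suc_leI)
    then show ?thesis by (simp add: Inr ell_Inr field_simps)
  qed (simp add: ell_Inl)
  have pos: "k = Inl j" if "(ell k :: real^'s) $ j > 0" for k :: "'s + 't + 't"
    using that by (cases k) (auto simp: ell_Inl ell_Inr split: if_splits)
  have "ell c $ j + (ell d :: real^'s) $ j > 0" using eq lower[of b] by simp
  then have "(ell c :: real^'s) $ j > 0 \<or> (ell d :: real^'s) $ j > 0" by linarith
  then have "c = Inl j \<or> d = Inl j" using pos by blast
  then show ?thesis
  proof
    assume "c = Inl j"
    moreover from this have "chi C l b = chi C l d" using assms(3) by simp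
    ultimately show ?thesis using assms(2) by (simp add: inj_eq)
  next
    assume "d = Inl j"
    moreover from this have "chi C l b = chi C l c" using assms(3) by (simp add: mult.commute)
    ultimately show ?thesis using assms(2) by (simp add: inj_eq)
  qed
qed

text \<open>If \<open>t \<ge> 2\<close>, the common value \<open>T\<close> of \<open>\<bar>\<psi>\<^sub>i(l)\<bar>\<^sup>2\<close> is at least a triple root of the integer
  polynomial with roots the products of two of the \<open>chi C l k\<close>, hence so is each conjugate of
  \<open>T\<close>. A product with a real factor is at most a double root, so all conjugates of the unit \<open>T\<close>
  have absolute value \<open>T\<close>, which forces \<open>T = 1\<close>.\<close>

lemma card_t_eq_1: "CARD('t) = 1"
proof (rule ccontr)
  assume "CARD('t) \<noteq> 1"
  then obtain i0 i1 :: 't where i: "i0 \<noteq> i1"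
    by (metis (full_types) UNIV_eq_I card_1_singleton_iff One_nat_def insertI1 singletonI)
  obtain l where l: "generic l" using generic_exists by blast
  then have "l \<in> L" by (simp add: generic_def)
  then obtain P where P: "ipoly P = (\<Prod>p\<in>UNIV. [:- (chi C l (fst p) * chi C l (snd p)), 1:])"
    using chi_charpoly(3) by blast
  have inj: "inj (chi C l)" by (rule generic_min_ipoly[OF l])
  have n1: "(\<Prod>p\<in>UNIV. cmod (chi C l (fst p) * chi C l (snd p))) = 1"
  proof -
    have "(\<Prod>p\<in>UNIV \<times> UNIV. cmod (chi C l (fst p)) * cmod (chi C l (snd p))) =
        (\<Prod>a\<in>UNIV. \<Prod>b\<in>UNIV. cmod (chi C l a) * cmod (chi C l b))"
      by (simp add: prod.cartesian_product case_prod_unfold)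
    also have "\<dots> = 1"
      unfolding prod.distrib prod_constant by (simp add: prod_power_distrib[symmetric] prod_cmod_chi sum_ell del: prod_norm)
    finally show ?thesis by (simp add: norm_mult)
  qed
  note P' = unit_ipoly[OF P n1]
  have "P \<noteq> 0" using P'(1) by auto
  have ord: "Polynomial.order w (ipoly P) = card {p. chi C l (fst p) * chi C l (snd p) = w}" for w
    unfolding P by (subst order_prod_linear) auto
  define r where "r = exp (2 * ((\<chi> j. - 1 / (2 * real CARD('t))) \<bullet> l))"
  have cm: "cmod (chi C l (Inr a) * chi C l (Inr b)) = r" for a b
  proof -
    have "ell (Inr a :: 's + 't + 't) = (\<chi> j. - 1 / (2 * real CARD('t)))" for a
      by (simp add: ell_def)
    then show ?thesis by (simp add: norm_mult cmod_chi[OF re] r_def flip: exp_add)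
  qed
  have T: "chi C l (Inr (Inl i)) * chi C l (Inr (Inr i)) = of_real r" for i
  proof -
    have "chi C l (Inr (Inl i)) * chi C l (Inr (Inr i)) = of_real ((cmod (chi C l (Inr (Inl i))))\<^sup>2)"
      by (simp only: chi_Inr_Inr complex_norm_square)
    also have "(cmod (chi C l (Inr (Inl i))))\<^sup>2 = r"
      using cm[of "Inl i" "Inl i"] by (simp add: norm_mult power2_eq_square)
    finally show ?thesis .
  qed
  \<comment> \<open>Multiplicities count ordered pairs: both orders for \<open>i0\<close> and one
    for \<open>i1\<close> already exceed the two orders of a product with a real factor.\<close>
  have "{(Inr (Inl i0), Inr (Inr i0)), (Inr (Inr i0), Inr (Inl i0)), (Inr (Inl i1), Inr (Inr i1))}
      \<subseteq> {p. chi C l (fst p) * chi C l (snd p) = of_real r}"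
    using T by (auto simp: mult.commute)
  from card_mono[OF finite this] have ord_r: "Polynomial.order (of_real r) (ipoly P) \<ge> 3"
    using i by (simp add: ord)
  have "poly (ipoly P) (of_real r) = 0"
    using ord_r \<open>P \<noteq> 0\<close> by (simp add: order_root)
  then obtain m where m: "min_ipoly (of_real r) m" "Polynomial.lead_coeff m = 1" "\<bar>Polynomial.coeff m 0\<bar> = 1"
    using monic_min_ipoly[OF P'(1,2)] by metis
  define Z where "Z = {w. poly (ipoly m) w = 0}"
  have "cmod w = r" if w: "w \<in> Z" for w
  proof (rule ccontr)
    assume neq: "cmod w \<noteq> r"
    have "3 \<le> Polynomial.order w (ipoly P)"
      using min_ipoly_order_le[OF m(1) _ \<open>P \<noteq> 0\<close>] w ord_r by (force simp: Z_def)
    then have c3: "3 \<le> card {p. chi C l (fst p) * chi C l (snd p) = w}" by (simp add: ord)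
    then obtain a b where ab: "chi C l a * chi C l b = w"
      by (metis (mono_tags, lifting) card.empty empty_Collect_eq not_numeral_le_zero)
    \<comment> \<open>Two non-real factors would give absolute value \<open>r\<close>.\<close>
    have "\<exists>j. a = Inl j \<or> b = Inl j"
      using cm ab neq by (metis sumE)
    then obtain j b' where jb: "chi C l (Inl j) * chi C l b' = w"
      using ab by (metis mult.commute)
    have "{p. chi C l (fst p) * chi C l (snd p) = w} \<subseteq> {(Inl j, b'), (b', Inl j)}"
    proof
      fix p assume "p \<in> {p. chi C l (fst p) * chi C l (snd p) = w}"
      then have "chi C l (Inl j) * chi C l b' = chi C l (fst p) * chi C l (snd p)" using jb by simp
      from generic_pair_unique[OF l inj this] show "p \<in> {(Inl j, b'), (b', Inl j)}" by auto
    qed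
    then have "card {p. chi C l (fst p) * chi C l (snd p) = w} \<le> card {(Inl j, b'), (b', Inl j)}"
      by (rule card_mono[rotated]) (rule finite)
    also have "\<dots> \<le> 2"
      using card_length[of "[(Inl j, b'), (b', Inl j)]"] by simp
    finally show False using c3 by simp
  qed
  then have "(\<Prod>w\<in>Z. cmod w) = r ^ card Z" by simp
  then have "r ^ card Z = 1" using min_ipoly_roots(4)[OF m] by (simp add: Z_def)
  moreover have "card Z > 0" using min_ipoly_roots(3)[OF m(1,2)] m(1) by (simp add: Z_def min_ipoly_def)
  moreover have "r \<ge> 0" by (simp add: r_def)
  ultimately have "r = 1" using power_eq_imp_eq_base[of r "card Z" 1] by simp
  then have "(\<chi> j. - 1 / (2 * real CARD('t))) \<bullet> l = 0" by (simp add: r_def)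
  moreover have "ell (Inr (Inl i0) :: 's + 't + 't) = (\<chi> j. - 1 / (2 * real CARD('t)))" by (simp add: ell_def)
  ultimately show False using generic_ell_nonzero[OF l, of "Inr (Inl i0)"] by simp
qed

text \<open>The traces required by \<open>trace_dual\<close> are those of \<open>l + j l0\<close>,
  again an element of \<open>L\<close>, because characters turn sums into products.\<close>

lemma generic_dual:
  assumes l0: "generic l0" and l: "l \<in> L" and m: "ipoly m = (\<Prod>k\<in>UNIV. [:- chi C l0 k, 1:])"
  obtains g where "\<And>k. poly (ipoly g) (chi C l0 k) = chi C l k * poly (ipoly (pderiv m)) (chi C l0 k)"
proof (rule trace_dual[OF m])
  fix j
  have "l + of_nat j *\<^sub>R l0 \<in> L"
    using L_plus[OF l L_int[of l0 "int j"]] l0 by (simp add: generic_def)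
  from chi_charpoly(2)[OF this] show "(\<Sum>k\<in>UNIV. chi C l k * chi C l0 k ^ j) \<in> \<int>"
    by (simp add: chi_add chi_scale_nat)
qed (rule that)

end

section \<open>The number field\<close>

lemma CC_simps [simp]:
  "carrier CC = UNIV" "x \<otimes>\<^bsub>CC\<^esub> y = x * y" "\<one>\<^bsub>CC\<^esub> = 1" "\<zero>\<^bsub>CC\<^esub> = 0" "x \<oplus>\<^bsub>CC\<^esub> y = x + y"
  by (simp_all add: ring_of_type_algebra_def)

lemma field_CC: "field CC"
  by (rule field_from_type_algebra)

lemma CC_a_inv [simp]: "\<ominus>\<^bsub>CC\<^esub> x = - x"
proof -
  interpret field CC by (rule field_CC)
  show ?thesis by (rule minus_equality) auto
qed

lemma CC_m_inv [simp]: "x \<noteq> 0 \<Longrightarrow> inv\<^bsub>CC\<^esub> x = inverse x"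
proof -
  interpret field CC by (rule field_CC)
  show "x \<noteq> 0 \<Longrightarrow> inv\<^bsub>CC\<^esub> x = inverse x" by (rule comm_inv_char) auto
qed

section \<open>Evaluation of rational polynomials\<close>

definition ratev :: "rat poly \<Rightarrow> complex \<Rightarrow> complex" where
  "ratev f x = poly (map_poly of_rat f) x"

lemma ratev_simps [simp]:
  "ratev 0 x = 0" "ratev 1 x = 1" "ratev (pCons a f) x = of_rat a + x * ratev f x"
  "ratev (Polynomial.monom a i) x = of_rat a * x ^ i"
  by (simp_all add: ratev_def map_poly_pCons map_poly_monom poly_monom)

lemma ratev_add [simp]: "ratev (f + g) x = ratev f x + ratev g x"
proof -
  have "map_poly of_rat (f + g) = (map_poly of_rat f + map_poly of_rat g :: complex poly)"
    by (rule poly_eqI) (simp add: coeff_map_poly of_rat_add)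
  then show ?thesis by (simp add: ratev_def)
qed

lemma ratev_uminus [simp]: "ratev (- f) x = - ratev f x"
  using ratev_add[of f "- f" x] by (simp add: eq_neg_iff_add_eq_0 add.commute)

lemma ratev_diff [simp]: "ratev (f - g) x = ratev f x - ratev g x"
  using ratev_add[of f "- g" x] by simp

lemma ratev_mult [simp]: "ratev (f * g) x = ratev f x * ratev g x"
proof -
  have "map_poly of_rat (f * g) = (map_poly of_rat f * map_poly of_rat g :: complex poly)"
    by (rule poly_eqI) (simp add: coeff_map_poly coeff_mult of_rat_mult of_rat_sum)
  then show ?thesis by (simp add: ratev_def)
qed

lemma cnj_of_rat [simp]: "cnj (of_rat r) = of_rat r"
  by (cases r) (simp add: of_rat_rat)

lemma ratev_cnj: "ratev f (cnj x) = cnj (ratev f x)"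
  by (induction f) auto

lemma ratev_of_int_poly: "ratev (map_poly of_int p) x = poly (ipoly p) x"
  by (induction p) (auto simp: map_poly_pCons)

text \<open>As \<open>c\<close> and \<open>g\<close> do not depend on \<open>x\<close>, a relation
  at one root can be read at all its conjugates.\<close>

lemma ratev_clear_denominators:
  "\<exists>c g. c \<noteq> 0 \<and> (\<forall>x. of_int c * ratev f x = poly (ipoly g) x)"
proof (induction f)
  case 0
  show ?case by (intro exI[of _ 1] exI[of _ 0]) simp
next
  case (pCons a f)
  then obtain c g where cg: "c \<noteq> 0" "\<And>x. of_int c * ratev f x = poly (ipoly g) x" by blast
  obtain p q where pq: "a = Rat.Fract p q" "q > 0" by (cases a) auto
  have "of_int (q * c) * ratev (pCons a f) x = poly (ipoly (pCons (p * c) (Polynomial.smult q g))) x" for x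
    using pq cg(2)[of x, symmetric]
    by (simp add: map_poly_pCons ipoly_smult of_rat_rat field_simps)
  then show ?case using cg(1) pq(2) by (intro exI[of _ "q * c"] exI) auto
qed

text \<open>A complete system of conjugates: \<open>\<gamma>\<close> lists the roots of an
  irreducible \<open>m\<close>, and the root at \<open>k0\<close> generates the field.\<close>

locale conj_system =
  fixes m :: "int poly" and \<gamma> :: "'n::finite \<Rightarrow> complex" and k0 :: 'n
  assumes inj: "inj \<gamma>"
    and prod: "ipoly m = (\<Prod>k\<in>UNIV. [:- \<gamma> k, 1:])"
    and min: "min_ipoly (\<gamma> k0) m"
begin

definition "K = range (\<lambda>f. ratev f (\<gamma> k0))"

text \<open>The embedding that sends \<open>\<gamma> k0\<close> to \<open>\<gamma> k\<close>. By
  \<open>ratev_eq\<close> the choice of the polynomial does not affect the value; outside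
  \<open>K\<close> it is \<open>undefined\<close>, as \<open>embeddings\<close> demands.\<close>

definition emb :: "'n \<Rightarrow> complex \<Rightarrow> complex" where
  "emb k x = (if x \<in> K then ratev (SOME f. ratev f (\<gamma> k0) = x) (\<gamma> k) else undefined)"

lemma degree_m: "Polynomial.degree m = CARD('n)"
proof -
  have "Polynomial.degree (ipoly m) = CARD('n)" unfolding prod by (simp add: degree_prod_sum_eq)
  then show ?thesis by simp
qed

lemma root_iff: "poly (ipoly m) x = 0 \<longleftrightarrow> x \<in> range \<gamma>"
  unfolding prod by (auto simp: poly_prod)

lemma ratev_root:
  assumes "ratev f (\<gamma> k0) = 0"
  shows "ratev f (\<gamma> k) = 0"
proof -
  obtain c g where cg: "c \<noteq> 0" "\<And>x. of_int c * ratev f x = poly (ipoly g) x"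
    using ratev_clear_denominators by blast
  then have "poly (ipoly g) (\<gamma> k0) = 0" using assms by (metis mult_zero_right)
  then have "m dvd g" using min by (simp add: min_ipoly_def)
  then obtain h where "g = m * h" by (auto simp: dvd_def)
  moreover have "poly (ipoly m) (\<gamma> k) = 0" using root_iff by blast
  ultimately have "of_int c * ratev f (\<gamma> k) = 0" by (simp add: cg(2) ipoly_mult)
  then show ?thesis using cg(1) by simp
qed

lemma ratev_eq:
  assumes "ratev f (\<gamma> k0) = ratev g (\<gamma> k0)"
  shows "ratev f (\<gamma> k) = ratev g (\<gamma> k)"
  using ratev_root[of "f - g" k] assms by simp

text \<open>By \<open>ratev_root\<close>, \<open>f\<close> vanishes at all \<open>CARD('n)\<close>
  conjugates, more roots than its degree allows. This carries the irreducibility of \<open>m\<close>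
  over to rational polynomials.\<close>

lemma ratev_small:
  assumes "ratev f (\<gamma> k0) = 0" "Polynomial.degree f < CARD('n)"
  shows "f = 0"
proof (rule ccontr)
  assume "f \<noteq> 0"
  define p :: "complex poly" where "p = map_poly of_rat f"
  have p: "p \<noteq> 0" "Polynomial.degree p = Polynomial.degree f"
    using \<open>f \<noteq> 0\<close> by (auto simp: p_def poly_eq_iff coeff_map_poly degree_map_poly)
  have "range \<gamma> \<subseteq> {x. poly p x = 0}"
    using ratev_root[OF assms(1)] by (auto simp: p_def ratev_def)
  then have "card (range \<gamma>) \<le> card {x. poly p x = 0}"
    using poly_roots_finite[OF p(1)] by (intro card_mono)
  also have "\<dots> \<le> Polynomial.degree p" by (rule card_poly_roots_bound[OF p(1)])
  finally show False using assms(2) p(2) inj by (simp add: card_image)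
qed

text \<open>With \<open>d\<close> the gcd of \<open>f\<close> and \<open>M\<close>, the cofactor of
  \<open>d\<close> in \<open>M\<close> vanishes at \<open>\<gamma> k0\<close>, so by
  \<open>ratev_small\<close> it has full degree and \<open>d\<close> is constant. Bezout then yields
  the inverse.\<close>

lemma ratev_inverse:
  assumes "ratev f (\<gamma> k0) \<noteq> 0"
  shows "\<exists>h. ratev h (\<gamma> k0) * ratev f (\<gamma> k0) = 1"
proof -
  define M :: "rat poly" where "M = map_poly of_int m"
  have M0: "ratev M (\<gamma> k0) = 0" using min by (simp add: M_def ratev_of_int_poly min_ipoly_def)
  have degM: "Polynomial.degree M = CARD('n)" by (simp add: M_def degree_map_poly degree_m)
  then have "M \<noteq> 0" by (metis degree_0 zero_less_card_finite less_irrefl)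
  define d where "d = gcd f M"
  obtain e e' where e: "M = d * e" "f = d * e'" unfolding d_def by (meson dvdE gcd_dvd1 gcd_dvd2)
  have "ratev d (\<gamma> k0) \<noteq> 0" using assms e(2) by auto
  then have "ratev e (\<gamma> k0) = 0" using M0 e(1) by simp
  moreover have "e \<noteq> 0" "d \<noteq> 0" using e(1) \<open>M \<noteq> 0\<close> by auto
  ultimately have "\<not> Polynomial.degree e < CARD('n)" using ratev_small by blast
  then have "Polynomial.degree d = 0"
    using degM e(1) \<open>e \<noteq> 0\<close> \<open>d \<noteq> 0\<close> by (simp add: degree_mult_eq)
  then obtain c where c: "d = [:c:]" by (auto elim: degree_eq_zeroE)
  have "c \<noteq> 0" using c \<open>d \<noteq> 0\<close> by simp
  obtain a b where ab: "a * f + b * M = d"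
    using bezout_coefficients_fst_snd unfolding d_def by metis
  then have "ratev (a * f + b * M) (\<gamma> k0) = of_rat c" using c by simp
  then have "ratev a (\<gamma> k0) * ratev f (\<gamma> k0) = of_rat c" using M0 by simp
  then have "ratev ([:1 / c:] * a) (\<gamma> k0) * ratev f (\<gamma> k0) = 1"
    using \<open>c \<noteq> 0\<close> by (simp add: of_rat_divide mult.assoc del: mult_pCons_left)
  then show ?thesis by blast
qed

lemma ratev_K [simp, intro]: "ratev f (\<gamma> k0) \<in> K"
  by (simp add: K_def)

lemma emb_ratev [simp]: "emb k (ratev f (\<gamma> k0)) = ratev f (\<gamma> k)"
proof -
  have "ratev (SOME g. ratev g (\<gamma> k0) = ratev f (\<gamma> k0)) (\<gamma> k0) = ratev f (\<gamma> k0)"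
    by (rule someI[of "\<lambda>g. ratev g (\<gamma> k0) = ratev f (\<gamma> k0)" f]) (rule refl)
  from ratev_eq[OF this] show ?thesis by (simp add: emb_def)
qed

lemma K_cases:
  assumes "x \<in> K"
  obtains f where "x = ratev f (\<gamma> k0)"
  using assms by (auto simp: K_def)

lemma K_closed:
  "0 \<in> K" "1 \<in> K" "\<And>x. x \<in> K \<Longrightarrow> - x \<in> K"
  "\<And>x y. x \<in> K \<Longrightarrow> y \<in> K \<Longrightarrow> x + y \<in> K" "\<And>x y. x \<in> K \<Longrightarrow> y \<in> K \<Longrightarrow> x * y \<in> K"
  "\<And>x. x \<in> K \<Longrightarrow> x \<noteq> 0 \<Longrightarrow> inverse x \<in> K" "of_rat r \<in> K" "\<gamma> k0 \<in> K"
proof -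
  show "0 \<in> K" using ratev_K[of 0] by simp
  show "1 \<in> K" using ratev_K[of 1] by simp
  show "- x \<in> K" if "x \<in> K" for x using that ratev_K[of "- _"] by (elim K_cases) simp
  show "x + y \<in> K" if "x \<in> K" "y \<in> K" for x y
    using that ratev_K[of "_ + _"] by (elim K_cases) simp
  show "x * y \<in> K" if "x \<in> K" "y \<in> K" for x y
    using that ratev_K[of "_ * _"] by (elim K_cases) simp
  show "inverse x \<in> K" if "x \<in> K" "x \<noteq> 0" for x
  proof -
    obtain f where f: "x = ratev f (\<gamma> k0)" using \<open>x \<in> K\<close> by (rule K_cases)
    then obtain h where "ratev h (\<gamma> k0) * x = 1" using ratev_inverse \<open>x \<noteq> 0\<close> by blast
    then have "inverse x = ratev h (\<gamma> k0)" by (metis inverse_unique mult.commute)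
    then show ?thesis by simp
  qed
  show "of_rat r \<in> K" using ratev_K[of "[:r:]"] by simp
  show "\<gamma> k0 \<in> K" using ratev_K[of "[:0, 1:]"] by simp
qed

lemma subfield_K: "subfield K CC"
proof -
  interpret field CC by (rule field_CC)
  show ?thesis
    by (intro subfieldI' subringI) (auto simp: K_closed)
qed

text \<open>\<open>E i\<close> is spanned by the first \<open>i\<close> powers of
  \<open>\<gamma> k0\<close>. By \<open>ratev_small\<close> the next power is new while i <
  \<open>CARD('n)\<close>; reduction modulo \<open>M\<close> shows that the last \<open>E i\<close>
  is \<open>K\<close>.\<close>

lemma dimension_K: "ring.dimension CC CARD('n) \<rat> K"
proof -
  interpret field CC by (rule field_CC)
  \<comment> \<open>The alternative \<open>f = 0\<close> makes \<open>E 0\<close> the zero space,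
    since the zero polynomial has degree 0.\<close>
  define E where "E i = {ratev f (\<gamma> k0) | f. Polynomial.degree f < i \<or> f = 0}" for i
  have E: "dimension i \<rat> (E i)" if "i \<le> CARD('n)" for i
    using that
  proof (induction i)
    case 0
    have "E 0 = {\<zero>\<^bsub>CC\<^esub>}" by (auto simp: E_def)
    then show ?case using zero_dim by metis
  next
    case (Suc i)
    have notin: "\<gamma> k0 ^ i \<notin> E i"
    proof
      assume "\<gamma> k0 ^ i \<in> E i"
      then obtain f where f: "\<gamma> k0 ^ i = ratev f (\<gamma> k0)" "Polynomial.degree f < i \<or> f = 0"
        by (auto simp: E_def)
      define h where "h = Polynomial.monom 1 i - f"
      have c: "Polynomial.coeff h i = 1" using f(2) by (auto simp: h_def coeff_eq_0)
      have "Polynomial.degree h \<le> i"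
        using f(2) unfolding h_def by (intro degree_diff_le) (auto simp: degree_monom_le)
      moreover have "ratev h (\<gamma> k0) = 0" using f(1) by (simp add: h_def)
      ultimately have "h = 0" using ratev_small Suc.prems by force
      then show False using c by simp
    qed
    have "E (Suc i) = line_extension \<rat> (\<gamma> k0 ^ i) (E i)"
    proof (intro equalityI subsetI)
      fix x assume "x \<in> E (Suc i)"
      then obtain f where f: "x = ratev f (\<gamma> k0)" "Polynomial.degree f < Suc i \<or> f = 0"
        by (auto simp: E_def)
      then have deg: "Polynomial.degree f \<le> i" by auto
      define h where "h = f - Polynomial.monom (Polynomial.coeff f i) i"
      have "Polynomial.degree h < i \<or> h = 0"
      proof (rule ccontr)
        assume *: "\<not> (Polynomial.degree h < i \<or> h = 0)"
        have "Polynomial.degree h \<le> i"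
          using deg unfolding h_def by (intro degree_diff_le) (auto simp: degree_monom_le)
        then have "Polynomial.degree h = i" using * by simp
        moreover have "Polynomial.coeff h i = 0" by (simp add: h_def)
        ultimately show False using * by (metis leading_coeff_0_iff)
      qed
      then have "ratev h (\<gamma> k0) \<in> E i" by (auto simp: E_def)
      moreover have "x = of_rat (Polynomial.coeff f i) * \<gamma> k0 ^ i + ratev h (\<gamma> k0)"
        by (simp add: f h_def)
      ultimately show "x \<in> line_extension \<rat> (\<gamma> k0 ^ i) (E i)"
        unfolding line_extension_mem_iff by (intro bexI[of _ "of_rat (Polynomial.coeff f i)"] bexI) auto
    next
      fix x assume "x \<in> line_extension \<rat> (\<gamma> k0 ^ i) (E i)"
      then obtain c y where cy: "c \<in> \<rat>" "y \<in> E i" "x = c * \<gamma> k0 ^ i + y"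
        unfolding line_extension_mem_iff by auto
      obtain r where r: "c = of_rat r" using cy(1) by (auto elim: Rats_cases)
      obtain f where f: "y = ratev f (\<gamma> k0)" "Polynomial.degree f < i \<or> f = 0"
        using cy(2) by (auto simp: E_def)
      have "Polynomial.degree (Polynomial.monom r i + f) \<le> i"
        using f(2) by (intro degree_add_le) (auto simp: degree_monom_le)
      moreover have "x = ratev (Polynomial.monom r i + f) (\<gamma> k0)" using cy r f by simp
      ultimately show "x \<in> E (Suc i)" unfolding E_def by (blast intro: le_imp_less_Suc)
    qed
    then show ?case using Suc_dim[OF _ notin Suc.IH] Suc.prems by simp
  qed
  have "K = E CARD('n)"
  proof (intro equalityI subsetI)
    fix x assume "x \<in> K"
    then obtain f where f: "x = ratev f (\<gamma> k0)" by (rule K_cases)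
    define M :: "rat poly" where "M = map_poly of_int m"
    have M0: "ratev M (\<gamma> k0) = 0" using min by (simp add: M_def ratev_of_int_poly min_ipoly_def)
    have degM: "Polynomial.degree M = CARD('n)" by (simp add: M_def degree_map_poly degree_m)
    then have "M \<noteq> 0" by (metis degree_0 zero_less_card_finite less_irrefl)
    have "x = ratev (f div M * M + f mod M) (\<gamma> k0)" by (simp only: div_mult_mod_eq f)
    also have "\<dots> = ratev (f mod M) (\<gamma> k0)" unfolding ratev_add ratev_mult M0 by simp
    finally have "x = ratev (f mod M) (\<gamma> k0)" .
    moreover have "Polynomial.degree (f mod M) < CARD('n) \<or> f mod M = 0"
      using degree_mod_less[OF \<open>M \<noteq> 0\<close>, of f] unfolding degM by (rule disj_commute[THEN iffD1])
    ultimately show "x \<in> E CARD('n)"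
      unfolding E_def by (intro CollectI exI[of _ "f mod M"] conjI)
  next
    fix x assume "x \<in> E CARD('n)"
    then show "x \<in> K" unfolding E_def by (elim CollectE exE conjE) (simp only: ratev_K)
  qed
  then show ?thesis using E[of "CARD('n)"] by simp
qed

lemma number_field_K: "number_field K CARD('n)"
  using subfield_K dimension_K by (simp add: number_field_def)

lemma emb_ring_hom: "emb k \<in> embeddings K"
proof -
  have "emb k (x + y) = emb k x + emb k y \<and> emb k (x * y) = emb k x * emb k y"
    if "x \<in> K" "y \<in> K" for x y
  proof -
    obtain f g where fg: "x = ratev f (\<gamma> k0)" "y = ratev g (\<gamma> k0)"
      using \<open>x \<in> K\<close> \<open>y \<in> K\<close> unfolding K_def by blast
    have "emb k (ratev (f + g) (\<gamma> k0)) = emb k x + emb k y" "emb k (ratev (f * g) (\<gamma> k0)) = emb k x * emb k y"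
      unfolding fg emb_ratev by simp_all
    then show ?thesis by (simp add: fg)
  qed
  moreover have "emb k 1 = 1" using emb_ratev[of k 1] by simp
  ultimately have "emb k \<in> ring_hom (CC\<lparr>carrier := K\<rparr>) CC"
    by (intro ring_hom_memI) auto
  moreover have "emb k \<in> extensional K" by (auto simp: extensional_def emb_def)
  ultimately show ?thesis by (simp add: embeddings_def)
qed

lemma emb_gamma [simp]: "emb k (\<gamma> k0) = \<gamma> k"
  using emb_ratev[of k "[:0, 1:]"] by simp

text \<open>A homomorphism fixes the rationals, so it sends \<open>\<gamma> k0\<close> to a root of
  \<open>m\<close>, and this root determines it on \<open>K\<close>.\<close>

lemma embedding_cases:
  assumes "h \<in> embeddings K"
  shows "h \<in> range emb"
proof -
  have h: "h (x + y) = h x + h y" "h (x * y) = h x * h y" if "x \<in> K" "y \<in> K" for x y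
    using assms that ring_hom_add[of h "CC\<lparr>carrier := K\<rparr>" CC x y] ring_hom_mult[of h "CC\<lparr>carrier := K\<rparr>" CC x y]
    by (auto simp: embeddings_def)
  have h1: "h 1 = 1"
    using assms ring_hom_one[of h "CC\<lparr>carrier := K\<rparr>" CC] by (auto simp: embeddings_def)
  have h0: "h 0 = 0" using h(1)[of 0 0] K_closed(1) by simp
  have hneg: "h (- x) = - h x" if "x \<in> K" for x
    using h(1)[OF that K_closed(3)[OF that]] h0 by (simp add: eq_neg_iff_add_eq_0 add.commute)
  have ratK: "of_int n \<in> K" for n using K_closed(7)[of "of_int n"] by simp
  have hnat: "h (of_nat n) = of_nat n" for n
  proof (induction n)
    case (Suc n)
    then show ?case using h(1)[OF K_closed(2) ratK[of "int n"]] h1 by simp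
  qed (simp add: h0)
  have hint: "h (of_int n) = of_int n" for n
    using hnat hneg[OF ratK[of "int _"]] by (cases n rule: int_cases2) auto
  have hrat: "h (of_rat r) = of_rat r" for r
  proof -
    obtain p q where pq: "r = Rat.Fract p q" "q > 0" by (cases r) auto
    then have eq: "of_rat r * of_int q = (of_int p :: complex)" by (simp add: of_rat_rat)
    have "h (of_rat r) * of_int q = of_int p"
      using h(2)[OF K_closed(7) ratK, of r q] by (simp add: eq hint)
    then have "h (of_rat r) * of_int q = of_rat r * of_int q" by (simp add: eq)
    then show ?thesis using pq(2) by simp
  qed
  have hratev: "h (ratev f (\<gamma> k0)) = ratev f (h (\<gamma> k0))" for f
    by (induction f) (simp_all add: h h0 hrat K_closed)
  have "poly (ipoly m) (h (\<gamma> k0)) = h (poly (ipoly m) (\<gamma> k0))"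
    using hratev[of "map_poly of_int m"] by (simp add: ratev_of_int_poly)
  also have "poly (ipoly m) (\<gamma> k0) = 0" by (simp add: root_iff)
  finally have "poly (ipoly m) (h (\<gamma> k0)) = 0" by (simp add: h0)
  then obtain k where k: "h (\<gamma> k0) = \<gamma> k" using root_iff by blast
  have "h x = emb k x" for x
  proof (cases "x \<in> K")
    case True
    then obtain f where "x = ratev f (\<gamma> k0)" by (rule K_cases)
    then show ?thesis by (simp add: hratev k)
  next
    case False
    then show ?thesis using assms by (simp add: embeddings_def extensional_def emb_def)
  qed
  then show ?thesis by blast
qed

lemma bij_emb: "bij_betw emb UNIV (embeddings K)"
  unfolding bij_betw_def
proof
  show "inj emb"
  proof (rule injI)
    fix k k' assume "emb k = emb k'"
    then have "\<gamma> k = \<gamma> k'" by (metis emb_gamma)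
    then show "k = k'" using inj by (simp add: inj_eq)
  qed
  show "range emb = embeddings K" using emb_ring_hom embedding_cases by blast
qed

text \<open>The hypothesis is the output of \<open>trace_dual\<close>. Since \<open>m\<close> is
  squarefree, its derivative can be divided out at every root.\<close>

lemma emb_quotient:
  assumes "\<And>k. poly (ipoly g) (\<gamma> k) = y k * poly (ipoly (pderiv m)) (\<gamma> k)"
  shows "y k0 \<in> K" "emb k (y k0) = y k"
proof -
  have nz: "poly (ipoly (pderiv m)) (\<gamma> k) \<noteq> 0" for k
    using min_ipoly_rsquarefree[OF min] root_iff unfolding rsquarefree_roots ipoly_pderiv by blast
  have "ratev (map_poly of_int g) (\<gamma> k0) * inverse (ratev (map_poly of_int (pderiv m)) (\<gamma> k0)) \<in> K"
    by (rule K_closed(5)[OF ratev_K K_closed(6)[OF ratev_K]]) (simp add: ratev_of_int_poly nz)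
  then show yK: "y k0 \<in> K" using nz[of k0] assms
    by (simp add: ratev_of_int_poly mult.assoc)
  then obtain f where f: "y k0 = ratev f (\<gamma> k0)" by (rule K_cases)
  have "ratev (f * map_poly of_int (pderiv m)) (\<gamma> k0) = ratev (map_poly of_int g) (\<gamma> k0)"
    by (simp add: ratev_of_int_poly assms f)
  then have "ratev (f * map_poly of_int (pderiv m)) (\<gamma> k) = ratev (map_poly of_int g) (\<gamma> k)" by (rule ratev_eq)
  then have "ratev f (\<gamma> k) = y k" using nz by (simp add: ratev_of_int_poly assms)
  then show "emb k (y k0) = y k" by (simp add: f)
qed

lemma generate_field_eq_K:
  assumes "U \<subseteq> K" "\<gamma> k0 \<in> U"
  shows "generate_field CC U = K"
proof
  interpret field CC by (rule field_CC)
  show "generate_field CC U \<subseteq> K"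
  proof
    fix x assume "x \<in> generate_field CC U"
    then show "x \<in> K"
      by induction (use assms(1) in \<open>auto simp: K_closed\<close>)
  qed
  have gen: "subfield (generate_field CC U) CC" by (rule generate_field_is_subfield) simp
  note g = subringE[OF subfieldE(1)[OF gen]]
  have int: "of_nat n \<in> generate_field CC U" for n
    by (induction n) (use g in auto)
  have int': "of_int n \<in> generate_field CC U" for n
    by (cases n rule: int_cases2) (use int g(5) in force)+
  have rat: "of_rat r \<in> generate_field CC U" for r
  proof -
    obtain p q where pq: "r = Rat.Fract p q" "q > 0" by (cases r) auto
    have "inverse (of_int q) \<in> generate_field CC U"
      using generate_field.m_inv[of "of_int q" CC U] int'[of q] pq(2) by simp
    then have "of_int p * inverse (of_int q) \<in> generate_field CC U"
      using g(6)[OF int'[of p]] by simp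
    then show ?thesis using pq by (simp add: of_rat_rat divide_inverse)
  qed
  have a: "\<gamma> k0 \<in> generate_field CC U" using assms(2) by (rule generate_field.incl)
  show "K \<subseteq> generate_field CC U"
  proof
    fix x assume "x \<in> K"
    then obtain f where "x = ratev f (\<gamma> k0)" by (rule K_cases)
    moreover have "ratev f (\<gamma> k0) \<in> generate_field CC U"
    proof (induction f)
      case (pCons c f)
      then show ?case using g(7)[OF rat[of c] g(6)[OF a, of "ratev f (\<gamma> k0)"]] by simp
    qed (use g(2) in simp)
    ultimately show "x \<in> generate_field CC U" by simp
  qed
qed

end

section \<open>The OT data of a lattice\<close>

lemma common_denominator:
  fixes q :: "'a \<Rightarrow> rat"
  assumes "finite B"
  shows "\<exists>D :: int. D \<noteq> 0 \<and> (\<forall>x\<in>B. \<exists>n. of_int D * q x = of_int n)"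
  using assms
proof (induction B)
  case empty
  show ?case by (intro exI[of _ 1]) auto
next
  case (insert y B)
  then obtain D where D: "D \<noteq> 0" "\<And>x. x \<in> B \<Longrightarrow> \<exists>n. of_int D * q x = of_int n" by blast
  obtain p r where pr: "q y = Rat.Fract p r" "r > 0" by (cases "q y") auto
  have "\<exists>n. of_int (r * D) * q x = of_int n" if "x \<in> insert y B" for x
  proof (cases "x = y")
    case True
    have "of_int (r * D) * q y = of_int (D * p)" using pr by (simp add: Fract_of_int_quotient)
    then show ?thesis using True by blast
  next
    case False
    then obtain n where "of_int D * q x = of_int n" using D(2) \<open>x \<in> insert y B\<close> by blast
    then have "of_int (r * D) * q x = of_int (r * n)" by (simp add: mult.assoc)
    then show ?thesis by blast
  qed
  then show ?case using D(1) pr(2) by (intro exI[of _ "r * D"]) auto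
qed

text \<open>A rational dependence, cleared of denominators; it bounds the rank of \<open>U\<close>.
  Linear dependence concerns sets of vectors, so two equal vectors are a separate case, with
  coefficients 1 and -1.\<close>

lemma integer_dependence:
  fixes c :: "'a \<Rightarrow> 's::finite \<Rightarrow> int"
  assumes "finite B" "card B > CARD('s)"
  shows "\<exists>n. (\<exists>x\<in>B. n x \<noteq> 0) \<and> (\<forall>k. (\<Sum>x\<in>B. n x * c x k) = 0)"
proof -
  define v :: "'a \<Rightarrow> rat^'s" where "v x = (\<chi> k. of_int (c x k))" for x
  have vc: "c x = c y" if "v x = v y" for x y
    using that by (auto simp: v_def vec_eq_iff)
  show ?thesis
  proof (cases "inj_on v B")
    case True
    then have "card (v ` B) > CARD('s)" using assms(2) by (simp add: card_image)
    then have "vec.dependent (v ` B)"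
      using vec.independent_card_le_dim[of "v ` B" UNIV] unfolding vec_dim_card by auto
    then obtain q where q: "\<exists>w\<in>v ` B. q w \<noteq> 0" "(\<Sum>w\<in>v ` B. q w *s w) = 0"
      using assms(1) by (auto simp: vec.dependent_finite)
    have q0: "(\<Sum>x\<in>B. q (v x) * of_int (c x k)) = 0" for k
    proof -
      have "(\<Sum>x\<in>B. q (v x) *s v x) = 0" using q(2) by (simp only: sum.reindex[OF True] o_def)
      then have "(\<Sum>x\<in>B. q (v x) *s v x) $ k = 0" by simp
      then show ?thesis by (simp add: v_def)
    qed
    obtain D :: int where D: "D \<noteq> 0" "\<And>x. x \<in> B \<Longrightarrow> \<exists>n. of_int D * q (v x) = of_int n"
      using common_denominator[OF assms(1), of "\<lambda>x. q (v x)"] by blast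
    then obtain n where n: "\<And>x. x \<in> B \<Longrightarrow> of_int D * q (v x) = of_int (n x)" by metis
    have "(\<Sum>x\<in>B. n x * c x k) = 0" for k
    proof -
      have "of_int (\<Sum>x\<in>B. n x * c x k) = (\<Sum>x\<in>B. of_int D * q (v x) * of_int (c x k))"
        using n by simp
      also have "\<dots> = of_int D * (\<Sum>x\<in>B. q (v x) * of_int (c x k))"
        by (simp add: sum_distrib_left mult.assoc)
      finally have "of_int (\<Sum>x\<in>B. n x * c x k) = (0 :: rat)" by (simp only: q0 mult_zero_right)
      then show ?thesis by (simp only: of_int_eq_0_iff)
    qed
    moreover have "\<exists>x\<in>B. n x \<noteq> 0"
    proof -
      obtain x where x: "x \<in> B" "q (v x) \<noteq> 0" using q(1) by blast
      then have "of_int (n x) \<noteq> (0 :: rat)" using n[OF x(1)] D(1) by (metis mult_eq_0_iff of_int_eq_0_iff)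
      then show ?thesis using x(1) by auto
    qed
    ultimately show ?thesis by blast
  next
    case False
    then obtain x y where xy: "x \<in> B" "y \<in> B" "x \<noteq> y" "v x = v y" by (auto simp: inj_on_def)
    define n :: "'a \<Rightarrow> int" where "n = (\<lambda>z. if z = x then 1 else if z = y then - 1 else 0)"
    have "(\<Sum>z\<in>B. n z * c z k) = 0" for k
    proof -
      have "(\<Sum>z\<in>B. n z * c z k) = (\<Sum>z\<in>{x, y}. n z * c z k)"
        by (rule sum.mono_neutral_right) (use assms(1) xy in \<open>auto simp: n_def\<close>)
      also have "\<dots> = 0" using xy vc[OF xy(4)] by (simp add: n_def)
      finally show ?thesis .
    qed
    moreover have "n x \<noteq> 0" by (simp add: n_def)
    ultimately show ?thesis using xy(1) by blast
  qed
qed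

lemma chi_scale_int: "chi C (of_int n *\<^sub>R x) k = chi C x k powi n"
proof (cases n rule: int_cases2)
  case (nonneg m)
  then show ?thesis using chi_scale_nat[of C m x k] by simp
next
  case (nonpos m)
  then show ?thesis using chi_scale_nat[of C m x k] by (simp add: chi_minus power_int_minus)
qed

lemma chi_int_sum:
  "chi C (\<Sum>i\<in>A. of_int (n i) *\<^sub>R x i) k = (\<Prod>i\<in>A. chi C (x i) k powi n i)"
  by (induction A rule: infinite_finite_induct) (auto simp: chi_add chi_scale_int)

lemma chi_inj:
  assumes "\<And>k. chi C x k = chi C y k"
  shows "x = y"
proof -
  have "exp (x $ j) = exp (y $ j)" for j
    using assms[of "Inl j"] unfolding chi_Inl of_real_eq_iff .
  then show ?thesis by (simp add: vec_eq_iff)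
qed

text \<open>Every coset meets the closed ball of radius \<open>R\<close>, so the quotient is a
  continuous image of a compact set.\<close>

lemma additive_lattice:
  fixes L :: "'a::euclidean_space set"
  assumes L0: "0 \<in> L" and Ld: "\<And>x y. x \<in> L \<Longrightarrow> y \<in> L \<Longrightarrow> x - y \<in> L"
    and disc: "\<exists>e>0. \<forall>l\<in>L. norm l < e \<longrightarrow> l = 0"
    and near: "\<exists>R. \<forall>y. \<exists>l\<in>L. norm (y - l) \<le> R"
  shows "is_lattice \<lparr>carrier = UNIV, mult = (+), one = 0\<rparr> euclidean L"
proof -
  let ?G = "\<lparr>carrier = UNIV, mult = (+), one = 0\<rparr> :: 'a monoid"
  have plus: "x + y \<in> L" if "x \<in> L" "y \<in> L" for x y
    using Ld[OF that(1) Ld[OF L0 that(2)]] by simp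
  have inv: "inv\<^bsub>?G\<^esub> x = - x" for x
    unfolding m_inv_def by (rule the_equality) (auto simp: eq_neg_iff_add_eq_0)
  have sub: "subgroup L ?G"
    by (rule subgroup.intro) (use L0 plus Ld[OF L0] in \<open>auto simp: inv\<close>)
  obtain e where e: "e > 0" "\<And>l. l \<in> L \<Longrightarrow> norm l < e \<Longrightarrow> l = 0" using disc by blast
  have "openin (top_of_set L) {x}" if x: "x \<in> L" for x
  proof -
    have "y = x" if "y \<in> L" "y \<in> ball x e" for y
      using e(2)[OF Ld[OF x \<open>y \<in> L\<close>]] that(2) by (simp add: dist_norm)
    then have "{x} = L \<inter> ball x e" using x e(1) by auto
    then show ?thesis by (metis open_ball openin_open_Int)
  qed
  then have discrete: "top_of_set L = discrete_topology L"
    by (intro sym[OF discrete_topology_unique[THEN iffD2]]) simp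
  obtain R where R: "\<And>y. \<exists>l\<in>L. norm (y - l) \<le> R" using near by blast
  let ?q = "\<lambda>g. L #>\<^bsub>?G\<^esub> g"
  have q: "?q (l + z) = ?q z" if l: "l \<in> L" for l z
  proof -
    have "?q w = (\<lambda>h. h + w) ` L" for w by (auto simp: r_coset_def)
    moreover have "(\<lambda>h. h + (l + z)) ` L = (\<lambda>h. h + z) ` L"
    proof (intro equalityI subsetI)
      fix y assume "y \<in> (\<lambda>h. h + (l + z)) ` L"
      then obtain h where "h \<in> L" "y = (h + l) + z" by (auto simp: algebra_simps)
      then show "y \<in> (\<lambda>h. h + z) ` L" using plus[OF _ l] by blast
    next
      fix y assume "y \<in> (\<lambda>h. h + z) ` L"
      then obtain h where "h \<in> L" "y = (h - l) + (l + z)" by (auto simp: algebra_simps)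
      then show "y \<in> (\<lambda>h. h + (l + z)) ` L" using Ld[OF _ l] by blast
    qed
    ultimately show ?thesis by simp
  qed
  have "?q y \<in> ?q ` cball 0 R" for y
  proof -
    obtain l where l: "l \<in> L" "norm (y - l) \<le> R" using R by blast
    have "?q y = ?q (y - l)" using q[OF l(1), of "y - l"] by simp
    then show ?thesis using l(2) by (intro image_eqI[of _ _ "y - l"]) auto
  qed
  then have top: "topspace (quotient_topology euclidean ?q) = ?q ` cball 0 R"
    by (auto simp: topspace_quotient_topology)
  have "compactin (quotient_topology euclidean ?q) (?q ` cball 0 R)"
    by (rule image_compactin[of euclidean])
      (auto intro: quotient_imp_continuous_map[OF quotient_map_quotient_topology])
  then have "compact_space (quotient_topology euclidean ?q)"
    by (simp add: compact_space_def top)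
  with sub discrete show ?thesis by (simp add: is_lattice_def)
qed

context ot_lattice
begin

lemma L_basis:
  "\<exists>b :: 's \<Rightarrow> real^'s. inj b \<and> independent (range b) \<and>
    L = range (\<lambda>m. \<Sum>k\<in>UNIV. of_int (m k) *\<^sub>R b k)"
proof -
  obtain e where e: "e > 0" "\<And>v. v \<in> L \<Longrightarrow> norm v < e \<Longrightarrow> v = 0" using L_discrete by blast
  have card: "CARD('s) = DIM(real^'s)" by simp
  obtain b :: "'s \<Rightarrow> real^'s" where b: "inj b" "independent (range b)"
    "L = range (\<lambda>m. \<Sum>k\<in>UNIV. of_int (m k) *\<^sub>R b k)"
    by (rule discrete_subgroup_basis[OF L_0 L_diff e span_L card])
  then show ?thesis by blast
qed

lemma algebraic_int_chi:
  assumes "l \<in> L"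
  shows "algebraic_int (chi C l k)"
proof -
  obtain P where P: "ipoly P = (\<Prod>k\<in>UNIV. [:- chi C l k, 1:])" using chi_charpoly(1)[OF assms] by blast
  have n1: "(\<Prod>k\<in>UNIV. cmod (chi C l k)) = 1"
    by (simp add: prod_cmod_chi sum_ell del: prod_norm)
  show ?thesis
    unfolding algebraic_int_altdef_ipoly using unit_ipoly[OF P n1] by blast
qed

text \<open>Since \<open>emb k\<close> takes \<open>u l\<close> to \<open>chi C l k\<close> for all
  \<open>l \<in> L\<close>, every condition on \<open>U\<close> becomes one on characters:
  \<open>log_vec emb\<close> inverts \<open>u\<close>, so the logarithmic lattice is
  \<open>L\<close> itself, and the given \<open>C\<close> satisfies the relation between
  \<open>C\<close> and the embeddings.\<close>

theorem OT_data:
  obtains K U and a :: "'s \<Rightarrow> complex" and \<sigma> :: "'s + 't + 't \<Rightarrow> complex \<Rightarrow> complex"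
  where "number_field K (CARD('s) + 2 * CARD('t))" "labelling K \<sigma>" "admissible K \<sigma> U"
    "simple_type K U" "Z_basis U a"
    "\<And>i k. \<sigma> (Inr (Inl i)) (a k) =
       exp (\<Sum>j\<in>UNIV. C $ i $ j * of_real (ln (Re (\<sigma> (Inl j) (a k)))))"
proof -
  obtain l0 where l0: "generic l0" using generic_exists by blast
  then have l0L: "l0 \<in> L" by (simp add: generic_def)
  \<comment> \<open>Any real index will do; one exists because types are nonempty.\<close>
  define k0 :: "'s + 't + 't" where "k0 = Inl undefined"
  obtain m where m: "min_ipoly (chi C l0 k0) m" "ipoly m = (\<Prod>k\<in>UNIV. [:- chi C l0 k, 1:])"
    "inj (chi C l0)"
    unfolding k0_def by (rule generic_min_ipoly[OF l0])
  interpret conj_system m "chi C l0" k0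
    by unfold_locales (rule m)+
  define u where "u l = chi C l k0" for l
  have uK: "u l \<in> K" and emb_u: "emb k (u l) = chi C l k" if lL: "l \<in> L" for l k
  proof -
    obtain g where "\<And>k. poly (ipoly g) (chi C l0 k) = chi C l k * poly (ipoly (pderiv m)) (chi C l0 k)"
      by (rule generic_dual[OF l0 lL m(2)]) (rule that)
    from emb_quotient[OF this] show "u l \<in> K" "emb k (u l) = chi C l k" by (auto simp: u_def)
  qed
  have inj_u: "inj_on u L"
  proof (rule inj_onI)
    fix l l' assume "l \<in> L" "l' \<in> L" "u l = u l'"
    then have "chi C l k = chi C l' k" for k using emb_u by metis
    then show "l = l'" by (rule chi_inj)
  qed
  have u_mult: "u l * u l' = u (l + l')" for l l' by (simp add: u_def chi_add)
  have u_0: "u 0 = 1" by (simp add: u_def)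
  define U where "U = u ` L"
  have nf: "number_field K (CARD('s) + 2 * CARD('t))"
    using number_field_K by (simp add: mult_2)
  have real: "real_embedding K (emb (Inl j))" for j
  proof -
    have "emb (Inl j) x \<in> \<real>" if "x \<in> K" for x
    proof -
      obtain f where f: "x = ratev f (chi C l0 k0)" using \<open>x \<in> K\<close> by (rule K_cases)
      have "cnj (chi C l0 (Inl j)) = chi C l0 (Inl j)" unfolding chi_Inl by simp
      then show ?thesis
        using ratev_cnj[of f "chi C l0 (Inl j)"] by (simp add: f Reals_cnj_iff)
    qed
    then show ?thesis using emb_ring_hom by (auto simp: real_embedding_def)
  qed
  have nonreal: "\<not> real_embedding K (emb (Inr i))" for i
  proof
    assume "real_embedding K (emb (Inr i))"
    then have "emb (Inr i) (chi C l0 k0) \<in> \<real>" using K_closed(8) by (auto simp: real_embedding_def)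
    then have r: "cnj (chi C l0 (Inr i)) = chi C l0 (Inr i)" by (simp add: Reals_cnj_iff)
    \<comment> \<open>The eigenvalue at the conjugate index would be the same number, against
      injectivity.\<close>
    obtain i' where "i = Inl i' \<or> i = Inr i'" by (metis sumE)
    then have "chi C l0 (Inr (Inl i')) = chi C l0 (Inr (Inr i'))"
      using r by (auto simp: chi_Inr_Inr)
    then show False using m(3) by (simp add: inj_eq)
  qed
  have cnj: "emb (Inr (Inl i)) x = cnj (emb (Inr (Inr i)) x)" if "x \<in> K" for i x
  proof -
    obtain f where f: "x = ratev f (chi C l0 k0)" using \<open>x \<in> K\<close> by (rule K_cases)
    show ?thesis unfolding f emb_ratev chi_Inr_Inr ratev_cnj by simp
  qed
  have lab: "labelling K emb"
    unfolding labelling_def using bij_emb real nonreal cnj by blast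
  have u_OK: "u l \<in> O_K K" if "l \<in> L" for l
    using uK[OF that] algebraic_int_chi[OF that] by (simp add: O_K_def u_def)
  have Lneg: "- l \<in> L" if "l \<in> L" for l using L_diff[OF L_0 that] by simp
  have unit: "u l \<in> carrier (O_K_units K)" if "l \<in> L" for l
    using u_OK[OF that] u_OK[OF Lneg[OF that]] u_mult[of l "- l"] u_mult[of "- l" l] u_0
    by (auto simp: units_of_def Units_def)
  have inv_u: "inv\<^bsub>O_K_units K\<^esub> (u l) = u (- l)" if "l \<in> L" for l
    unfolding m_inv_def
  proof (rule the_equality)
    show "u (- l) \<in> carrier (O_K_units K) \<and> u l \<otimes>\<^bsub>O_K_units K\<^esub> u (- l) = \<one>\<^bsub>O_K_units K\<^esub> \<and>
        u (- l) \<otimes>\<^bsub>O_K_units K\<^esub> u l = \<one>\<^bsub>O_K_units K\<^esub>"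
      using unit[OF Lneg[OF that]] by (simp add: units_of_def u_mult u_0)
    fix y assume "y \<in> carrier (O_K_units K) \<and> u l \<otimes>\<^bsub>O_K_units K\<^esub> y = \<one>\<^bsub>O_K_units K\<^esub> \<and>
        y \<otimes>\<^bsub>O_K_units K\<^esub> u l = \<one>\<^bsub>O_K_units K\<^esub>"
    then have "y * u l = 1" by (simp add: units_of_def)
    moreover have "u (- l) * u l = 1" by (simp add: u_mult u_0)
    ultimately show "y = u (- l)" by (metis mult_cancel_right zero_neq_one mult_zero_right)
  qed
  have subU: "subgroup U (O_K_units K)"
  proof (rule subgroup.intro)
    show "U \<subseteq> carrier (O_K_units K)" using unit by (auto simp: U_def)
    show "\<one>\<^bsub>O_K_units K\<^esub> \<in> U"
      using L_0 u_0 by (force simp: U_def units_of_def)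
    show "x \<otimes>\<^bsub>O_K_units K\<^esub> y \<in> U" if "x \<in> U" "y \<in> U" for x y
      using that L_plus by (auto simp: U_def units_of_def u_mult)
    show "inv\<^bsub>O_K_units K\<^esub> x \<in> U" if "x \<in> U" for x
      using that Lneg inv_u by (auto simp: U_def)
  qed
  have pos: "U \<subseteq> O_K_pos_units K"
  proof
    fix x assume "x \<in> U"
    then obtain l where l: "l \<in> L" "x = u l" by (auto simp: U_def)
    have "Re (\<tau> x) > 0" if \<tau>: "real_embedding K \<tau>" for \<tau>
    proof -
      obtain k where k: "\<tau> = emb k"
        using \<tau> embedding_cases unfolding real_embedding_def by blast
      obtain j where "k = Inl j" using \<tau> nonreal unfolding k by (metis sumE)
      then show ?thesis unfolding k l(2) emb_u[OF l(1)] by (simp add: chi_Inl)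
    qed
    then show "x \<in> O_K_pos_units K" using unit[OF l(1)] l(2) by (simp add: O_K_pos_units_def)
  qed
  obtain b :: "'s \<Rightarrow> real^'s" where b: "inj b" "independent (range b)"
    "L = range (\<lambda>n. \<Sum>k\<in>UNIV. of_int (n k) *\<^sub>R b k)"
    using L_basis by blast
  have bL: "b k \<in> L" for k
  proof -
    have "(\<Sum>j\<in>UNIV. of_int (if j = k then 1 else 0) *\<^sub>R b j) = (\<Sum>j\<in>UNIV. if j = k then b k else 0)"
      by (rule sum.cong) auto
    then have "b k = (\<Sum>j\<in>UNIV. of_int (if j = k then 1 else 0) *\<^sub>R b j)" by simp
    then show ?thesis unfolding b(3) by (rule range_eqI[where x = "\<lambda>j. if j = k then 1 else 0"])
  qed
  have sumL: "(\<Sum>k\<in>UNIV. of_int (n k) *\<^sub>R b k) \<in> L" for n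
    unfolding b(3) by (rule rangeI)
  have inj_sum: "inj (\<lambda>n :: 's \<Rightarrow> int. \<Sum>k\<in>UNIV. of_int (n k) *\<^sub>R b k)"
  proof (rule injI)
    fix n n' :: "'s \<Rightarrow> int"
    assume "(\<Sum>k\<in>UNIV. of_int (n k) *\<^sub>R b k) = (\<Sum>k\<in>UNIV. of_int (n' k) *\<^sub>R b k)"
    then have "(\<Sum>k\<in>UNIV. of_int (n k - n' k) *\<^sub>R b k) = 0"
      by (simp add: scaleR_left_diff_distrib sum_subtractf)
    then have "(\<Sum>v\<in>range b. of_int (n (the_inv b v) - n' (the_inv b v)) *\<^sub>R v) = 0"
      by (simp only: sum.reindex[OF b(1)] o_def the_inv_f_f[OF b(1)])
    note coeff0 = independentD[OF b(2) finite_imageI[OF finite] subset_refl this]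
    have "n k = n' k" for k
      using coeff0[OF rangeI[of b k]] unfolding the_inv_f_f[OF b(1)] by simp
    then show "n = n'" by blast
  qed
  define a where "a k = u (b k)" for k
  have prod_a: "(\<Prod>k\<in>UNIV. a k powi n k) = u (\<Sum>k\<in>UNIV. of_int (n k) *\<^sub>R b k)" for n
    unfolding a_def u_def by (rule chi_int_sum[symmetric])
  have zb: "Z_basis U a"
    unfolding Z_basis_def prod_a bij_betw_def
  proof
    show "inj (\<lambda>n. u (\<Sum>k\<in>UNIV. of_int (n k) *\<^sub>R b k))"
    proof (rule injI)
      fix n n' :: "'s \<Rightarrow> int"
      assume "u (\<Sum>k\<in>UNIV. of_int (n k) *\<^sub>R b k) = u (\<Sum>k\<in>UNIV. of_int (n' k) *\<^sub>R b k)"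
      then have "(\<Sum>k\<in>UNIV. of_int (n k) *\<^sub>R b k) = (\<Sum>k\<in>UNIV. of_int (n' k) *\<^sub>R b k)"
        by (rule inj_onD[OF inj_u _ sumL sumL])
      then show "n = n'" by (rule injD[OF inj_sum])
    qed
    show "range (\<lambda>n. u (\<Sum>k\<in>UNIV. of_int (n k) *\<^sub>R b k)) = U"
      unfolding U_def b(3) by (simp add: image_image)
  qed
  have inj_a: "inj a"
    using b(1) bL inj_u by (auto simp: a_def inj_on_def)
  have "mult_independent (range a)"
    unfolding mult_independent_def
  proof (intro allI impI ballI)
    fix n :: "complex \<Rightarrow> int" and x
    assume n: "(\<Prod>b\<in>range a. b powi n b) = 1" and x: "x \<in> range a"
    have "(\<Prod>k\<in>UNIV. a k powi (n \<circ> a) k) = (\<Prod>k\<in>UNIV. a k powi (\<lambda>_. 0) k)"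
      using n inj_a by (simp add: prod.reindex)
    moreover have "inj (\<lambda>m :: 's \<Rightarrow> int. \<Prod>k\<in>UNIV. a k powi m k)"
      using zb by (simp add: Z_basis_def bij_betw_def)
    ultimately have "n \<circ> a = (\<lambda>_. 0)" by (rule injD[rotated])
    then show "n x = 0" using x by (auto dest: fun_cong)
  qed
  moreover have "card B \<le> CARD('s)" if B: "B \<subseteq> U" "finite B" "mult_independent B" for B
  proof (rule ccontr)
    assume "\<not> card B \<le> CARD('s)"
    define l where "l x = the_inv_into L u x" for x
    have l: "l x \<in> L" "u (l x) = x" if "x \<in> B" for x
      using B(1) that the_inv_into_into[OF inj_u _ subset_refl] f_the_inv_into_f[OF inj_u]
      by (auto simp: l_def U_def)
    have "\<exists>n. l x = (\<Sum>k\<in>UNIV. of_int (n k) *\<^sub>R b k)" if "x \<in> B" for x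
      using l(1)[OF that] unfolding b(3) by blast
    then obtain c where c: "\<And>x. x \<in> B \<Longrightarrow> l x = (\<Sum>k\<in>UNIV. of_int (c x k) *\<^sub>R b k)" by metis
    \<comment> \<open>A linear relation among exponent vectors with respect to \<open>b\<close> is a
      multiplicative relation among the elements of \<open>B\<close>.\<close>
    obtain n where n: "\<exists>x\<in>B. n x \<noteq> 0" "\<And>k. (\<Sum>x\<in>B. n x * c x k) = 0"
      using integer_dependence[OF B(2), of c] \<open>\<not> card B \<le> CARD('s)\<close> by force
    have "(\<Sum>x\<in>B. of_int (n x) *\<^sub>R l x) = (\<Sum>x\<in>B. \<Sum>k\<in>UNIV. of_int (n x * c x k) *\<^sub>R b k)"
      by (rule sum.cong) (auto simp: c scaleR_sum_right)
    also have "\<dots> = (\<Sum>k\<in>UNIV. \<Sum>x\<in>B. of_int (n x * c x k) *\<^sub>R b k)" by (rule sum.swap)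
    also have "\<dots> = (\<Sum>k\<in>UNIV. of_int (\<Sum>x\<in>B. n x * c x k) *\<^sub>R b k)"
      by (simp only: of_int_sum scaleR_sum_left)
    also have "\<dots> = 0" by (simp only: n(2)) simp
    finally have "u (\<Sum>x\<in>B. of_int (n x) *\<^sub>R l x) = 1" by (simp add: u_0)
    moreover have "u (\<Sum>x\<in>B. of_int (n x) *\<^sub>R l x) = (\<Prod>x\<in>B. u (l x) powi n x)"
      by (simp add: u_def chi_int_sum)
    ultimately have "(\<Prod>x\<in>B. x powi n x) = 1" using l(2) by simp
    then show False using B(3) n(1) by (auto simp: mult_independent_def)
  qed
  moreover have "range a \<subseteq> U" using bL by (auto simp: a_def U_def)
  ultimately have rank: "has_rank U CARD('s)"
    unfolding has_rank_def using inj_a by (metis card_image finite finite_imageI)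
  have "log_vec emb (u l) = l" if "l \<in> L" for l
    using emb_u[OF that] by (simp add: log_vec_def chi_Inl vec_eq_iff)
  then have logU: "log_vec emb ` U = L" by (simp add: U_def image_image)
  have adm: "admissible K emb U"
    unfolding admissible_def logU
    using subU pos rank additive_lattice[OF L_0 L_diff L_discrete L_near] by blast
  have "U \<subseteq> K" using uK by (auto simp: U_def)
  then have simple: "simple_type K U"
    unfolding simple_type_def using l0L by (intro generate_field_eq_K) (auto simp: U_def u_def)
  have "emb (Inr (Inl i)) (a k) = exp (\<Sum>j\<in>UNIV. C $ i $ j * of_real (ln (Re (emb (Inl j) (a k)))))" for i k
    unfolding a_def emb_u[OF bL] by (simp add: chi_def)
  with nf lab adm simple zb show thesis by (rule that)
qed

end

section \<open>Transfer along a Lie isomorphism\<close>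

lemma G_C_simps [simp]:
  "carrier (G_C C) = UNIV" "(x, v) \<otimes>\<^bsub>G_C C\<^esub> (y, w) = (x + y, v + phi C x w)"
  "\<one>\<^bsub>G_C C\<^esub> = 0" "mtop (mfd (G_C C)) = euclidean"
  by (simp_all add: G_C_def)

text \<open>The images in \<open>\<Gamma>\<setminus>G\<close> of the balls around the identity form an open cover, which has a finite
  subcover; so \<open>\<Gamma>\<close> times a single ball is the whole group.\<close>

lemma lattice_transfer:
  fixes G :: "('a, 'e::euclidean_space) lie" and C :: "complex^'s::finite^'t::finite"
  assumes G: "lie_group G" and iso: "lie_isomorphic G (G_C C)"
    and lattice: "is_lattice G (mtop (mfd G)) \<Gamma>"
    and re: "\<And>i j. Re (C $ i $ j) = - 1 / (2 * real CARD('t))"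
  shows "\<exists>\<Gamma>'. ot_lattice C \<Gamma>'"
proof -
  interpret group G using G by (simp add: lie_group_def)
  let ?T = "mtop (mfd G)"
  have top: "topspace ?T = carrier G" using G by (simp add: lie_group_def)
  obtain f where f: "f \<in> iso G (G_C C)" "smooth_map (mfd G) (mfd (G_C C)) f"
    "smooth_map (mfd (G_C C)) (mfd G) (inv_into (carrier G) f)"
    using iso by (auto simp: lie_isomorphic_def)
  define g where "g = inv_into (carrier G) f"
  have cont_f: "continuous_map ?T euclidean f" and cont_g: "continuous_map euclidean ?T g"
    using f by (auto simp: smooth_map_def g_def)
  have bij: "bij_betw f (carrier G) UNIV" using f(1) by (simp add: iso_def)
  have gf: "g (f x) = x" if "x \<in> carrier G" for x
    using bij that by (simp add: g_def bij_betw_def)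
  have fg: "f (g p) = p" and g_car: "g p \<in> carrier G" for p
    using bij by (auto simp: g_def bij_betw_def intro!: f_inv_into_f inv_into_into)
  have mult: "f (x \<otimes>\<^bsub>G\<^esub> y) = f x \<otimes>\<^bsub>G_C C\<^esub> f y" if "x \<in> carrier G" "y \<in> carrier G" for x y
    using f(1) that by (simp add: iso_def hom_mult)
  have f_one: "f \<one>\<^bsub>G\<^esub> = 0"
  proof -
    obtain x v where xv: "f \<one>\<^bsub>G\<^esub> = (x, v)" by (rule prod.exhaust)
    have "(x, v) = (x + x, v + phi C x v)"
      using mult[OF one_closed one_closed] unfolding l_one[OF one_closed] xv G_C_simps .
    then have "x = x + x" "v = v + phi C x v" unfolding prod.inject by blast+
    then have "x = 0" "phi C x v = 0" by (metis add_cancel_right_right)+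
    then show ?thesis by (simp add: xv zero_prod_def)
  qed
  have sub: "subgroup \<Gamma> G" using lattice by (simp add: is_lattice_def)
  then have \<Gamma>_car: "\<gamma> \<in> carrier G" if "\<gamma> \<in> \<Gamma>" for \<gamma> using that subgroup.subset by blast
  define \<Gamma>' where "\<Gamma>' = f ` \<Gamma>"
  have mem: "f \<gamma> \<in> \<Gamma>'" if "\<gamma> \<in> \<Gamma>" for \<gamma> using that by (simp add: \<Gamma>'_def)
  have zero_mem: "0 \<in> \<Gamma>'" using mem[OF subgroup.one_closed[OF sub]] by (simp add: f_one)
  have mult_mem: "(x + y, v + phi C x w) \<in> \<Gamma>'" if xy: "(x, v) \<in> \<Gamma>'" "(y, w) \<in> \<Gamma>'" for x v y w
  proof -
    obtain \<gamma> \<delta> where *: "\<gamma> \<in> \<Gamma>" "\<delta> \<in> \<Gamma>" "f \<gamma> = (x, v)" "f \<delta> = (y, w)" using xy by (auto simp: \<Gamma>'_def)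
    have "f (\<gamma> \<otimes>\<^bsub>G\<^esub> \<delta>) \<in> \<Gamma>'" by (rule mem) (rule subgroup.m_closed[OF sub *(1,2)])
    then show ?thesis using mult[OF \<Gamma>_car[OF *(1)] \<Gamma>_car[OF *(2)]] * by simp
  qed
  have inv_mem: "(- x, - phi C (- x) v) \<in> \<Gamma>'" if xv: "(x, v) \<in> \<Gamma>'" for x v
  proof -
    obtain \<gamma> where *: "\<gamma> \<in> \<Gamma>" "f \<gamma> = (x, v)" using xv by (auto simp: \<Gamma>'_def)
    obtain x' v' where inv: "f (inv\<^bsub>G\<^esub> \<gamma>) = (x', v')" by (rule prod.exhaust)
    have "inv\<^bsub>G\<^esub> \<gamma> \<otimes>\<^bsub>G\<^esub> \<gamma> = \<one>\<^bsub>G\<^esub>" using \<Gamma>_car[OF *(1)] by (rule l_inv)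
    then have "(x' + x, v' + phi C x' v) = 0"
      using mult[OF inv_closed[OF \<Gamma>_car[OF *(1)]] \<Gamma>_car[OF *(1)]] by (simp add: inv * f_one)
    then have "x' + x = 0" "v' + phi C x' v = 0" by (simp_all add: zero_prod_def)
    then have "x' = - x" "v' = - phi C x' v" by (simp_all add: eq_neg_iff_add_eq_0)
    then have "(x', v') = (- x, - phi C (- x) v)" by simp
    moreover have "f (inv\<^bsub>G\<^esub> \<gamma>) \<in> \<Gamma>'" by (rule mem) (rule subgroup.m_inv_closed[OF sub *(1)])
    ultimately show ?thesis by (simp only: inv)
  qed
  have discrete: "\<exists>e>0. \<forall>p\<in>\<Gamma>'. norm p < e \<longrightarrow> p = 0"
  proof -
    have "openin (subtopology ?T \<Gamma>) {\<one>\<^bsub>G\<^esub>}"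
      using lattice subgroup.one_closed[OF sub] by (simp add: is_lattice_def)
    then obtain U where U: "openin ?T U" "{\<one>\<^bsub>G\<^esub>} = U \<inter> \<Gamma>" unfolding openin_subtopology by blast
    have "open {p. g p \<in> U}" using openin_continuous_map_preimage[OF cont_g U(1)] by simp
    moreover have "0 \<in> {p. g p \<in> U}" using gf[OF one_closed] U(2) by (auto simp: f_one)
    ultimately obtain e where e: "e > 0" "ball 0 e \<subseteq> {p. g p \<in> U}" using open_contains_ball by blast
    have "p = 0" if p: "p \<in> \<Gamma>'" "norm p < e" for p
    proof -
      obtain \<gamma> where \<gamma>: "\<gamma> \<in> \<Gamma>" "p = f \<gamma>" using p(1) by (auto simp: \<Gamma>'_def)
      have "p \<in> ball 0 e" using p(2) by simp
      then have "\<gamma> \<in> U" using e(2) gf[OF \<Gamma>_car[OF \<gamma>(1)]] \<gamma>(2) by auto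
      then have "\<gamma> = \<one>\<^bsub>G\<^esub>" using U(2) \<gamma>(1) by blast
      then show ?thesis using \<gamma>(2) f_one by simp
    qed
    with e(1) show ?thesis by blast
  qed
  have cocompact: "\<exists>R. \<forall>y w. \<exists>(x, v)\<in>\<Gamma>'. \<exists>z u. norm z \<le> R \<and> norm u \<le> R \<and> y = x + z \<and> w = v + phi C x u"
  proof -
    let ?q = "\<lambda>x. \<Gamma> #>\<^bsub>G\<^esub> x"
    let ?Q = "quotient_topology ?T ?q"
    \<comment> \<open>\<open>S r\<close> is \<open>\<Gamma>'\<close> times the ball of radius
      \<open>r\<close>: the pair tested for membership is the inverse of (x, v) times
      \<open>p\<close>. It is open, and by \<open>preimage\<close> it describes the preimage of
      \<open>W r\<close> in the group, so \<open>W r\<close> is open in the quotient.\<close>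
    define S where "S r = (\<Union>(x, v)\<in>\<Gamma>'. {p. (fst p - x, phi C (- x) (snd p - v)) \<in> ball 0 (real r)})" for r
    define V where "V r = {x \<in> carrier G. f x \<in> ball 0 (real r)}" for r
    define W where "W r = ?q ` V r" for r
    have "open (S r)" for r
    proof -
      have "continuous_on UNIV (\<lambda>p. (fst p - x, phi C (- x) (snd p - v)))" for x v
        unfolding phi_def case_prod_unfold by (intro continuous_intros)
      then have "open ((\<lambda>p. (fst p - x, phi C (- x) (snd p - v))) -` ball 0 (real r))" for x v
        by (intro open_vimage) auto
      then show ?thesis unfolding S_def vimage_def by (intro open_UN) auto
    qed
    then have open_S: "openin ?T {x \<in> carrier G. f x \<in> S r}" for r
      using openin_continuous_map_preimage[OF cont_f, of "S r"] by (simp add: top)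
    have preimage: "?q x \<in> W r \<longleftrightarrow> f x \<in> S r" if x: "x \<in> carrier G" for x r
    proof
      assume "?q x \<in> W r"
      then obtain y where y: "y \<in> carrier G" "norm (f y) < real r" "?q x = ?q y" by (auto simp: W_def V_def)
      then have "x \<in> ?q y" using rcos_self[OF x sub] by simp
      then obtain \<gamma> where \<gamma>: "\<gamma> \<in> \<Gamma>" "x = \<gamma> \<otimes>\<^bsub>G\<^esub> y" by (auto simp: r_coset_def)
      obtain a v where a: "f \<gamma> = (a, v)" by (rule prod.exhaust)
      have "f x = (a, v) \<otimes>\<^bsub>G_C C\<^esub> f y" using mult[OF \<Gamma>_car[OF \<gamma>(1)] y(1)] by (simp add: \<gamma>(2) a)
      then have "fst (f x) = a + fst (f y)" "snd (f x) = v + phi C a (snd (f y))" by (cases "f y"; simp)+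
      then have "(fst (f x) - a, phi C (- a) (snd (f x) - v)) = f y" by (simp add: phi_phi)
      moreover have "(a, v) \<in> \<Gamma>'" using mem[OF \<gamma>(1)] by (simp only: a)
      ultimately show "f x \<in> S r"
        unfolding S_def using y(2) by (intro UN_I[of "(a, v)"]) auto
    next
      assume "f x \<in> S r"
      then obtain a v where av: "(a, v) \<in> \<Gamma>'" "norm (fst (f x) - a, phi C (- a) (snd (f x) - v)) < real r"
        by (auto simp: S_def)
      obtain \<gamma> where \<gamma>: "\<gamma> \<in> \<Gamma>" "f \<gamma> = (a, v)" using av(1) by (auto simp: \<Gamma>'_def)
      define y where "y = g (fst (f x) - a, phi C (- a) (snd (f x) - v))"
      have y: "y \<in> carrier G" "f y = (fst (f x) - a, phi C (- a) (snd (f x) - v))"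
        by (simp_all add: y_def fg g_car)
      have "f (\<gamma> \<otimes>\<^bsub>G\<^esub> y) = (a, v) \<otimes>\<^bsub>G_C C\<^esub> f y"
        using mult[OF \<Gamma>_car[OF \<gamma>(1)] y(1)] unfolding \<gamma>(2) .
      also have "\<dots> = f x" unfolding y(2) by (simp add: phi_phi)
      finally have fx: "f (\<gamma> \<otimes>\<^bsub>G\<^esub> y) = f x" .
      have "\<gamma> \<otimes>\<^bsub>G\<^esub> y = g (f (\<gamma> \<otimes>\<^bsub>G\<^esub> y))"
        by (rule gf[OF m_closed[OF \<Gamma>_car[OF \<gamma>(1)] y(1)], symmetric])
      also have "\<dots> = x" unfolding fx by (rule gf[OF x])
      finally have "\<gamma> \<otimes>\<^bsub>G\<^esub> y = x" .
      moreover have "?q (\<gamma> \<otimes>\<^bsub>G\<^esub> y) = ?q y"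
        using coset_mult_assoc[OF subgroup.subset[OF sub] \<Gamma>_car[OF \<gamma>(1)] y(1)]
          coset_join2[OF \<Gamma>_car[OF \<gamma>(1)] sub \<gamma>(1)] by simp
      ultimately have "?q x = ?q y" by simp
      moreover have "y \<in> V r" using y av(2) by (simp add: V_def)
      ultimately show "?q x \<in> W r" by (simp add: W_def)
    qed
    have openW: "openin ?Q (W r)" for r
    proof -
      have "{x \<in> topspace ?T. ?q x \<in> W r} = {x \<in> carrier G. f x \<in> S r}" using preimage by (auto simp: top)
      then show ?thesis
        unfolding openin_quotient_topology using open_S[of r] by (auto simp: W_def V_def top)
    qed
    have cover: "topspace ?Q \<subseteq> \<Union>(range W)"
    proof
      fix c assume "c \<in> topspace ?Q"
      then obtain x where x: "x \<in> carrier G" "c = ?q x" by (auto simp: topspace_quotient_topology top)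
      obtain r :: nat where "norm (f x) < real r" using reals_Archimedean2 by blast
      then have "x \<in> V r" using x(1) by (simp add: V_def)
      then show "c \<in> \<Union>(range W)" using x(2) by (auto simp: W_def)
    qed
    have "compactin ?Q (topspace ?Q)" using lattice by (simp add: is_lattice_def compact_space_def)
    then obtain \<F> where \<F>: "finite \<F>" "\<F> \<subseteq> range W" "topspace ?Q \<subseteq> \<Union>\<F>"
      using compactinD[of ?Q "topspace ?Q" "range W"] openW cover by blast
    then obtain N where N: "finite N" "\<F> = W ` N" by (meson finite_subset_image)
    \<comment> \<open>The balls increase with \<open>r\<close>, so the largest radius serves for
      all; \<open>insert 0\<close> keeps the argument of \<open>Max\<close> nonempty.\<close>
    have "\<exists>(x, v)\<in>\<Gamma>'. \<exists>z u. norm z \<le> real (Max (insert 0 N)) \<and> norm u \<le> real (Max (insert 0 N)) \<and> y = x + z \<and> w = v + phi C x u" for y w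
    proof -
      have x: "g (y, w) \<in> carrier G" by (rule g_car)
      then have "?q (g (y, w)) \<in> topspace ?Q" by (auto simp: topspace_quotient_topology top)
      then obtain r where r: "r \<in> N" "?q (g (y, w)) \<in> W r" using \<F>(3) N(2) by blast
      then have "(y, w) \<in> S r" using preimage[OF x] by (simp add: fg)
      then obtain a v where av: "(a, v) \<in> \<Gamma>'" "norm (y - a, phi C (- a) (w - v)) < real r"
        by (auto simp: S_def)
      have "real r \<le> real (Max (insert 0 N))" using r(1) N(1) by simp
      then have "norm (y - a) \<le> real (Max (insert 0 N))" "norm (phi C (- a) (w - v)) \<le> real (Max (insert 0 N))"
        using av(2) norm_fst_le[of "y - a" "phi C (- a) (w - v)"] norm_snd_le[of "phi C (- a) (w - v)" "y - a"]
        by linarith+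
      moreover have "w = v + phi C a (phi C (- a) (w - v))" by (simp add: phi_phi)
      moreover have "y = a + (y - a)" by simp
      ultimately show ?thesis using av(1) by blast
    qed
    then show ?thesis by blast
  qed
  have "ot_lattice C \<Gamma>'"
    by unfold_locales (fact re zero_mem mult_mem inv_mem discrete cocompact)+
  then show ?thesis by blast
qed

theorem theorem1p4:
  fixes G :: "('a, 'e::euclidean_space) lie"
  assumes "lie_group G"
    and "LCK_OT_like TYPE('s::finite) TYPE('t::finite) G"
    and "\<exists>\<Gamma>. is_lattice G (mtop (mfd G)) \<Gamma>"
  shows "CARD('t) = 1 \<and>
    (\<exists>K U. \<exists>M :: ('s, 't) OT_space.
       OT_manifold K U M \<and> simple_type K U \<and> OT_associated TYPE('s) TYPE('t) G K U)"
proof -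
  obtain C :: "complex^'s^'t" where C: "\<And>i j. Re (C $ i $ j) = - 1 / (2 * real CARD('t))"
    "lie_isomorphic G (G_C C)"
    using assms(2) by (auto simp: LCK_OT_like_def)
  obtain \<Gamma> where "is_lattice G (mtop (mfd G)) \<Gamma>" using assms(3) by blast
  then obtain \<Gamma>' where "ot_lattice C \<Gamma>'" using lattice_transfer[OF assms(1) C(2) _ C(1)] by blast
  then interpret ot_lattice C \<Gamma>' .
  obtain K U and a :: "'s \<Rightarrow> complex" and \<sigma> :: "'s + 't + 't \<Rightarrow> complex \<Rightarrow> complex"
    where K: "number_field K (CARD('s) + 2 * CARD('t))" "labelling K \<sigma>" "admissible K \<sigma> U"
      "simple_type K U" "Z_basis U a"
      "\<And>i k. \<sigma> (Inr (Inl i)) (a k) =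
         exp (\<Sum>j\<in>UNIV. C $ i $ j * of_real (ln (Re (\<sigma> (Inl j) (a k)))))"
    by (rule OT_data) (rule that)
  have "OT_manifold K U (OT_quotient K U \<sigma>)"
    unfolding OT_manifold_def using K(1-3) by blast
  moreover have "OT_associated TYPE('s) TYPE('t) G K U"
    unfolding OT_associated_def using K(2,5,6) C(2) by blast
  ultimately show ?thesis using card_t_eq_1 K(4) by blast
qed

end
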